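(* Let $G$ be a second countable locally compact group such that the Fourier algebra $A(G)$ has a (perhaps unbounded) approximate identity. Let $\omega_1,\dots,\omega_k:G\to\mathbb{R}^+$ be continuous group homomorphisms, $t_1,\dots,t_k>0$, and let $F\subseteq G$ be a closed set satisfying spectral synthesis. Then the set $$F\cup\left(E_{\omega_1}^{t_1}\cap\dots\cap E_{\omega_k}^{t_k}\right)$$ satisfies spectral synthesis.
   Context: $\mathbb{R}^+$ is the multiplicative group of positive reals. For a continuous homomorphism $\omega:G\to\mathbb{R}^+$ and $t>0$, $E_\omega^t=\{x\in G:\omega(x)\le t\}$. A closed set $E\subseteq G$ satisfies spectral synthesis (is synthetic) if, in the Fourier algebra $A(G)$, every $f\in A(G)$ vanishing on $E$ lies in the norm closure of the set of functions in $A(G)$ with compact support disjoint from $E$. *)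

theory Defs
  imports "HOL-Analysis.Analysis"
begin

text \<open>
  The class \<^class>\<open>topological_group_add\<close> does not assume commutativity, so it covers all
  topological groups; the group law is merely written \<open>x + y\<close>, the inverse \<open>- x\<close>.
  Throughout, \<open>\<mu>\<close> stands for a left Haar measure on the group.
\<close>

text \<open>
  Regularity is not listed: on a second countable locally compact Hausdorff space every Borel
  measure that is finite on compact sets is regular. Invariance also forces
  \<open>sets \<mu> = sets borel\<close>.
\<close>

definition left_haar_measure :: "'a::topological_group_add measure \<Rightarrow> bool" where
  "left_haar_measure \<mu> \<longleftrightarrow>
     (\<forall>x. distr \<mu> borel (\<lambda>y. x + y) = \<mu>) \<and>
     (\<forall>K. compact K \<longrightarrow> emeasure \<mu> K < \<infinity>) \<and>
     emeasure \<mu> (space \<mu>) \<noteq> 0"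

definition L2 :: "'a measure \<Rightarrow> ('a \<Rightarrow> complex) set" where
  "L2 \<mu> = {f \<in> borel_measurable \<mu>. integrable \<mu> (\<lambda>x. (cmod (f x))\<^sup>2)}"

definition L2_norm :: "'a measure \<Rightarrow> ('a \<Rightarrow> complex) \<Rightarrow> real" where
  "L2_norm \<mu> f = sqrt (\<integral>x. (cmod (f x))\<^sup>2 \<partial>\<mu>)"

text \<open>
  The coefficient \<open>s \<mapsto> \<langle>\<lambda>\<^sub>s \<xi>, \<eta>\<rangle>\<close> of the left regular representation
  \<open>(\<lambda>\<^sub>s \<xi>)(t) = \<xi>(s\<inverse> t)\<close> on the space of square integrable functions.
\<close>

definition regular_coeff ::
  "'a::group_add measure \<Rightarrow> ('a \<Rightarrow> complex) \<Rightarrow> ('a \<Rightarrow> complex) \<Rightarrow> 'a \<Rightarrow> complex" where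
  "regular_coeff \<mu> \<xi> \<eta> s = (\<integral>t. \<xi> (- s + t) * cnj (\<eta> t) \<partial>\<mu>)"

text \<open>
  The Fourier algebra is taken as the predual of the group von Neumann algebra, realised as a
  space of functions: the image of the projective tensor product of the square integrable
  functions with their conjugate space under
  \<open>\<Sum>\<^sub>n \<xi>\<^sub>n \<otimes> \<eta>\<^sub>n \<mapsto> \<Sum>\<^sub>n \<langle>\<lambda>\<^sub>s \<xi>\<^sub>n, \<eta>\<^sub>n\<rangle>\<close>, with the quotient norm.
\<close>

definition fourier_rep ::
  "'a::group_add measure \<Rightarrow> ('a \<Rightarrow> complex) \<Rightarrow>
     (nat \<Rightarrow> 'a \<Rightarrow> complex) \<Rightarrow> (nat \<Rightarrow> 'a \<Rightarrow> complex) \<Rightarrow> bool" where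
  "fourier_rep \<mu> u \<xi> \<eta> \<longleftrightarrow>
     (\<forall>n. \<xi> n \<in> L2 \<mu> \<and> \<eta> n \<in> L2 \<mu>) \<and>
     summable (\<lambda>n. L2_norm \<mu> (\<xi> n) * L2_norm \<mu> (\<eta> n)) \<and>
     (\<forall>s. (\<lambda>n. regular_coeff \<mu> (\<xi> n) (\<eta> n) s) sums u s)"

definition fourier_algebra :: "'a::group_add measure \<Rightarrow> ('a \<Rightarrow> complex) set" where
  "fourier_algebra \<mu> = {u. \<exists>\<xi> \<eta>. fourier_rep \<mu> u \<xi> \<eta>}"

definition fourier_norm :: "'a::group_add measure \<Rightarrow> ('a \<Rightarrow> complex) \<Rightarrow> real" where
  "fourier_norm \<mu> u =
     Inf {(\<Sum>n. L2_norm \<mu> (\<xi> n) * L2_norm \<mu> (\<eta> n)) | \<xi> \<eta>. fourier_rep \<mu> u \<xi> \<eta>}"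

definition fourier_closure ::
  "'a::group_add measure \<Rightarrow> ('a \<Rightarrow> complex) set \<Rightarrow> ('a \<Rightarrow> complex) set" where
  "fourier_closure \<mu> S =
     {f \<in> fourier_algebra \<mu>. \<forall>\<epsilon>>0. \<exists>h\<in>S. fourier_norm \<mu> (\<lambda>x. f x - h x) < \<epsilon>}"

text \<open>
  A net is represented by the filter on functions that it generates; conversely every proper
  filter arises from a net. No bound on the norms is imposed.
\<close>

definition has_approximate_identity :: "'a::group_add measure \<Rightarrow> bool" where
  "has_approximate_identity \<mu> \<longleftrightarrow>
     (\<exists>\<U> :: ('a \<Rightarrow> complex) filter.
        \<U> \<noteq> bot \<and>
        (\<forall>\<^sub>F u in \<U>. u \<in> fourier_algebra \<mu>) \<and>
        (\<forall>f\<in>fourier_algebra \<mu>.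
           ((\<lambda>u. fourier_norm \<mu> (\<lambda>x. u x * f x - f x)) \<longlongrightarrow> 0) \<U>))"

definition supp :: "('a::topological_space \<Rightarrow> complex) \<Rightarrow> 'a set" where
  "supp f = closure {x. f x \<noteq> 0}"

definition spectral_synthesis :: "'a::topological_group_add measure \<Rightarrow> 'a set \<Rightarrow> bool" where
  "spectral_synthesis \<mu> E \<longleftrightarrow>
     closed E \<and>
     (\<forall>f\<in>fourier_algebra \<mu>. (\<forall>x\<in>E. f x = 0) \<longrightarrow>
        f \<in> fourier_closure \<mu>
              {h \<in> fourier_algebra \<mu>. compact (supp h) \<and> supp h \<inter> E = {}})"

definition continuous_hom_pos :: "('a::topological_group_add \<Rightarrow> real) \<Rightarrow> bool" where
  "continuous_hom_pos \<omega> \<longleftrightarrow>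
     continuous_on UNIV \<omega> \<and> (\<forall>x. 0 < \<omega> x) \<and> (\<forall>x y. \<omega> (x + y) = \<omega> x * \<omega> y)"

definition sublevel :: "('a \<Rightarrow> real) \<Rightarrow> real \<Rightarrow> 'a set" where
  "sublevel \<omega> t = {x. \<omega> x \<le> t}"

end

theory Submission imports Defs begin

text \<open>
  Put \<open>\<phi> i = ln \<circ> \<omega> i\<close> and \<open>c i = ln (t i)\<close>, and let \<open>f\<close> vanish on \<open>F\<close> and where \<open>\<phi> i \<le> c i\<close> for all \<open>i\<close>.
  By the approximate identity it suffices to approximate \<open>f * u\<close>, where \<open>u\<close> is a coefficient of two
  compactly supported functions \<open>a\<close> and \<open>b\<close>. Cut the supports of \<open>a\<close> and \<open>b\<close> along the grid of mesh \<open>\<delta>\<close> in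
  the values of the \<open>\<phi> i\<close>, shifted by \<open>c i\<close> for \<open>b\<close>; then \<open>u\<close> is a finite sum of coefficients \<open>u l m\<close>
  with \<open>\<phi> i\<close> close to \<open>c i + \<delta> * (m i - l i)\<close> on the support of \<open>u l m\<close>.
  If some \<open>m i - l i\<close> is at least 2, then \<open>u l m\<close> vanishes near the intersection of the sublevel sets and
  the synthesis of \<open>F\<close> applies to \<open>f * u l m\<close>. If some \<open>m i - l i\<close> is negative, then \<open>f * u l m\<close> vanishes
  on the larger intersection that omits \<open>i\<close>, and induction on the number of homomorphisms applies.
  The remaining cells contribute little for small \<open>\<delta>\<close>: the kernel \<open>f (t - s)\<close> is the inner product of two
  continuous Hilbert space valued functions of \<open>s\<close> and \<open>t\<close>. It vanishes where all \<open>\<phi> i t - \<phi> i s\<close> equal \<open>c i\<close>,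
  so on such a cell these functions take values close to two orthogonal subspaces.
\<close>

section \<open>Square integrable functions\<close>

text \<open>Indicators of slabs such as \<open>\<phi> i x \<le> c i\<close> are in general not
  multipliers of the Fourier algebra, but they do act on square integrable functions; this is why
  \<open>a\<close> and \<open>b\<close> are cut and not \<open>f\<close>. In the kernel
  \<open>f (t - s)\<close> the intersection of the sublevel sets becomes the set of pairs with
  \<open>\<phi> i t - \<phi> i s \<le> c i\<close> for all \<open>i\<close>, a form that respects
  cutting in \<open>s\<close> and in \<open>t\<close> separately. The obstacle is that a finer grid
  has more cells touching the boundary, so a small bound on each cell is useless on its own. What
  saves the sum is a bound proportional to the norms of the two pieces, with a small factor that is
  the same for all these cells. Pieces of \<open>a\<close> from different cells are orthogonal,
  likewise those of \<open>b\<close>, and each piece has a bounded number of partners; hence the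
  total is at most that factor times a constant that does not depend on the mesh. The uniformity of
  the factor is a compactness argument, which is the reason for passing to compactly supported
  \<open>a\<close> and \<open>b\<close>.\<close>

definition L2_inner :: "'a measure \<Rightarrow> ('a \<Rightarrow> complex) \<Rightarrow> ('a \<Rightarrow> complex) \<Rightarrow> complex" where
  "L2_inner M v w = (\<integral>x. v x * cnj (w x) \<partial>M)"

lemma L2_integrable: "v \<in> L2 M \<Longrightarrow> integrable M (\<lambda>x. (cmod (v x))\<^sup>2)"
  by (simp add: L2_def)

lemma L2_norm_nonneg [simp]: "0 \<le> L2_norm M v"
  by (simp add: L2_norm_def)

lemma L2_norm_power2: "(L2_norm M v)\<^sup>2 = (\<integral>x. (cmod (v x))\<^sup>2 \<partial>M)"
  by (simp add: L2_norm_def)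

lemma L2_boundedI:
  assumes "v \<in> borel_measurable M" "integrable M g" "\<And>x. x \<in> space M \<Longrightarrow> (cmod (v x))\<^sup>2 \<le> g x"
  shows "v \<in> L2 M"
  unfolding L2_def using assms
  by (auto intro!: Bochner_Integration.integrable_bound[OF assms(2)] AE_I2 order_trans[OF _ abs_ge_self])

lemma L2_zero [simp]: "(\<lambda>x. 0) \<in> L2 M"
  by (simp add: L2_def)

lemma L2_scale [intro]: "v \<in> L2 M \<Longrightarrow> (\<lambda>x. c * v x) \<in> L2 M"
  by (auto simp: L2_def norm_mult power_mult_distrib)

lemma L2_add [intro]:
  assumes "v \<in> L2 M" "w \<in> L2 M" shows "(\<lambda>x. v x + w x) \<in> L2 M"
proof (rule L2_boundedI)
  show "integrable M (\<lambda>x. 2 * (cmod (v x))\<^sup>2 + 2 * (cmod (w x))\<^sup>2)"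
    using assms by (simp add: L2_def)
  fix x
  have "(cmod (v x + w x))\<^sup>2 \<le> (cmod (v x) + cmod (w x))\<^sup>2"
    by (simp add: norm_triangle_ineq power_mono)
  also have "\<dots> \<le> 2 * (cmod (v x))\<^sup>2 + 2 * (cmod (w x))\<^sup>2"
    using sum_squares_bound[of "cmod (v x)" "cmod (w x)"] by (simp add: power2_sum)
  finally show "(cmod (v x + w x))\<^sup>2 \<le> 2 * (cmod (v x))\<^sup>2 + 2 * (cmod (w x))\<^sup>2" .
qed (use assms in \<open>auto simp: L2_def\<close>)

lemma L2_diff [intro]: "v \<in> L2 M \<Longrightarrow> w \<in> L2 M \<Longrightarrow> (\<lambda>x. v x - w x) \<in> L2 M"
  using L2_add[of v M "\<lambda>x. - 1 * w x"] L2_scale[of w M "- 1"] by simp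

lemma L2_sum [intro]: "(\<And>i. i \<in> I \<Longrightarrow> v i \<in> L2 M) \<Longrightarrow> (\<lambda>x. \<Sum>i\<in>I. v i x) \<in> L2 M"
  by (induction I rule: infinite_finite_induct) auto

lemma L2_lincomb [intro, simp]:
  "(\<And>i. i \<in> I \<Longrightarrow> v i \<in> L2 M) \<Longrightarrow> (\<lambda>x. \<Sum>i\<in>I. c i * v i x) \<in> L2 M"
  by (rule L2_sum) auto

lemma L2_indicator_mult [intro]:
  assumes "v \<in> L2 M" "A \<in> sets M" shows "(\<lambda>x. indicator A x * v x) \<in> L2 M"
  by (rule L2_boundedI[OF _ L2_integrable[OF assms(1)]])
    (use assms in \<open>auto simp: L2_def indicator_def intro!: borel_measurable_times\<close>)

lemma L2_norm_scale [simp]: "L2_norm M (\<lambda>x. c * v x) = cmod c * L2_norm M v"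
  by (simp add: L2_norm_def norm_mult power_mult_distrib real_sqrt_mult)

lemma L2_norm_zero [simp]: "L2_norm M (\<lambda>x. 0) = 0"
  by (simp add: L2_norm_def)

lemma L2_norm_minus_commute: "L2_norm M (\<lambda>x. v x - w x) = L2_norm M (\<lambda>x. w x - v x)"
  by (simp add: L2_norm_def norm_minus_commute)

lemma L2_norm_mono:
  assumes "v \<in> borel_measurable M" "w \<in> L2 M" "\<And>x. x \<in> space M \<Longrightarrow> cmod (v x) \<le> cmod (w x)"
  shows "v \<in> L2 M" "L2_norm M v \<le> L2_norm M w"
proof -
  show v: "v \<in> L2 M"
    by (rule L2_boundedI[OF assms(1) L2_integrable[OF assms(2)]]) (simp add: assms(3) power_mono)
  show "L2_norm M v \<le> L2_norm M w"
    unfolding L2_norm_def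
    by (intro real_sqrt_le_mono integral_mono L2_integrable v assms power_mono) auto
qed

lemma L2_mult_integrable:
  assumes "v \<in> L2 M" "w \<in> L2 M"
  shows "integrable M (\<lambda>x. v x * cnj (w x))" "integrable M (\<lambda>x. cmod (v x) * cmod (w x))"
proof -
  have [measurable]: "v \<in> borel_measurable M" "w \<in> borel_measurable M"
    using assms by (auto simp: L2_def)
  have [measurable]: "(\<lambda>x. cnj (w x)) \<in> borel_measurable M"
    by (rule borel_measurable_continuous_on[where f=cnj and M=M and g=w]) (auto intro!: continuous_intros)
  have i: "integrable M (\<lambda>x. (cmod (v x))\<^sup>2 + (cmod (w x))\<^sup>2)"
    using assms by (simp add: L2_def)
  have b: "cmod (v x) * cmod (w x) \<le> (cmod (v x))\<^sup>2 + (cmod (w x))\<^sup>2" for x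
    using sum_squares_bound[of "cmod (v x)" "cmod (w x)"]
      mult_nonneg_nonneg[OF norm_ge_zero[of "v x"] norm_ge_zero[of "w x"]] by linarith
  show "integrable M (\<lambda>x. v x * cnj (w x))" "integrable M (\<lambda>x. cmod (v x) * cmod (w x))"
    using b by (auto intro!: Bochner_Integration.integrable_bound[OF i] AE_I2 simp: norm_mult)
qed

text \<open>The moduli stay inside the integral because this form later justifies exchanging a
  series with an integral.\<close>

lemma L2_Cauchy_Schwarz_abs:
  assumes v: "v \<in> L2 M" and w: "w \<in> L2 M"
  shows "(\<integral>x. cmod (v x) * cmod (w x) \<partial>M) \<le> L2_norm M v * L2_norm M w"
proof (cases "L2_norm M v * L2_norm M w = 0")
  \<comment> \<open>Vanishing norm only gives vanishing almost everywhere. The case is separate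
    because the main argument divides by the product of the norms.\<close>
  case True
  have z: "AE x in M. u x = 0" if "u \<in> L2 M" "L2_norm M u = 0" for u
  proof -
    have "AE x in M. (cmod (u x))\<^sup>2 = 0"
      using integral_nonneg_eq_0_iff_AE[OF L2_integrable[OF that(1)]] that(2)
      by (simp add: L2_norm_def)
    then show ?thesis by simp
  qed
  have "AE x in M. cmod (v x) * cmod (w x) = 0"
  proof (cases "L2_norm M v = 0")
    case True
    show ?thesis using z[OF v True] by eventually_elim simp
  next
    case False
    with \<open>L2_norm M v * L2_norm M w = 0\<close> have "L2_norm M w = 0" by simp
    from z[OF w this] show ?thesis by eventually_elim simp
  qed
  then have "(\<integral>x. cmod (v x) * cmod (w x) \<partial>M) = 0"
    by (rule integral_eq_zero_AE)
  with True show ?thesis by simp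
next
  case False
  define a where "a = L2_norm M v"
  define b where "b = L2_norm M w"
  have pos: "a * b > 0" using False by (simp add: a_def b_def less_le)
  let ?I = "\<integral>x. cmod (v x) * cmod (w x) \<partial>M"
  \<comment> \<open>With these weights both square terms integrate to
    \<open>a\<^sup>2 * b\<^sup>2\<close>, so that the inequality only has to be divided by
    \<open>2 * a * b\<close>.\<close>
  have "0 \<le> (\<integral>x. (b * cmod (v x) - a * cmod (w x))\<^sup>2 \<partial>M)" by simp
  also have "\<dots> = (\<integral>x. b\<^sup>2 * (cmod (v x))\<^sup>2 + a\<^sup>2 * (cmod (w x))\<^sup>2
      - (2 * a * b) * (cmod (v x) * cmod (w x)) \<partial>M)"
    by (rule Bochner_Integration.integral_cong) (auto simp: power2_eq_square algebra_simps)
  also have "\<dots> = b\<^sup>2 * a\<^sup>2 + a\<^sup>2 * b\<^sup>2 - (2 * a * b) * ?I"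
    using L2_integrable[OF v] L2_integrable[OF w] L2_mult_integrable(2)[OF v w]
    by (simp add: a_def b_def L2_norm_power2 del: mult_minus_left)
  finally have "(2 * a * b) * ?I \<le> (2 * a * b) * (a * b)"
    by (simp add: power2_eq_square algebra_simps)
  moreover have "0 < 2 * a * b" using pos by simp
  ultimately have "?I \<le> a * b" by (rule mult_left_le_imp_le)
  then show ?thesis by (simp add: a_def b_def)
qed

lemma L2_Cauchy_Schwarz:
  assumes "v \<in> L2 M" "w \<in> L2 M"
  shows "cmod (L2_inner M v w) \<le> L2_norm M v * L2_norm M w"
proof -
  have "cmod (L2_inner M v w) \<le> (\<integral>x. cmod (v x) * cmod (w x) \<partial>M)"
    unfolding L2_inner_def using integral_norm_bound[of M "\<lambda>x. v x * cnj (w x)"]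
    by (simp add: norm_mult)
  with L2_Cauchy_Schwarz_abs[OF assms] show ?thesis by simp
qed

lemma L2_norm_add:
  assumes v: "v \<in> L2 M" and w: "w \<in> L2 M"
  shows "L2_norm M (\<lambda>x. v x + w x) \<le> L2_norm M v + L2_norm M w"
proof (rule power2_le_imp_le)
  have "(L2_norm M (\<lambda>x. v x + w x))\<^sup>2
      \<le> (\<integral>x. (cmod (v x))\<^sup>2 + (cmod (w x))\<^sup>2 + 2 * (cmod (v x) * cmod (w x)) \<partial>M)"
    unfolding L2_norm_power2
  proof (rule integral_mono)
    fix x
    have "(cmod (v x + w x))\<^sup>2 \<le> (cmod (v x) + cmod (w x))\<^sup>2"
      by (simp add: norm_triangle_ineq power_mono)
    then show "(cmod (v x + w x))\<^sup>2
      \<le> (cmod (v x))\<^sup>2 + (cmod (w x))\<^sup>2 + 2 * (cmod (v x) * cmod (w x))"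
      by (simp add: power2_sum algebra_simps)
  qed (use L2_integrable[OF L2_add[OF v w]] L2_integrable[OF v] L2_integrable[OF w]
      L2_mult_integrable(2)[OF v w] in auto)
  also have "\<dots> = (L2_norm M v)\<^sup>2 + (L2_norm M w)\<^sup>2 + 2 * (\<integral>x. cmod (v x) * cmod (w x) \<partial>M)"
    using L2_integrable[OF v] L2_integrable[OF w] L2_mult_integrable(2)[OF v w]
    by (simp add: L2_norm_power2)
  also have "\<dots> \<le> (L2_norm M v + L2_norm M w)\<^sup>2"
    using L2_Cauchy_Schwarz_abs[OF v w] by (simp add: power2_sum)
  finally show "(L2_norm M (\<lambda>x. v x + w x))\<^sup>2 \<le> (L2_norm M v + L2_norm M w)\<^sup>2" .
qed simp

lemma L2_norm_diff_triangle:
  assumes "u \<in> L2 M" "v \<in> L2 M" "w \<in> L2 M"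
  shows "L2_norm M (\<lambda>x. u x - w x) \<le> L2_norm M (\<lambda>x. u x - v x) + L2_norm M (\<lambda>x. v x - w x)"
  using L2_norm_add[of "\<lambda>x. u x - v x" M "\<lambda>x. v x - w x"] assms by (simp add: L2_diff)

lemma L2_norm_diff: 
  assumes "v \<in> L2 M" "w \<in> L2 M"
  shows "L2_norm M (\<lambda>x. v x - w x) \<le> L2_norm M v + L2_norm M w"
  using L2_norm_diff_triangle[of v M "\<lambda>x. 0" w] assms L2_norm_minus_commute[of M "\<lambda>x. 0" w] by simp

section \<open>Sesquilinearity of the inner product\<close>

lemma L2_inner_add_left:
  "u \<in> L2 M \<Longrightarrow> v \<in> L2 M \<Longrightarrow> w \<in> L2 M \<Longrightarrow>
    L2_inner M (\<lambda>x. u x + v x) w = L2_inner M u w + L2_inner M v w"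
  by (simp add: L2_inner_def distrib_right L2_mult_integrable)

lemma L2_inner_diff_left:
  "u \<in> L2 M \<Longrightarrow> v \<in> L2 M \<Longrightarrow> w \<in> L2 M \<Longrightarrow>
    L2_inner M (\<lambda>x. u x - v x) w = L2_inner M u w - L2_inner M v w"
  by (simp add: L2_inner_def left_diff_distrib L2_mult_integrable)

lemma L2_inner_scale_left: "L2_inner M (\<lambda>x. c * v x) w = c * L2_inner M v w"
  by (simp add: L2_inner_def mult.assoc)

lemma L2_inner_commute: "L2_inner M v w = cnj (L2_inner M w v)"
  by (simp add: L2_inner_def mult.commute flip: Bochner_Integration.integral_cnj)

lemma L2_inner_zero [simp]: "L2_inner M (\<lambda>x. 0) w = 0" "L2_inner M w (\<lambda>x. 0) = 0"
  by (simp_all add: L2_inner_def)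

lemma L2_inner_sum_left:
  assumes "\<And>i. i \<in> I \<Longrightarrow> v i \<in> L2 M" "w \<in> L2 M"
  shows "L2_inner M (\<lambda>x. \<Sum>i\<in>I. v i x) w = (\<Sum>i\<in>I. L2_inner M (v i) w)"
  using assms
  by (induction I rule: infinite_finite_induct) (simp_all add: L2_inner_add_left L2_sum)

lemma L2_inner_diff_right:
  "u \<in> L2 M \<Longrightarrow> v \<in> L2 M \<Longrightarrow> w \<in> L2 M \<Longrightarrow>
    L2_inner M w (\<lambda>x. u x - v x) = L2_inner M w u - L2_inner M w v"
  using L2_inner_diff_left[of u M v w] by (simp add: L2_inner_commute[of M w])

lemma L2_inner_scale_right: "L2_inner M v (\<lambda>x. c * w x) = cnj c * L2_inner M v w"
  using L2_inner_scale_left[of M c w v] by (simp add: L2_inner_commute[of M v])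

lemma L2_inner_sum_right:
  assumes "\<And>i. i \<in> I \<Longrightarrow> v i \<in> L2 M" "w \<in> L2 M"
  shows "L2_inner M w (\<lambda>x. \<Sum>i\<in>I. v i x) = (\<Sum>i\<in>I. L2_inner M w (v i))"
  using L2_inner_sum_left[of I v M w] assms by (simp add: L2_inner_commute[of M w])

lemma L2_inner_lincomb_left:
  assumes "\<And>i. i \<in> I \<Longrightarrow> v i \<in> L2 M" "w \<in> L2 M"
  shows "L2_inner M (\<lambda>x. \<Sum>i\<in>I. c i * v i x) w = (\<Sum>i\<in>I. c i * L2_inner M (v i) w)"
  using L2_inner_sum_left[of I "\<lambda>i x. c i * v i x" M w] assms
  by (simp add: L2_scale L2_inner_scale_left)

lemma L2_inner_lincomb_right:
  assumes "\<And>i. i \<in> I \<Longrightarrow> v i \<in> L2 M" "w \<in> L2 M"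
  shows "L2_inner M w (\<lambda>x. \<Sum>i\<in>I. c i * v i x) = (\<Sum>i\<in>I. cnj (c i) * L2_inner M w (v i))"
  using L2_inner_sum_right[of I "\<lambda>i x. c i * v i x" M w] assms
  by (simp add: L2_scale L2_inner_scale_right)

lemma L2_inner_self: "L2_inner M v v = of_real ((L2_norm M v)\<^sup>2)"
proof -
  have "L2_inner M v v = (\<integral>x. complex_of_real ((cmod (v x))\<^sup>2) \<partial>M)"
    unfolding L2_inner_def by (simp only: complex_norm_square)
  then show ?thesis by (simp add: L2_norm_power2 del: of_real_power)
qed

section \<open>Gram-Schmidt orthogonalisation\<close>

text \<open>Since \<open>r / 0 = 0\<close>, vectors that depend on their predecessors are sent to zero.\<close>

fun gram_schmidt :: "'a measure \<Rightarrow> (nat \<Rightarrow> 'a \<Rightarrow> complex) \<Rightarrow> nat \<Rightarrow> 'a \<Rightarrow> complex" where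
  [simp del]: "gram_schmidt M v n =
    (let r = (\<lambda>x. v n x - (\<Sum>i\<in>{..<n}. L2_inner M (v n) (gram_schmidt M v i) * gram_schmidt M v i x))
     in (\<lambda>x. r x / complex_of_real (L2_norm M r)))"

text \<open>Gives a name to the remainder \<open>r\<close>, which is local to the recursion of
  \<open>gram_schmidt\<close>.\<close>

definition gs_rem :: "'a measure \<Rightarrow> (nat \<Rightarrow> 'a \<Rightarrow> complex) \<Rightarrow> nat \<Rightarrow> 'a \<Rightarrow> complex" where
  "gs_rem M v n =
    (\<lambda>x. v n x - (\<Sum>i<n. L2_inner M (v n) (gram_schmidt M v i) * gram_schmidt M v i x))"

lemma gram_schmidt_eq:
  "gram_schmidt M v n = (\<lambda>x. inverse (complex_of_real (L2_norm M (gs_rem M v n))) * gs_rem M v n x)"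
  by (subst gram_schmidt.simps) (simp add: Let_def gs_rem_def field_simps)

lemma gram_schmidt_L2:
  assumes "\<And>n. v n \<in> L2 M" shows "gram_schmidt M v n \<in> L2 M"
proof (induction n rule: less_induct)
  case (less n)
  have "gs_rem M v n \<in> L2 M"
    unfolding gs_rem_def using assms less by (intro L2_scale L2_diff L2_sum) auto
  then show ?case by (subst gram_schmidt_eq) (rule L2_scale)
qed

lemma gs_rem_L2:
  assumes "\<And>n. v n \<in> L2 M" shows "gs_rem M v n \<in> L2 M"
  unfolding gs_rem_def using assms gram_schmidt_L2[OF assms] by (intro L2_scale L2_diff L2_sum) auto

definition orthonormal_or_zero :: "'a measure \<Rightarrow> (nat \<Rightarrow> 'a \<Rightarrow> complex) \<Rightarrow> bool" where
  "orthonormal_or_zero M e \<longleftrightarrow> (\<forall>n. e n \<in> L2 M) \<and>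
     (\<forall>i j. i \<noteq> j \<longrightarrow> L2_inner M (e i) (e j) = 0) \<and>
     (\<forall>i. e i = (\<lambda>x. 0) \<or> L2_norm M (e i) = 1)"

lemma gram_schmidt_orthonormal:
  assumes v: "\<And>n. v n \<in> L2 M"
  shows "orthonormal_or_zero M (gram_schmidt M v)"
proof -
  let ?e = "gram_schmidt M v"
  note eL = gram_schmidt_L2[of v M, OF v]
  note rL = gs_rem_L2[of v M, OF v]
  have unit: "?e i = (\<lambda>x. 0) \<or> L2_norm M (?e i) = 1" for i
    unfolding gram_schmidt_eq[of M v i] by (cases "L2_norm M (gs_rem M v i) = 0") (auto simp: norm_inverse)
  have self: "L2_inner M (u) (?e i) * L2_inner M (?e i) (?e i) = L2_inner M u (?e i)" for u i
    using unit[of i] by (auto simp: L2_inner_self)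
  have orth: "\<forall>i<n. L2_inner M (?e n) (?e i) = 0" for n
  proof (induction n rule: less_induct)
    case (less n)
    have sym: "L2_inner M (?e i) (?e j) = 0" if "i < n" "j < n" "i \<noteq> j" for i j
      using less[of i] less[of j] that L2_inner_commute[of M "?e i" "?e j"]
      by (cases "i < j") auto
    show ?case
    proof (intro allI impI)
      fix i assume i: "i < n"
      have "L2_inner M (gs_rem M v n) (?e i) = L2_inner M (v n) (?e i)
          - (\<Sum>j<n. L2_inner M (v n) (?e j) * L2_inner M (?e j) (?e i))"
        unfolding gs_rem_def using v eL
        by (subst L2_inner_diff_left) (auto simp: L2_inner_lincomb_left)
      also have "(\<Sum>j<n. L2_inner M (v n) (?e j) * L2_inner M (?e j) (?e i))
          = (\<Sum>j<n. if j = i then L2_inner M (v n) (?e i) else 0)"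
        using sym i self by (intro sum.cong) auto
      finally have "L2_inner M (gs_rem M v n) (?e i) = 0" using i by simp
      then show "L2_inner M (?e n) (?e i) = 0"
        by (simp add: gram_schmidt_eq[of M v n] L2_inner_scale_left)
    qed
  qed
  show ?thesis
    unfolding orthonormal_or_zero_def
  proof (intro conjI allI impI eL unit)
    fix i j :: nat assume "i \<noteq> j"
    then show "L2_inner M (?e i) (?e j) = 0"
      using orth[of i] orth[of j] L2_inner_commute[of M "?e i" "?e j"] by (cases "i < j") auto
  qed
qed

section \<open>Bessel's inequality and Parseval's identity\<close>

lemma onz_self:
  assumes "orthonormal_or_zero M e"
  shows "L2_inner M u (e i) * L2_inner M (e i) (e i) = L2_inner M u (e i)"
proof -
  have "e i = (\<lambda>x. 0) \<or> L2_norm M (e i) = 1"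
    using assms unfolding orthonormal_or_zero_def by blast
  then show ?thesis by (auto simp: L2_inner_self)
qed

text \<open>Pythagoras for the projection onto the span of the chosen members; all three cross terms
  equal the sum of squares.\<close>

lemma onz_partial_norm:
  assumes e: "orthonormal_or_zero M e" and w: "w \<in> L2 M" and I: "finite I"
  shows "(L2_norm M (\<lambda>x. w x - (\<Sum>i\<in>I. L2_inner M w (e i) * e i x)))\<^sup>2
    = (L2_norm M w)\<^sup>2 - (\<Sum>i\<in>I. (cmod (L2_inner M w (e i)))\<^sup>2)"
proof -
  have eL: "e n \<in> L2 M" for n using e unfolding orthonormal_or_zero_def by blast
  let ?s = "\<lambda>x. \<Sum>i\<in>I. L2_inner M w (e i) * e i x"
  have sL: "?s \<in> L2 M" using eL by auto
  have so: "L2_inner M (e j) ?s = cnj (L2_inner M w (e j))" if "j \<in> I" for j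
  proof -
    have "L2_inner M (e j) ?s = (\<Sum>i\<in>I. cnj (L2_inner M w (e i)) * L2_inner M (e j) (e i))"
      using eL by (intro L2_inner_lincomb_right) auto
    also have "\<dots> = (\<Sum>i\<in>I. if i = j then cnj (L2_inner M w (e j) * L2_inner M (e j) (e j)) else 0)"
      using e by (intro sum.cong) (auto simp: orthonormal_or_zero_def L2_inner_self)
    finally show ?thesis using that I by (simp add: onz_self[OF e] del: complex_cnj_mult)
  qed
  have ss: "L2_inner M ?s ?s = (\<Sum>i\<in>I. L2_inner M w (e i) * cnj (L2_inner M w (e i)))"
    using eL sL so by (subst L2_inner_lincomb_left) (auto intro!: sum.cong)
  have ws: "L2_inner M w ?s = (\<Sum>i\<in>I. L2_inner M w (e i) * cnj (L2_inner M w (e i)))"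
    using eL w by (subst L2_inner_lincomb_right) (auto simp: mult.commute)
  have sw: "L2_inner M ?s w = (\<Sum>i\<in>I. L2_inner M w (e i) * cnj (L2_inner M w (e i)))"
    using ws by (subst L2_inner_commute) (simp add: mult.commute)
  have "complex_of_real ((L2_norm M (\<lambda>x. w x - ?s x))\<^sup>2)
      = L2_inner M w w - L2_inner M w ?s - (L2_inner M ?s w - L2_inner M ?s ?s)"
    unfolding L2_inner_self[symmetric] using w sL
    by (simp add: L2_inner_diff_left L2_inner_diff_right L2_diff)
  also have "\<dots> = complex_of_real ((L2_norm M w)\<^sup>2 - (\<Sum>i\<in>I. (cmod (L2_inner M w (e i)))\<^sup>2))"
    unfolding ss ws sw by (simp add: L2_inner_self complex_norm_square del: of_real_power)
  finally show ?thesis by (simp only: of_real_eq_iff)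
qed

lemma onz_Bessel:
  assumes "orthonormal_or_zero M e" "w \<in> L2 M" "finite I"
  shows "(\<Sum>i\<in>I. (cmod (L2_inner M w (e i)))\<^sup>2) \<le> (L2_norm M w)\<^sup>2"
  using onz_partial_norm[OF assms] zero_le_power2[of "L2_norm M (\<lambda>x. w x - (\<Sum>i\<in>I. L2_inner M w (e i) * e i x))"]
  by linarith

text \<open>The first \<open>Suc j\<close> members already reproduce \<open>v j\<close> up to norm
  0, by construction of the \<open>j\<close>-th member. Further members can only lower the distance,
  since they enlarge the sum of squares. Equality of functions may fail, because a remainder of norm
  0 that is not identically 0 is also sent to zero.\<close>

lemma gram_schmidt_span:
  assumes v: "\<And>n. v n \<in> L2 M" and "j < n"
  shows "L2_norm M (\<lambda>x. v j x - (\<Sum>i<n. L2_inner M (v j) (gram_schmidt M v i) * gram_schmidt M v i x)) = 0"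
proof -
  let ?e = "gram_schmidt M v"
  note on = gram_schmidt_orthonormal[of v M, OF v]
  have eL: "?e n \<in> L2 M" for n using gram_schmidt_L2[of v M] v by blast
  have rL: "gs_rem M v n \<in> L2 M" for n using gs_rem_L2[of v M] v by blast
  define N where "N = L2_norm M (gs_rem M v j)"
  have "L2_inner M (gs_rem M v j) (?e j) = L2_inner M (v j) (?e j)
          - (\<Sum>i<j. L2_inner M (v j) (?e i) * L2_inner M (?e i) (?e j))"
    unfolding gs_rem_def using v eL
    by (subst L2_inner_diff_left) (auto simp: L2_inner_lincomb_left)
  also have "(\<Sum>i<j. L2_inner M (v j) (?e i) * L2_inner M (?e i) (?e j)) = 0"
    using on by (intro sum.neutral) (auto simp: orthonormal_or_zero_def)
  finally have a: "L2_inner M (v j) (?e j) = L2_inner M (gs_rem M v j) (?e j)" by simp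
  also have "\<dots> = complex_of_real N"
    unfolding gram_schmidt_eq[of M v j] L2_inner_scale_right L2_inner_self N_def
    by (cases "L2_norm M (gs_rem M v j) = 0") (auto simp: field_simps power2_eq_square)
  finally have b: "L2_inner M (v j) (?e j) = complex_of_real N" .
  have partial: "L2_norm M (\<lambda>x. v j x - (\<Sum>i<Suc j. L2_inner M (v j) (?e i) * ?e i x)) = 0"
  \<comment> \<open>If \<open>N = 0\<close>, the \<open>j\<close>-th member is zero and the
    remainder itself has norm 0; otherwise the remainder is \<open>N\<close> times the
    \<open>j\<close>-th member and the difference vanishes pointwise.\<close>
  proof (cases "N = 0")
    case True
    then show ?thesis using b by (simp add: N_def gs_rem_def)
  next
    case False
    have "v j x - (\<Sum>i<Suc j. L2_inner M (v j) (?e i) * ?e i x) = 0" for x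
    proof -
      have "complex_of_real N * ?e j x = gs_rem M v j x"
        using False by (subst gram_schmidt_eq) (simp add: N_def)
      then show ?thesis using b by (simp add: gs_rem_def algebra_simps)
    qed
    then show ?thesis by simp
  qed
  have "(\<Sum>i<Suc j. (cmod (L2_inner M (v j) (?e i)))\<^sup>2) \<le> (\<Sum>i<n. (cmod (L2_inner M (v j) (?e i)))\<^sup>2)"
    using \<open>j < n\<close> by (intro sum_mono2) auto
  then have "(L2_norm M (\<lambda>x. v j x - (\<Sum>i<n. L2_inner M (v j) (?e i) * ?e i x)))\<^sup>2 \<le> 0"
    using onz_partial_norm[OF on v[of j], of "{..<Suc j}"] onz_partial_norm[OF on v[of j], of "{..<n}"]
    by (simp add: partial del: sum.lessThan_Suc)
  then show ?thesis by simp
qed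

text \<open>The members before \<open>i\<close> already exhaust the squared norm of
  \<open>v j\<close>, so Bessel's inequality leaves nothing for the coefficient at
  \<open>i\<close>.\<close>

lemma gram_schmidt_inner_beyond:
  assumes v: "\<And>n. v n \<in> L2 M" and "j < i"
  shows "L2_inner M (v j) (gram_schmidt M v i) = 0"
proof -
  note on = gram_schmidt_orthonormal[of v M, OF v]
  have "(L2_norm M (v j))\<^sup>2 = (\<Sum>k<i. (cmod (L2_inner M (v j) (gram_schmidt M v k)))\<^sup>2)"
    using onz_partial_norm[OF on v[of j], of "{..<i}"] gram_schmidt_span[of v M, OF v \<open>j < i\<close>] by simp
  moreover have "(\<Sum>k<Suc i. (cmod (L2_inner M (v j) (gram_schmidt M v k)))\<^sup>2) \<le> (L2_norm M (v j))\<^sup>2"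
    by (rule onz_Bessel[OF on v]) simp
  ultimately show ?thesis by simp
qed

lemma gram_schmidt_orthogonal:
  assumes v: "\<And>n. v n \<in> L2 M" and u: "u \<in> L2 M"
    and "\<And>j. j < n \<Longrightarrow> L2_inner M u (v j) = 0" "i < n"
  shows "L2_inner M u (gram_schmidt M v i) = 0"
  using \<open>i < n\<close>
proof (induction i rule: less_induct)
  case (less i)
  have eL: "gram_schmidt M v n \<in> L2 M" for n using gram_schmidt_L2[of v M] v by blast
  have "L2_inner M u (gs_rem M v i) = 0"
    unfolding gs_rem_def using v eL u less assms(3)
    by (subst L2_inner_diff_right) (auto simp: L2_inner_lincomb_right)
  then show ?case
    by (subst gram_schmidt_eq) (simp add: L2_inner_scale_right)
qed

text \<open>Only \<open>u\<close> has to be a limit of the vectors \<open>v j\<close>;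
  \<open>w\<close> is arbitrary, because the partial sums are inner products of \<open>w\<close>
  with projections of \<open>u\<close>. In the application \<open>u\<close> ranges over the vectors
  built from \<open>\<xi>\<close>, and the system is adapted to those alone.\<close>

lemma gram_schmidt_Parseval:
  assumes v: "\<And>n. v n \<in> L2 M" and u: "u \<in> L2 M" and w: "w \<in> L2 M"
    and dense: "\<And>\<epsilon>. \<epsilon> > 0 \<Longrightarrow> \<exists>j. L2_norm M (\<lambda>x. u x - v j x) < \<epsilon>"
  shows "(\<lambda>i. L2_inner M u (gram_schmidt M v i) * cnj (L2_inner M w (gram_schmidt M v i)))
    sums L2_inner M u w"
proof -
  let ?e = "gram_schmidt M v"
  let ?P = "\<lambda>n u x. \<Sum>i<n. L2_inner M u (?e i) * ?e i x"
  note on = gram_schmidt_orthonormal[of v M, OF v]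
  have eL: "?e n \<in> L2 M" for n using gram_schmidt_L2[of v M] v by blast
  have PL: "?P n u \<in> L2 M" for n u using eL by auto
  have part: "(\<Sum>i<n. L2_inner M u (?e i) * cnj (L2_inner M w (?e i))) = L2_inner M (?P n u) w" for n
  proof -
    have "L2_inner M (?P n u) w = (\<Sum>i<n. L2_inner M u (?e i) * L2_inner M (?e i) w)"
      using eL w by (intro L2_inner_lincomb_left) auto
    then show ?thesis by (simp flip: L2_inner_commute[of M _ w])
  qed
  have close: "\<exists>j. \<forall>n>j. L2_norm M (\<lambda>x. u x - ?P n u x) < \<epsilon>" if "\<epsilon> > 0" for \<epsilon>
  proof -
    obtain j where j: "L2_norm M (\<lambda>x. u x - v j x) < \<epsilon>"
      using dense[OF \<open>\<epsilon> > 0\<close>] by blast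
    have "L2_norm M (\<lambda>x. u x - ?P n u x) < \<epsilon>" if "j < n" for n
    proof -
      \<comment> \<open>The error for \<open>u\<close> splits into the errors for \<open>?d\<close>
        and for \<open>v j\<close>: the second has norm 0 once \<open>j < n\<close>, and the first
        is at most the norm of \<open>?d\<close>.\<close>
      let ?d = "\<lambda>x. u x - v j x"
      have dL: "?d \<in> L2 M" using u v by auto
      have eq: "u x - ?P n u x = (?d x - ?P n ?d x) + (v j x - ?P n (v j) x)" for x
        using u v eL by (simp add: L2_inner_diff_left left_diff_distrib sum_subtractf)
      have "L2_norm M (\<lambda>x. u x - ?P n u x)
          \<le> L2_norm M (\<lambda>x. ?d x - ?P n ?d x) + L2_norm M (\<lambda>x. v j x - ?P n (v j) x)"
        unfolding eq by (intro L2_norm_add L2_diff[OF dL PL] L2_diff[OF v PL])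
      also have "\<dots> = L2_norm M (\<lambda>x. ?d x - ?P n ?d x)"
        using gram_schmidt_span[of v M, OF v that] by simp
      also have "\<dots> \<le> L2_norm M ?d"
      proof (rule power2_le_imp_le)
        show "(L2_norm M (\<lambda>x. ?d x - ?P n ?d x))\<^sup>2 \<le> (L2_norm M ?d)\<^sup>2"
          using onz_partial_norm[OF on dL, of "{..<n}"] by (simp add: sum_nonneg)
      qed simp
      finally show ?thesis using j by simp
    qed
    then show ?thesis by blast
  qed
  show ?thesis
    unfolding sums_def part
  proof (rule LIMSEQ_I)
    fix r :: real assume "0 < r"
    define \<epsilon> where "\<epsilon> = r / (L2_norm M w + 1)"
    have w1: "L2_norm M w + 1 > 0" by (simp add: add_nonneg_pos)
    then have "\<epsilon> > 0" using \<open>0 < r\<close> by (simp add: \<epsilon>_def)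
    from close[OF this] obtain j where j: "\<And>n. n > j \<Longrightarrow> L2_norm M (\<lambda>x. u x - ?P n u x) < \<epsilon>" by blast
    have "cmod (L2_inner M (?P n u) w - L2_inner M u w) < r" if "n \<ge> Suc j" for n
    proof -
      have "cmod (L2_inner M (?P n u) w - L2_inner M u w) = cmod (L2_inner M (\<lambda>x. u x - ?P n u x) w)"
        using u w PL by (simp add: L2_inner_diff_left norm_minus_commute)
      also have "\<dots> \<le> L2_norm M (\<lambda>x. u x - ?P n u x) * L2_norm M w"
        by (rule L2_Cauchy_Schwarz[OF L2_diff[OF u PL] w])
      also have "\<dots> \<le> L2_norm M (\<lambda>x. u x - ?P n u x) * (L2_norm M w + 1)"
        by (simp add: mult_left_mono)
      also have "\<dots> < \<epsilon> * (L2_norm M w + 1)"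
        using j[of n] that w1 by (intro mult_strict_right_mono) auto
      also have "\<dots> = r" using w1 by (simp add: \<epsilon>_def)
      finally show ?thesis .
    qed
    then show "\<exists>no. \<forall>n\<ge>no. cmod (L2_inner M (?P n u) w - L2_inner M u w) < r" by blast
  qed
qed

lemma L2_norm_dominated_convergence:
  assumes g: "\<And>n. g n \<in> borel_measurable M" and v: "v \<in> borel_measurable M" and w: "w \<in> L2 M"
    and lim: "\<And>x. x \<in> space M \<Longrightarrow> (\<lambda>n. g n x) \<longlonglongrightarrow> v x"
    and bound: "\<And>n x. x \<in> space M \<Longrightarrow> cmod (g n x) \<le> cmod (w x)"
  shows "(\<lambda>n. L2_norm M (\<lambda>x. v x - g n x)) \<longlonglongrightarrow> 0"
proof -
  have vb: "cmod (v x) \<le> cmod (w x)" if "x \<in> space M" for x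
    by (rule LIMSEQ_le_const2[OF tendsto_norm[OF lim[OF that]]]) (use bound that in auto)
  have "(\<lambda>n. \<integral>x. (cmod (v x - g n x))\<^sup>2 \<partial>M) \<longlonglongrightarrow> (\<integral>x. 0 \<partial>M)"
  proof (rule integral_dominated_convergence)
    show "integrable M (\<lambda>x. 4 * (cmod (w x))\<^sup>2)" using w by (simp add: L2_def)
    show "AE x in M. (\<lambda>n. (cmod (v x - g n x))\<^sup>2) \<longlonglongrightarrow> 0"
    proof (rule AE_I2)
      fix x assume "x \<in> space M"
      have "(\<lambda>n. (cmod (v x - g n x))\<^sup>2) \<longlonglongrightarrow> (cmod (v x - v x))\<^sup>2"
        by (intro tendsto_intros lim[OF \<open>x \<in> space M\<close>])
      then show "(\<lambda>n. (cmod (v x - g n x))\<^sup>2) \<longlonglongrightarrow> 0" by simp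
    qed
    fix n
    show "AE x in M. norm ((cmod (v x - g n x))\<^sup>2) \<le> 4 * (cmod (w x))\<^sup>2"
    proof (rule AE_I2)
      fix x assume x: "x \<in> space M"
      have "cmod (v x - g n x) \<le> 2 * cmod (w x)"
        using norm_triangle_ineq4[of "v x" "g n x"] vb[OF x] bound[OF x, of n] by linarith
      then have "(cmod (v x - g n x))\<^sup>2 \<le> (2 * cmod (w x))\<^sup>2"
        by (intro power_mono) auto
      then show "norm ((cmod (v x - g n x))\<^sup>2) \<le> 4 * (cmod (w x))\<^sup>2" by (simp add: power_mult_distrib)
    qed
  qed (use g v in auto)
  then have "(\<lambda>n. sqrt (\<integral>x. (cmod (v x - g n x))\<^sup>2 \<partial>M)) \<longlonglongrightarrow> sqrt 0"
    by (intro tendsto_intros) simp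
  then show ?thesis by (simp add: L2_norm_def)
qed

section \<open>Translation in \<open>L2\<close> of a Haar measure\<close>

locale haar =
  fixes \<mu> :: "'a::{topological_group_add, t2_space, second_countable_topology} measure"
  assumes locally_compact: "locally compact (UNIV :: 'a set)"
    and left_haar: "left_haar_measure \<mu>"
begin

lemma sets_haar [simp, measurable_cong]: "sets \<mu> = sets borel"
  using left_haar sets_distr[of \<mu> borel "\<lambda>y. 0 + y"] unfolding left_haar_measure_def by metis

lemma space_haar [simp]: "space \<mu> = UNIV"
  using sets_eq_imp_space_eq[OF sets_haar] by simp

lemma distr_translate: "distr \<mu> borel (\<lambda>y. x + y) = \<mu>"
  using left_haar unfolding left_haar_measure_def by blast

lemma measurable_translate [measurable]: "(\<lambda>y. x + y) \<in> measurable \<mu> borel"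
  by (subst measurable_cong_sets[OF sets_haar refl])
     (intro borel_measurable_continuous_onI continuous_intros)

lemma measurable_translate': "f \<in> borel_measurable \<mu> \<Longrightarrow> (\<lambda>y. f (x + y)) \<in> borel_measurable \<mu>"
  using measurable_compose[OF measurable_translate, of f borel x] by simp

lemma integral_translate:
  fixes f :: "'a \<Rightarrow> 'b::{banach, second_countable_topology}"
  assumes "f \<in> borel_measurable \<mu>"
  shows "(\<integral>y. f (x + y) \<partial>\<mu>) = (\<integral>y. f y \<partial>\<mu>)"
  using integral_distr[OF measurable_translate, of f x] assms by (simp add: distr_translate)

lemma integrable_translate:
  fixes f :: "'a \<Rightarrow> 'b::{banach, second_countable_topology}"
  assumes "f \<in> borel_measurable \<mu>"
  shows "integrable \<mu> (\<lambda>y. f (x + y)) \<longleftrightarrow> integrable \<mu> f"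
  using integrable_distr_eq[OF measurable_translate, of f x] assms by (simp add: distr_translate)

lemma L2_translate: "v \<in> L2 \<mu> \<Longrightarrow> (\<lambda>y. v (x + y)) \<in> L2 \<mu>"
  using integrable_translate[of "\<lambda>y. (cmod (v y))\<^sup>2" x]
  by (auto simp: L2_def measurable_translate')

lemma L2_norm_translate: "v \<in> borel_measurable \<mu> \<Longrightarrow> L2_norm \<mu> (\<lambda>y. v (x + y)) = L2_norm \<mu> v"
  using integral_translate[of "\<lambda>y. (cmod (v y))\<^sup>2" x] by (simp add: L2_norm_def)

lemma compact_nhd: "\<exists>U K. open U \<and> compact K \<and> (x::'a) \<in> U \<and> U \<subseteq> K"
  using locally_compact unfolding locally_def 
  by (metis UNIV_I open_UNIV open_openin subtopology_UNIV)

lemma compact_exhaustion: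
  obtains K :: "nat \<Rightarrow> 'a set" where "\<And>n. compact (K n)" "incseq K" "(\<Union>n. K n) = UNIV"
proof -
  let ?\<F> = "{U::'a set. open U \<and> (\<exists>K. compact K \<and> U \<subseteq> K)}"
  obtain \<G> where \<G>: "\<G> \<subseteq> ?\<F>" "countable \<G>" "\<Union>\<G> = \<Union>?\<F>"
    using Lindelof[of ?\<F>] by blast
  have cov: "\<Union>\<G> = UNIV" unfolding \<G>(3) using compact_nhd by fastforce
  have ne: "\<G> \<noteq> {}" using cov by auto
  have ex: "\<exists>K. compact K \<and> U \<subseteq> K" if "U \<in> \<G>" for U using that \<G>(1) by blast
  then obtain k where k: "\<And>U. U \<in> \<G> \<Longrightarrow> compact (k U)" "\<And>U. U \<in> \<G> \<Longrightarrow> U \<subseteq> k U"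
    by metis
  let ?g = "from_nat_into \<G>"
  have g: "?g n \<in> \<G>" for n using ne by (rule from_nat_into)
  have "(\<Union>n. \<Union>m\<le>n. k (?g m)) = UNIV"
  proof (intro set_eqI iffI UNIV_I)
    fix x :: 'a
    have "x \<in> \<Union>\<G>" by (simp add: cov)
    then obtain U where U: "U \<in> \<G>" "x \<in> U" by (rule UnionE)
    obtain n where "?g n = U"
      using from_nat_into_surj[OF \<G>(2) U(1)] by (rule exE)
    then have "x \<in> k (?g n)" using k(2)[OF U(1)] U(2) by (simp add: subsetD)
    then show "x \<in> (\<Union>n. \<Union>m\<le>n. k (?g m))" by (intro UN_I[of n]) auto
  qed
  then show ?thesis
  proof (intro that)
    show "compact (\<Union>m\<le>n. k (?g m))" for n by (intro compact_UN k(1) g) simp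
    show "incseq (\<lambda>n. \<Union>m\<le>n. k (?g m))" by (intro monoI UN_mono) auto
  qed
qed

lemma compact_sets [simp]: "compact K \<Longrightarrow> K \<in> sets borel" for K :: "'a set"
  by (simp add: compact_imp_closed)

lemma emeasure_compact: "compact K \<Longrightarrow> emeasure \<mu> K < \<infinity>"
  using left_haar unfolding left_haar_measure_def by blast

sublocale sigma_finite_measure \<mu>
proof
  obtain K :: "nat \<Rightarrow> 'a set" where "\<And>n. compact (K n)" "incseq K" "(\<Union>n. K n) = UNIV"
    by (rule compact_exhaustion) blast
  then show "\<exists>A. countable A \<and> A \<subseteq> sets \<mu> \<and> \<Union> A = space \<mu> \<and> (\<forall>a\<in>A. emeasure \<mu> a \<noteq> \<infinity>)"
    using emeasure_compact by (intro exI[of _ "range K"]) (auto simp: less_top)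
qed

text \<open>The sets \<open>B i + C\<close>, with \<open>B i\<close> shrinking to \<open>0\<close>,
  decrease to \<open>C\<close> because \<open>C\<close> is closed, and continuity of the measure
  from above applies. Unlike plain outer regularity, this gives a set that contains all small left
  translates of \<open>C\<close> at once.\<close>

lemma compact_outer_approx:
  assumes C: "compact (C::'a set)" and "\<epsilon> > 0"
  obtains U V where "open U" "0 \<in> U" "\<And>u c. u \<in> U \<Longrightarrow> c \<in> C \<Longrightarrow> u + c \<in> V"
    "V \<in> sets borel" "emeasure \<mu> V < \<infinity>" "measure \<mu> V < measure \<mu> C + \<epsilon>"
proof -
  obtain O0 K0 where O0: "open O0" "compact K0" "(0::'a) \<in> O0" "O0 \<subseteq> K0"
    using compact_nhd by blast
  obtain A where A: "\<And>i. open (A i)" "\<And>i. (0::'a) \<in> A i"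
    "\<And>S. open S \<Longrightarrow> 0 \<in> S \<Longrightarrow> eventually (\<lambda>i. A i \<subseteq> S) sequentially"
    by (rule countable_basis_at_decseq) blast
  \<comment> \<open>Intersecting with \<open>O0\<close> keeps every \<open>V i\<close> inside the
    compact set \<open>K0 + C\<close>; continuity from above needs this finiteness.\<close>
  define B where "B i = O0 \<inter> (\<Inter>j\<le>i. A j)" for i
  define V where "V i = {x. \<exists>c\<in>C. x - c \<in> B i}" for i
  have oB: "open (B i)" for i unfolding B_def using O0 A(1) by (intro open_Int open_INT) auto
  have B0: "0 \<in> B i" for i using O0 A(2) by (auto simp: B_def)
  have oV: "open (V i)" for i
  proof -
    have "V i = (\<Union>c\<in>C. (\<lambda>x. x - c) -` B i)" by (auto simp: V_def)
    moreover have "open ((\<lambda>x. x - c) -` B i)" for c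
      by (rule open_vimage[OF oB]) (intro continuous_intros)
    ultimately show ?thesis by auto
  qed
  let ?L = "(\<lambda>p. fst p + snd p) ` (K0 \<times> C)"
  have "compact ?L"
    by (intro compact_continuous_image compact_Times O0 C continuous_intros)
  have VL: "V i \<subseteq> ?L" for i
  proof
    fix x assume "x \<in> V i"
    then obtain c where "c \<in> C" "x - c \<in> B i" by (auto simp: V_def)
    moreover have "x = fst (x - c, c) + snd (x - c, c)" by simp
    ultimately show "x \<in> ?L" using O0(4) by (intro image_eqI) (auto simp: B_def)
  qed
  have fin: "emeasure \<mu> (V i) < \<infinity>" for i
    using emeasure_mono[OF VL[of i], of \<mu>] emeasure_compact[OF \<open>compact ?L\<close>] \<open>compact ?L\<close>
    by (simp add: order_le_less_trans)
  have "decseq V" unfolding decseq_def V_def B_def by fastforce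
  have "(\<Inter>i. V i) = C"
  proof (intro set_eqI iffI)
    fix x assume "x \<in> (\<Inter>i. V i)"
    then have "\<forall>i. \<exists>c. c \<in> C \<and> x - c \<in> B i" by (auto simp: V_def)
    then obtain c where c: "\<And>i. c i \<in> C" "\<And>i. x - c i \<in> B i" by metis
    have "(\<lambda>i. x - c i) \<longlonglongrightarrow> 0"
    proof (rule topological_tendstoI)
      fix S assume "open S" "(0::'a) \<in> S"
      from A(3)[OF this] show "eventually (\<lambda>i. x - c i \<in> S) sequentially"
        by eventually_elim (use c(2) in \<open>auto simp: B_def\<close>)
    qed
    then have "(\<lambda>i. - (x - c i) + x) \<longlonglongrightarrow> - 0 + x" by (intro tendsto_intros)
    moreover have "- (x - c i) + x = c i" for i by simp
    ultimately have "c \<longlonglongrightarrow> x" by simp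
    show "x \<in> C" 
      by (rule Lim_in_closed_set[OF compact_imp_closed[OF C] _ _ \<open>c \<longlonglongrightarrow> x\<close>]) (use c in auto)
  next
    fix x assume "x \<in> C"
    then have "\<exists>c\<in>C. x - c \<in> B i" for i using B0[of i] by (intro bexI[of _ x]) auto
    then show "x \<in> (\<Inter>i. V i)" by (auto simp: V_def)
  qed
  have "(\<lambda>i. measure \<mu> (V i)) \<longlonglongrightarrow> measure \<mu> (\<Inter>i. V i)"
    by (rule Lim_measure_decseq) (use oV \<open>decseq V\<close> fin in \<open>auto simp: less_top\<close>)
  then have "eventually (\<lambda>i. measure \<mu> (V i) < measure \<mu> C + \<epsilon>) sequentially"
    unfolding \<open>(\<Inter>i. V i) = C\<close> using \<open>\<epsilon> > 0\<close> by (intro order_tendstoD) auto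
  then obtain i where "measure \<mu> (V i) < measure \<mu> C + \<epsilon>"
    by (auto simp: eventually_sequentially)
  moreover have "u + c \<in> V i" if "u \<in> B i" "c \<in> C" for u c
    using that by (auto simp: V_def intro!: bexI[of _ c])
  ultimately show ?thesis using that[of "B i" "V i"] oB B0 oV fin by auto
qed

section \<open>Strong continuity of left translation\<close>

definition translation_continuous :: "('a \<Rightarrow> complex) \<Rightarrow> bool" where
  "translation_continuous v \<longleftrightarrow>
     ((\<lambda>s. L2_norm \<mu> (\<lambda>r. v (s + r) - v r)) \<longlongrightarrow> 0) (nhds 0)"

lemma translation_continuousI:
  assumes "\<And>\<epsilon>. \<epsilon> > 0 \<Longrightarrow> eventually (\<lambda>s. L2_norm \<mu> (\<lambda>r. v (s + r) - v r) < \<epsilon>) (nhds 0)"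
  shows "translation_continuous v"
  unfolding translation_continuous_def using assms
  by (intro tendstoI) (auto simp: dist_real_def)

lemma translation_continuousD:
  assumes "translation_continuous v" "\<epsilon> > 0"
  shows "eventually (\<lambda>s. L2_norm \<mu> (\<lambda>r. v (s + r) - v r) < \<epsilon>) (nhds 0)"
  using order_tendstoD(2)[OF assms(1)[unfolded translation_continuous_def] assms(2)] .

lemma translation_continuous_add:
  assumes "v \<in> L2 \<mu>" "w \<in> L2 \<mu>" "translation_continuous v" "translation_continuous w"
  shows "translation_continuous (\<lambda>r. v r + w r)"
proof (rule translation_continuousI)
  fix \<epsilon> :: real assume "\<epsilon> > 0"
  then have "\<epsilon>/2 > 0" by simp
  from translation_continuousD[OF assms(3) this] translation_continuousD[OF assms(4) this]
  show "eventually (\<lambda>s. L2_norm \<mu> (\<lambda>r. (v (s + r) + w (s + r)) - (v r + w r)) < \<epsilon>) (nhds 0)"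
  proof eventually_elim
    case (elim s)
    have "L2_norm \<mu> (\<lambda>r. (v (s + r) - v r) + (w (s + r) - w r))
        \<le> L2_norm \<mu> (\<lambda>r. v (s + r) - v r) + L2_norm \<mu> (\<lambda>r. w (s + r) - w r)"
      by (intro L2_norm_add L2_diff L2_translate assms)
    with elim show ?case by (simp add: algebra_simps)
  qed
qed

lemma translation_continuous_scale:
  assumes "v \<in> L2 \<mu>" "translation_continuous v"
  shows "translation_continuous (\<lambda>r. c * v r)"
proof -
  have "((\<lambda>s. cmod c * L2_norm \<mu> (\<lambda>r. v (s + r) - v r)) \<longlongrightarrow> cmod c * 0) (nhds 0)"
    using assms(2) unfolding translation_continuous_def by (intro tendsto_intros)
  then show ?thesis
    unfolding translation_continuous_def by (simp flip: right_diff_distrib)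
qed

lemma translation_continuous_zero: "translation_continuous (\<lambda>r. 0)"
  by (simp add: translation_continuous_def)

lemma translation_continuous_sum:
  assumes "\<And>i. i \<in> I \<Longrightarrow> v i \<in> L2 \<mu>" "\<And>i. i \<in> I \<Longrightarrow> translation_continuous (v i)"
  shows "translation_continuous (\<lambda>r. \<Sum>i\<in>I. v i r)"
  using assms
proof (induction I rule: infinite_finite_induct)
  case (insert i I)
  have "translation_continuous (\<lambda>r. v i r + (\<Sum>i\<in>I. v i r))"
    using insert by (intro translation_continuous_add L2_sum) auto
  with insert show ?case by simp
qed (auto simp: translation_continuous_zero)

lemma translation_continuous_closed:
  assumes v: "v \<in> L2 \<mu>" and g: "\<And>n. g n \<in> L2 \<mu>" "\<And>n. translation_continuous (g n)"
    and lim: "(\<lambda>n. L2_norm \<mu> (\<lambda>x. v x - g n x)) \<longlonglongrightarrow> 0"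
  shows "translation_continuous v"
proof (rule translation_continuousI)
  fix \<epsilon> :: real assume "\<epsilon> > 0"
  then have e3: "\<epsilon>/3 > 0" by simp
  obtain n where n: "L2_norm \<mu> (\<lambda>x. v x - g n x) < \<epsilon>/3"
    using order_tendstoD(2)[OF lim e3] by (auto simp: eventually_sequentially)
  from translation_continuousD[OF g(2) e3, of n]
  show "eventually (\<lambda>s. L2_norm \<mu> (\<lambda>r. v (s + r) - v r) < \<epsilon>) (nhds 0)"
  proof eventually_elim
    case (elim s)
    have "L2_norm \<mu> (\<lambda>r. v (s + r) - v r)
      \<le> L2_norm \<mu> (\<lambda>r. v (s + r) - g n (s + r)) + L2_norm \<mu> (\<lambda>r. g n (s + r) - v r)"
      by (intro L2_norm_diff_triangle L2_translate v g)
    also have "L2_norm \<mu> (\<lambda>r. g n (s + r) - v r)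
      \<le> L2_norm \<mu> (\<lambda>r. g n (s + r) - g n r) + L2_norm \<mu> (\<lambda>r. g n r - v r)"
      by (intro L2_norm_diff_triangle L2_translate v g)
    also have "L2_norm \<mu> (\<lambda>r. g n r - v r) = L2_norm \<mu> (\<lambda>x. v x - g n x)"
      by (rule L2_norm_minus_commute)
    also have "L2_norm \<mu> (\<lambda>r. v (s + r) - g n (s + r)) = L2_norm \<mu> (\<lambda>x. v x - g n x)"
      using L2_diff[OF v g(1), of n] by (intro L2_norm_translate[of "\<lambda>x. v x - g n x"]) (simp add: L2_def)
    finally show ?case using n elim by linarith
  qed
qed

lemma indicator_L2:
  assumes "A \<in> sets borel" "emeasure \<mu> A < \<infinity>"
  shows "(indicator A :: 'a \<Rightarrow> complex) \<in> L2 \<mu>"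
proof (rule L2_boundedI)
  show "integrable \<mu> (indicator A :: 'a \<Rightarrow> real)" using assms by simp
qed (use assms in \<open>auto simp: indicator_def\<close>)

text \<open>\<open>C\<close> and its translate have the same measure and both lie in
  \<open>V\<close>, so each fills \<open>V\<close> up to less than
  \<open>\<epsilon>\<^sup>2/2\<close>; their symmetric difference then has measure below
  \<open>\<epsilon>\<^sup>2\<close>.\<close>

lemma translation_continuous_compact:
  assumes C: "compact C"
  shows "translation_continuous (indicator C)"
proof (rule translation_continuousI)
  fix \<epsilon> :: real assume "\<epsilon> > 0"
  then have "\<epsilon>\<^sup>2/2 > 0" by simp
  then obtain U V where UV: "open U" "0 \<in> U" "\<And>u c. u \<in> U \<Longrightarrow> c \<in> C \<Longrightarrow> u + c \<in> V"
    "V \<in> sets borel" "emeasure \<mu> V < \<infinity>" "measure \<mu> V < measure \<mu> C + \<epsilon>\<^sup>2/2"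
    by (rule compact_outer_approx[OF C]) blast
  have "((\<lambda>s. - s) \<longlongrightarrow> - 0) (nhds (0::'a))" by (intro tendsto_minus filterlim_ident)
  then have "eventually (\<lambda>s. - s \<in> U) (nhds 0)"
    using UV(1,2) by (intro topological_tendstoD) auto
  then show "eventually (\<lambda>s. L2_norm \<mu> (\<lambda>r. indicator C (s + r) - indicator C r) < \<epsilon>) (nhds 0)"
  proof eventually_elim
    fix s assume s: "- s \<in> U"
    let ?T = "{r. s + r \<in> C}"
    have [measurable]: "?T \<in> sets borel"
    proof -
      have "closed ((\<lambda>r. s + r) -` C)"
        by (rule closed_vimage[OF compact_imp_closed[OF C]]) (intro continuous_intros)
      then show ?thesis by (simp add: vimage_def)
    qed
    note [measurable] = compact_sets[OF C]
    have TV: "?T \<subseteq> V"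
    proof
      fix r assume "r \<in> ?T"
      then have "- s + (s + r) \<in> V" using UV(3)[OF s] by blast
      then show "r \<in> V" by (simp add: add.assoc[symmetric])
    qed
    have CV: "C \<subseteq> V" using UV(3)[OF UV(2)] by force
    have fin: "emeasure \<mu> X < \<infinity>" if "X \<in> sets borel" "X \<subseteq> V" for X
      using emeasure_mono[OF that(2), of \<mu>] UV(4,5) by (simp add: order_le_less_trans)
    have mT: "measure \<mu> ?T = measure \<mu> C"
    proof -
      have "emeasure \<mu> C = emeasure (distr \<mu> borel (\<lambda>y. s + y)) C" by (simp add: distr_translate)
      also have "\<dots> = emeasure \<mu> ?T"
        by (subst emeasure_distr) (auto simp: vimage_def)
      finally show ?thesis by (simp add: measure_def)
    qed
    have d1: "measure \<mu> (?T - C) \<le> measure \<mu> V - measure \<mu> C"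
    proof -
      have "measure \<mu> (?T - C) \<le> measure \<mu> (V - C)"
        using TV UV(4) fin[of "V - C"] by (intro measure_mono_fmeasurable) (auto simp: fmeasurable_def)
      also have "\<dots> = measure \<mu> V - measure \<mu> C"
        using CV UV(4,5) by (intro measure_Diff) auto
      finally show ?thesis .
    qed
    have d2: "measure \<mu> (C - ?T) \<le> measure \<mu> V - measure \<mu> C"
    proof -
      have "measure \<mu> (C - ?T) \<le> measure \<mu> (V - ?T)"
        using CV UV(4) fin[of "V - ?T"] by (intro measure_mono_fmeasurable) (auto simp: fmeasurable_def)
      also have "\<dots> = measure \<mu> V - measure \<mu> ?T"
        using TV UV(4,5) by (intro measure_Diff) auto
      finally show ?thesis by (simp add: mT)
    qed
    have "(L2_norm \<mu> (\<lambda>r. indicator C (s + r) - indicator C r))\<^sup>2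
      = (\<integral>r. indicator (?T - C) r + indicator (C - ?T) r \<partial>\<mu>)"
      unfolding L2_norm_power2
      by (intro Bochner_Integration.integral_cong) (auto simp: indicator_def)
    also have "\<dots> = measure \<mu> (?T - C) + measure \<mu> (C - ?T)"
    proof -
      have "emeasure \<mu> (?T - C) < \<infinity>" by (rule fin) (use TV in auto)
      moreover have "emeasure \<mu> (C - ?T) < \<infinity>" by (rule fin) (use CV in auto)
      ultimately show ?thesis by (subst Bochner_Integration.integral_add) auto
    qed
    also have "\<dots> < \<epsilon>\<^sup>2" using d1 d2 UV(6) by linarith
    finally show "L2_norm \<mu> (\<lambda>r. indicator C (s + r) - indicator C r) < \<epsilon>"
      by (rule power2_less_imp_less) (use \<open>\<epsilon> > 0\<close> in simp)
  qed
qed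

lemma emeasure_Int_compact:
  assumes "A \<in> sets borel" "compact C" shows "emeasure \<mu> (A \<inter> C) < \<infinity>"
  using emeasure_mono[of "A \<inter> C" C \<mu>] emeasure_compact[OF assms(2)] assms(2)
  by (simp add: order_le_less_trans)

text \<open>Induction over the sigma-algebra generated by the closed sets, which are stable under
  intersection. The fixed compact \<open>C\<close> keeps all indicators square integrable:
  complements become differences in \<open>L2\<close>, and disjoint unions become limits dominated
  by the indicator of \<open>C\<close>.\<close>

lemma translation_continuous_indicator:
  assumes C: "compact C" and "A \<in> sets borel"
  shows "translation_continuous (indicator (A \<inter> C))"
proof -
  have "Int_stable (Collect closed :: 'a set set)" by (auto simp: Int_stable_def)
  moreover have "Collect closed \<subseteq> Pow (UNIV :: 'a set)" by simp
  moreover have "A \<in> sigma_sets UNIV (Collect closed)"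
    using \<open>A \<in> sets borel\<close> by (simp add: borel_eq_closed)
  ultimately show ?thesis
  proof (induction rule: sigma_sets_induct_disjoint)
    case (basic A)
    then have "compact (A \<inter> C)" using C by (simp add: closed_Int_compact)
    then show ?case by (rule translation_continuous_compact)
  next
    case empty
    then show ?case by (simp add: translation_continuous_zero indicator_def)
  next
    case (compl A)
    then have A: "A \<in> sets borel" by (simp add: borel_eq_closed)
    have "translation_continuous (\<lambda>r. indicator C r + - 1 * indicator (A \<inter> C) r)"
      using compl C A emeasure_Int_compact[OF A C] emeasure_compact[OF C]
      by (intro translation_continuous_add translation_continuous_scale L2_scale indicator_L2
          translation_continuous_compact[OF C] compl) auto
    moreover have "(\<lambda>r. indicator C r + - 1 * indicator (A \<inter> C) r) = (indicator ((UNIV - A) \<inter> C) :: 'a \<Rightarrow> complex)"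
      by (auto simp: indicator_def)
    ultimately show ?case by simp
  next
    case (union D)
    then have D: "D i \<in> sets borel" for i by (auto simp: borel_eq_closed)
    let ?g = "\<lambda>n r. \<Sum>i<n. indicator (D i \<inter> C) r :: complex"
    have gi: "?g n = indicator ((\<Union>i<n. D i \<inter> C))" for n
      using union(1) by (intro ext indicator_UN_disjoint[symmetric])
        (auto simp: disjoint_family_on_def)
    have DC: "(indicator (D i \<inter> C) :: 'a \<Rightarrow> complex) \<in> L2 \<mu>" for i
      by (intro indicator_L2 sets.Int D compact_sets C emeasure_Int_compact)
    have UD: "(\<Union>i. D i) \<inter> C = (\<Union>i. D i \<inter> C)" by auto
    show ?case unfolding UD
    proof (rule translation_continuous_closed)
      show "(indicator (\<Union>i. D i \<inter> C) :: 'a \<Rightarrow> complex) \<in> L2 \<mu>"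
        unfolding UD[symmetric] using D C
        by (intro indicator_L2 emeasure_Int_compact sets.Int sets.countable_UN) auto
      show "?g n \<in> L2 \<mu>" for n by (intro L2_sum DC)
      show "translation_continuous (?g n)" for n
        by (intro translation_continuous_sum DC union)
      show "(\<lambda>n. L2_norm \<mu> (\<lambda>x. indicator (\<Union>i. D i \<inter> C) x - ?g n x)) \<longlonglongrightarrow> 0"
      proof (rule L2_norm_dominated_convergence[where w="indicator C"])
        show "?g n \<in> borel_measurable \<mu>" for n
          using D C by (intro borel_measurable_sum borel_measurable_indicator) auto
        show "(indicator (\<Union>i. D i \<inter> C) :: 'a \<Rightarrow> complex) \<in> borel_measurable \<mu>"
          using D C by (intro borel_measurable_indicator) auto
        show "(indicator C :: 'a \<Rightarrow> complex) \<in> L2 \<mu>"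
          by (intro indicator_L2 compact_sets C emeasure_compact)
        show "(\<lambda>n. ?g n x) \<longlonglongrightarrow> indicator (\<Union>i. D i \<inter> C) x" for x
          unfolding fun_cong[OF gi] by (rule LIMSEQ_indicator_UN)
        show "cmod (?g n x) \<le> cmod (indicator C x)" for n x
          unfolding fun_cong[OF gi] by (auto simp: indicator_def)
      qed
    qed
  qed
qed

lemma translation_continuous_L2_compact:
  assumes v: "v \<in> L2 \<mu>" and C: "compact C" and van: "\<And>x. x \<notin> C \<Longrightarrow> v x = 0"
  shows "translation_continuous v"
proof -
  obtain s where s: "\<And>i. simple_function \<mu> (s i)" "\<And>x. (\<lambda>i. s i x) \<longlonglongrightarrow> v x"
    and bound: "\<And>i x. cmod (s i x) \<le> 2 * cmod (v x)"
    using borel_measurable_implies_sequence_metric[of v \<mu> 0] v by (auto simp: L2_def)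
  have sm: "s i \<in> borel_measurable \<mu>" for i by (rule borel_measurable_simple_function[OF s(1)])
  have sv: "s i x = 0" if "x \<notin> C" for i x using bound[of i x] van[OF that] by simp
  have lev: "s i -` {y} \<in> sets borel" for i y
    using simple_functionD(2)[OF s(1), of i "{y}"] by simp
  have eq: "s i = (\<lambda>r. \<Sum>y\<in>range (s i). y * indicator (s i -` {y} \<inter> C) r)" for i
  proof
    fix r
    have fin: "finite (range (s i))" using simple_functionD(1)[OF s(1)[of i]] by simp
    have "(\<Sum>y\<in>range (s i). y * indicator (s i -` {y} \<inter> C) r)
      = (\<Sum>y\<in>range (s i). if y = s i r then s i r else 0)"
      using sv[of r i] by (intro sum.cong) (auto simp: indicator_def)
    with fin show "s i r = (\<Sum>y\<in>range (s i). y * indicator (s i -` {y} \<inter> C) r)" by simp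
  qed
  have iL: "(\<lambda>r. y * indicator (s i -` {y} \<inter> C) r) \<in> L2 \<mu>" for i y
    by (intro L2_scale indicator_L2 sets.Int lev compact_sets C emeasure_Int_compact)
  show ?thesis
  proof (rule translation_continuous_closed[OF v])
    show "s i \<in> L2 \<mu>" for i by (subst eq) (intro L2_sum iL)
    show "translation_continuous (s i)" for i
      by (subst eq) (intro translation_continuous_sum iL translation_continuous_scale
          translation_continuous_indicator C lev indicator_L2 sets.Int compact_sets emeasure_Int_compact)
    show "(\<lambda>i. L2_norm \<mu> (\<lambda>x. v x - s i x)) \<longlonglongrightarrow> 0"
      by (rule L2_norm_dominated_convergence[where w="\<lambda>x. 2 * v x"])
        (use sm s(2) bound v in \<open>auto simp: norm_mult L2_def\<close>)
  qed
qed

lemma L2_compact_truncation: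
  assumes v: "v \<in> L2 \<mu>" and K: "\<And>n. compact (K n)" "incseq K" "(\<Union>n. K n) = UNIV"
  shows "(\<lambda>n. L2_norm \<mu> (\<lambda>x. v x - indicator (K n) x * v x)) \<longlonglongrightarrow> 0"
proof (rule L2_norm_dominated_convergence[where w=v])
  show "(\<lambda>n. indicator (K n) x * v x) \<longlonglongrightarrow> v x" for x
  proof -
    have "(\<lambda>n. indicator (K n) x :: complex) \<longlonglongrightarrow> indicator (\<Union>n. K n) x"
      by (rule LIMSEQ_indicator_incseq[OF K(2)])
    then have "(\<lambda>n. indicator (K n) x * v x) \<longlonglongrightarrow> indicator (\<Union>n. K n) x * v x"
      by (intro tendsto_intros)
    with K(3) show ?thesis by simp
  qed
  show "(\<lambda>x. indicator (K n) x * v x) \<in> borel_measurable \<mu>" for n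
    using L2_indicator_mult[OF v, of "K n"] K(1) by (simp add: L2_def)
qed (use v in \<open>auto simp: L2_def norm_mult indicator_def\<close>)

lemma translation_continuous_L2:
  assumes v: "v \<in> L2 \<mu>" shows "translation_continuous v"
proof -
  obtain K :: "nat \<Rightarrow> 'a set" where K: "\<And>n. compact (K n)" "incseq K" "(\<Union>n. K n) = UNIV"
    by (rule compact_exhaustion) blast
  have L: "(\<lambda>x. indicator (K n) x * v x) \<in> L2 \<mu>" for n
    by (intro L2_indicator_mult v) (simp add: K)
  have "translation_continuous (\<lambda>x. indicator (K n) x * v x)" for n
    by (rule translation_continuous_L2_compact[OF L K(1)[of n]]) simp
  then show ?thesis
    by (rule translation_continuous_closed[OF v L _ L2_compact_truncation[OF v K]])
qed

text \<open>Substituting \<open>s0 + r\<close> for \<open>r\<close> moves the question to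
  translation by \<open>s - s0\<close>, which tends to \<open>0\<close>.\<close>

lemma L2_translate_tendsto:
  assumes v: "v \<in> L2 \<mu>"
  shows "((\<lambda>s. L2_norm \<mu> (\<lambda>r. v (s + r) - v (s0 + r))) \<longlongrightarrow> 0) (nhds s0)"
proof -
  have eq: "L2_norm \<mu> (\<lambda>r. v (s + r) - v (s0 + r)) = L2_norm \<mu> (\<lambda>r. v (s - s0 + r) - v r)" for s
  proof -
    have "L2_norm \<mu> (\<lambda>r. v (s - s0 + (s0 + r)) - v (s0 + r)) = L2_norm \<mu> (\<lambda>r. v (s - s0 + r) - v r)"
      using L2_diff[OF L2_translate[OF v] v, of "s - s0"]
      by (intro L2_norm_translate[of "\<lambda>r. v (s - s0 + r) - v r"]) (simp add: L2_def)
    then show ?thesis by (simp add: add.assoc[symmetric])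
  qed
  have "((\<lambda>s. s - s0) \<longlongrightarrow> s0 - s0) (nhds s0)" by (intro tendsto_diff filterlim_ident tendsto_const)
  then have "filterlim (\<lambda>s. s - s0) (nhds 0) (nhds s0)" by simp
  from filterlim_compose[OF translation_continuous_L2[OF v, unfolded translation_continuous_def] this]
  show ?thesis unfolding eq .
qed

end

section \<open>Fourier algebra\<close>

text \<open>Flattens a series of series along \<open>prod_decode\<close>. The majorant
  \<open>F\<close> makes the double family absolutely summable, so the order of summation is
  irrelevant.\<close>

lemma double_sums:
  fixes c :: "nat \<times> nat \<Rightarrow> 'b::banach"
  assumes bound: "\<And>n j. norm (c (n, j)) \<le> F (n, j)" and R: "\<And>n. (\<lambda>j. F (n, j)) sums R n" "summable R"
    and f: "\<And>n. (\<lambda>j. c (n, j)) sums f n" "f sums g"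
  shows "(\<lambda>m. c (prod_decode m)) sums g"
proof -
  have F0: "0 \<le> F p" for p using bound[of "fst p" "snd p"] norm_ge_zero order_trans by (metis prod.collapse)
  have R0: "0 \<le> R n" for n using sums_le[OF _ sums_zero R(1)] F0 by blast
  have FR: "((\<lambda>j. F (n, j)) has_sum R n) UNIV" for n
    by (rule sums_nonneg_imp_has_sum[OF R(1) F0])
  have "(\<lambda>p. norm (F p)) summable_on Sigma UNIV (\<lambda>_. UNIV)"
    unfolding Infinite_Sum.abs_summable_on_Sigma_iff
  proof (intro conjI ballI)
    show "(\<lambda>j. norm (F (n, j))) summable_on UNIV" for n
      using FR[of n] F0 by (auto simp: summable_on_def)
    have "infsum (\<lambda>j. norm (F (n, j))) UNIV = R n" for n
      using infsumI[OF FR[of n]] F0 by simp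
    then show "(\<lambda>n. norm (infsum (\<lambda>j. norm (F (n, j))) UNIV)) summable_on UNIV"
      using R(2) R0 by (simp add: summable_on_UNIV_nonneg_real_iff)
  qed
  then have "(\<lambda>p. norm (c p)) summable_on Sigma UNIV (\<lambda>_. UNIV)"
    by (rule Infinite_Sum.abs_summable_on_comparison_test) (use bound F0 in \<open>auto\<close>)
  then have "c summable_on Sigma UNIV (\<lambda>_. UNIV)" by (rule Infinite_Sum.abs_summable_summable)
  then obtain S where S: "(c has_sum S) (Sigma UNIV (\<lambda>_. UNIV))" by (auto simp: summable_on_def)
  have "((\<lambda>j. c (n, j)) has_sum f n) UNIV" for n
    by (rule norm_summable_imp_has_sum[OF _ f(1)])
      (rule summable_comparison_test'[where g="\<lambda>j. F (n, j)" and N=0], use R(1) bound in \<open>auto simp: sums_iff\<close>)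
  then have "(f has_sum S) UNIV"
    by (intro has_sum_Sigma[OF isUCont_plus S]) auto
  then have "S = g" using has_sum_imp_sums f(2) sums_unique2 by blast
  then have "((\<lambda>m. c (prod_decode m)) has_sum g) UNIV"
    using S by (subst has_sum_reindex_bij_betw[where g=prod_decode and f=c, OF bij_prod_decode]) simp
  then show ?thesis by (rule has_sum_imp_sums)
qed

text \<open>\<open>fourier_norm\<close> is an infimum and carries no information where there is no
  representation. This predicate joins membership to an upper bound, so that estimates can be
  carried out on explicit representations.\<close>

definition fourier_bounded :: "'a::group_add measure \<Rightarrow> ('a \<Rightarrow> complex) \<Rightarrow> real \<Rightarrow> bool" where
  "fourier_bounded \<mu> u C \<longleftrightarrow>
    (\<exists>\<xi> \<eta>. fourier_rep \<mu> u \<xi> \<eta> \<and> (\<Sum>n. L2_norm \<mu> (\<xi> n) * L2_norm \<mu> (\<eta> n)) \<le> C)"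

lemma fourier_rep_nonneg:
  "fourier_rep \<mu> u \<xi> \<eta> \<Longrightarrow> 0 \<le> (\<Sum>n. L2_norm \<mu> (\<xi> n) * L2_norm \<mu> (\<eta> n))"
  by (intro suminf_nonneg) (auto simp: fourier_rep_def)

lemma fourier_bounded_nonneg: "fourier_bounded \<mu> u C \<Longrightarrow> 0 \<le> C"
  unfolding fourier_bounded_def using fourier_rep_nonneg order_trans by blast

lemma fourier_bounded_mono: "fourier_bounded \<mu> u C \<Longrightarrow> C \<le> D \<Longrightarrow> fourier_bounded \<mu> u D"
  unfolding fourier_bounded_def using order_trans by blast

lemma fourier_boundedD:
  assumes "fourier_bounded \<mu> u C"
  shows "u \<in> fourier_algebra \<mu>" "fourier_norm \<mu> u \<le> C"
proof -
  obtain \<xi> \<eta> where r: "fourier_rep \<mu> u \<xi> \<eta>" "(\<Sum>n. L2_norm \<mu> (\<xi> n) * L2_norm \<mu> (\<eta> n)) \<le> C"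
    using assms unfolding fourier_bounded_def by blast
  then show "u \<in> fourier_algebra \<mu>" unfolding fourier_algebra_def by blast
  have "fourier_norm \<mu> u \<le> (\<Sum>n. L2_norm \<mu> (\<xi> n) * L2_norm \<mu> (\<eta> n))"
    unfolding fourier_norm_def using r(1) fourier_rep_nonneg
    by (intro cInf_lower bdd_belowI[of _ 0]) blast+
  with r(2) show "fourier_norm \<mu> u \<le> C" by simp
qed

lemma fourier_boundedI:
  assumes "u \<in> fourier_algebra \<mu>" "fourier_norm \<mu> u < C"
  shows "fourier_bounded \<mu> u C"
proof -
  let ?S = "{(\<Sum>n. L2_norm \<mu> (\<xi> n) * L2_norm \<mu> (\<eta> n)) | \<xi> \<eta>. fourier_rep \<mu> u \<xi> \<eta>}"
  have "?S \<noteq> {}" using assms(1) unfolding fourier_algebra_def by blast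
  then obtain x where "x \<in> ?S" "x < C"
    using cInf_lessD[of ?S C] assms(2) unfolding fourier_norm_def by blast
  then show ?thesis unfolding fourier_bounded_def by (auto intro: less_imp_le)
qed

lemma fourier_algebra_bounded:
  assumes "u \<in> fourier_algebra \<mu>" obtains C where "fourier_bounded \<mu> u C"
  using fourier_boundedI[OF assms, of "fourier_norm \<mu> u + 1"] by auto

text \<open>Representations of the \<open>f n\<close> are merged into one by a pairing of the
  indices. The premise on coefficients is the Cauchy-Schwarz bound, which holds for invariant
  measures and supplies the absolute convergence at each point.\<close>

lemma fourier_bounded_sums:
  assumes f: "\<And>n. fourier_bounded \<mu> (f n) (C n)" and C: "summable C"
    and g: "\<And>s. (\<lambda>n. f n s) sums g s"
    and coeff: "\<And>\<xi> \<eta> s. \<xi> \<in> L2 \<mu> \<Longrightarrow> \<eta> \<in> L2 \<mu> \<Longrightarrow>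
      cmod (regular_coeff \<mu> \<xi> \<eta> s) \<le> L2_norm \<mu> \<xi> * L2_norm \<mu> \<eta>"
  shows "fourier_bounded \<mu> g (suminf C)"
proof -
  obtain \<xi> \<eta> where r: "\<And>n. fourier_rep \<mu> (f n) (\<xi> n) (\<eta> n)"
    and b: "\<And>n. (\<Sum>j. L2_norm \<mu> (\<xi> n j) * L2_norm \<mu> (\<eta> n j)) \<le> C n"
    using f unfolding fourier_bounded_def by metis
  define F where "F = (\<lambda>(n, j). L2_norm \<mu> (\<xi> n j) * L2_norm \<mu> (\<eta> n j))"
  define R where "R n = (\<Sum>j. F (n, j))" for n
  have F: "(\<lambda>j. F (n, j)) sums R n" for n
    unfolding R_def using r[of n] by (intro summable_sums) (simp add: F_def fourier_rep_def)
  have R0: "0 \<le> R n" for n using fourier_rep_nonneg[OF r] by (simp add: R_def F_def)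
  have RC: "R n \<le> C n" for n using b by (simp add: R_def F_def)
  have sR: "summable R"
    by (rule summable_comparison_test'[OF C, where N=0]) (use R0 RC in auto)
  have F0: "0 \<le> F p" for p by (auto simp: F_def split: prod.split)
  have Fs: "(\<lambda>m. F (prod_decode m)) sums suminf R"
    by (rule double_sums[of F F R, OF _ F sR F summable_sums[OF sR]]) (use F0 in auto)
  let ?\<xi> = "\<lambda>m. case prod_decode m of (n, j) \<Rightarrow> \<xi> n j"
  let ?\<eta> = "\<lambda>m. case prod_decode m of (n, j) \<Rightarrow> \<eta> n j"
  have Fm: "L2_norm \<mu> (?\<xi> m) * L2_norm \<mu> (?\<eta> m) = F (prod_decode m)" for m
    by (auto simp: F_def split: prod.split)
  have L: "\<xi> n j \<in> L2 \<mu>" "\<eta> n j \<in> L2 \<mu>" for n j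
    using r[of n] by (auto simp: fourier_rep_def)
  have "fourier_rep \<mu> g ?\<xi> ?\<eta>"
    unfolding fourier_rep_def Fm
  proof (intro conjI allI)
    show "summable (\<lambda>m. F (prod_decode m))" using Fs by (simp add: sums_iff)
    fix s
    let ?c = "\<lambda>(n, j). regular_coeff \<mu> (\<xi> n j) (\<eta> n j) s"
    have "(\<lambda>m. ?c (prod_decode m)) sums g s"
    proof (rule double_sums[OF _ F sR])
      show "norm (?c (n, j)) \<le> F (n, j)" for n j using coeff[OF L] by (simp add: F_def)
      show "(\<lambda>j. ?c (n, j)) sums f n s" for n using r[of n] by (simp add: fourier_rep_def)
      show "(\<lambda>n. f n s) sums g s" by (rule g)
    qed
    moreover have "?c (prod_decode m) = regular_coeff \<mu> (?\<xi> m) (?\<eta> m) s" for m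
      by (auto split: prod.split)
    ultimately show "(\<lambda>m. regular_coeff \<mu> (?\<xi> m) (?\<eta> m) s) sums g s" by simp
  qed (auto split: prod.split simp: L)
  moreover have "(\<Sum>m. L2_norm \<mu> (?\<xi> m) * L2_norm \<mu> (?\<eta> m)) \<le> suminf C"
    unfolding Fm using Fs suminf_le[OF RC sR C] by (simp add: sums_iff)
  ultimately show ?thesis unfolding fourier_bounded_def by blast
qed

lemma fourier_bounded_zero: "fourier_bounded \<mu> (\<lambda>x. 0) 0"
  unfolding fourier_bounded_def fourier_rep_def
  by (intro exI[of _ "\<lambda>n x. 0"]) (simp add: regular_coeff_def)

lemma fourier_bounded_scale:
  assumes "fourier_bounded \<mu> u C" shows "fourier_bounded \<mu> (\<lambda>x. c * u x) (cmod c * C)"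
proof -
  obtain \<xi> \<eta> where r: "fourier_rep \<mu> u \<xi> \<eta>" "(\<Sum>n. L2_norm \<mu> (\<xi> n) * L2_norm \<mu> (\<eta> n)) \<le> C"
    using assms unfolding fourier_bounded_def by blast
  have "fourier_rep \<mu> (\<lambda>x. c * u x) (\<lambda>n x. c * \<xi> n x) \<eta>"
    using r(1) unfolding fourier_rep_def
    by (auto simp: regular_coeff_def mult.assoc intro!: summable_mult sums_mult L2_scale)
  moreover have "(\<Sum>n. L2_norm \<mu> (\<lambda>x. c * \<xi> n x) * L2_norm \<mu> (\<eta> n)) \<le> cmod c * C"
    using r by (simp add: fourier_rep_def mult.assoc suminf_mult mult_left_mono)
  ultimately show ?thesis unfolding fourier_bounded_def by blast
qed

context haar
begin

lemma regular_coeff_inner: "regular_coeff \<mu> \<xi> \<eta> s = L2_inner \<mu> (\<lambda>t. \<xi> (- s + t)) \<eta>"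
  by (simp add: regular_coeff_def L2_inner_def)

lemma regular_coeff_bound:
  assumes "\<xi> \<in> L2 \<mu>" "\<eta> \<in> L2 \<mu>"
  shows "cmod (regular_coeff \<mu> \<xi> \<eta> s) \<le> L2_norm \<mu> \<xi> * L2_norm \<mu> \<eta>"
  using L2_Cauchy_Schwarz[OF L2_translate[OF assms(1)] assms(2), of "- s"]
    L2_norm_translate[of \<xi> "- s"] assms by (simp add: regular_coeff_inner L2_def)

lemmas fourier_bounded_sums' = fourier_bounded_sums[OF _ _ _ regular_coeff_bound]

section \<open>Calculus of norm bounds\<close>

lemma fourier_bounded_add:
  assumes "fourier_bounded \<mu> u C" "fourier_bounded \<mu> v D"
  shows "fourier_bounded \<mu> (\<lambda>x. u x + v x) (C + D)"
proof -
  let ?f = "\<lambda>n x. if n = (0::nat) then u x else if n = 1 then v x else (0::complex)"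
  let ?C = "\<lambda>n. if n = (0::nat) then C else if n = 1 then D else (0::real)"
  have s: "?C sums (\<Sum>n\<in>{0,1}. ?C n)" by (rule sums_finite) auto
  have "fourier_bounded \<mu> (\<lambda>x. u x + v x) (suminf ?C)"
  proof (rule fourier_bounded_sums')
    show "fourier_bounded \<mu> (?f n) (?C n)" for n
      using assms fourier_bounded_zero[of \<mu>] by auto
    show "summable ?C" using s by (simp add: sums_iff)
    show "(\<lambda>n. ?f n x) sums (u x + v x)" for x
      using sums_finite[of "{0,1::nat}" "\<lambda>n. ?f n x"] by simp
  qed
  with s show ?thesis by (simp add: sums_iff)
qed

lemma fourier_bounded_diff:
  assumes "fourier_bounded \<mu> u C" "fourier_bounded \<mu> v D"
  shows "fourier_bounded \<mu> (\<lambda>x. u x - v x) (C + D)"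
  using fourier_bounded_add[OF assms(1) fourier_bounded_scale[OF assms(2), of "- 1"]] by simp

lemma fourier_bounded_sum:
  assumes "\<And>i. i \<in> I \<Longrightarrow> fourier_bounded \<mu> (u i) (C i)"
  shows "fourier_bounded \<mu> (\<lambda>x. \<Sum>i\<in>I. u i x) (\<Sum>i\<in>I. C i)"
  using assms
  by (induction I rule: infinite_finite_induct) (simp_all add: fourier_bounded_zero fourier_bounded_add)

lemma fourier_algebra_diff:
  "u \<in> fourier_algebra \<mu> \<Longrightarrow> v \<in> fourier_algebra \<mu> \<Longrightarrow> (\<lambda>x. u x - v x) \<in> fourier_algebra \<mu>"
  by (elim fourier_algebra_bounded) (rule fourier_boundedD(1)[OF fourier_bounded_diff])

lemma fourier_bounded_coeff:
  assumes "a \<in> L2 \<mu>" "b \<in> L2 \<mu>"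
  shows "fourier_bounded \<mu> (regular_coeff \<mu> a b) (L2_norm \<mu> a * L2_norm \<mu> b)"
proof -
  let ?a = "\<lambda>n x. if n = (0::nat) then a x else 0" 
  have e: "L2_norm \<mu> (?a n) * L2_norm \<mu> b = (if n = 0 then L2_norm \<mu> a * L2_norm \<mu> b else 0)" for n
    by auto
  have c: "regular_coeff \<mu> (?a n) b s = (if n = 0 then regular_coeff \<mu> a b s else 0)" for n s
    by (auto simp: regular_coeff_def)
  have "fourier_rep \<mu> (regular_coeff \<mu> a b) ?a (\<lambda>_. b)"
    unfolding fourier_rep_def e c
  proof (intro conjI allI)
    show "?a n \<in> L2 \<mu>" for n using assms by (cases n) auto
  qed (use assms in \<open>auto intro!: sums_summable[OF sums_single] sums_single\<close>)
  moreover have "(\<Sum>n. L2_norm \<mu> (?a n) * L2_norm \<mu> b) = L2_norm \<mu> a * L2_norm \<mu> b"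
    unfolding e by (rule sums_unique[symmetric, OF sums_single])
  ultimately show ?thesis unfolding fourier_bounded_def by (intro exI[of _ ?a] exI[of _ "\<lambda>_. b"]) simp
qed

lemma regular_coeff_diff_left:
  assumes "a \<in> L2 \<mu>" "a' \<in> L2 \<mu>" "b \<in> L2 \<mu>"
  shows "regular_coeff \<mu> (\<lambda>x. a x - a' x) b s = regular_coeff \<mu> a b s - regular_coeff \<mu> a' b s"
  unfolding regular_coeff_inner using assms by (intro L2_inner_diff_left L2_translate)

lemma regular_coeff_diff_right:
  assumes "a \<in> L2 \<mu>" "b \<in> L2 \<mu>" "b' \<in> L2 \<mu>"
  shows "regular_coeff \<mu> a (\<lambda>x. b x - b' x) s = regular_coeff \<mu> a b s - regular_coeff \<mu> a b' s"
  unfolding regular_coeff_inner using assms by (intro L2_inner_diff_right L2_translate)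

lemma regular_coeff_sum:
  assumes "\<And>i. i \<in> I \<Longrightarrow> a i \<in> L2 \<mu>" "\<And>j. j \<in> J \<Longrightarrow> b j \<in> L2 \<mu>"
  shows "regular_coeff \<mu> (\<lambda>x. \<Sum>i\<in>I. a i x) (\<lambda>x. \<Sum>j\<in>J. b j x) s
    = (\<Sum>i\<in>I. \<Sum>j\<in>J. regular_coeff \<mu> (a i) (b j) s)"
proof -
  have "L2_inner \<mu> (\<lambda>t. \<Sum>i\<in>I. a i (- s + t)) (\<lambda>x. \<Sum>j\<in>J. b j x)
    = (\<Sum>i\<in>I. L2_inner \<mu> (\<lambda>t. a i (- s + t)) (\<lambda>x. \<Sum>j\<in>J. b j x))"
    using assms by (intro L2_inner_sum_left L2_translate L2_sum)
  also have "\<dots> = (\<Sum>i\<in>I. \<Sum>j\<in>J. L2_inner \<mu> (\<lambda>t. a i (- s + t)) (b j))"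
    using assms by (intro sum.cong refl L2_inner_sum_right L2_translate)
  finally show ?thesis by (simp add: regular_coeff_inner)
qed

section \<open>Products with coefficients\<close>

text \<open>Exchanging the finite sum with the integral leaves the integral of the squared modulus
  of \<open>a\<close> times the sum of squares of the \<open>\<alpha> j\<close>. The pointwise bound
  is asked only where \<open>a\<close> is nonzero, which is how localisation to a cell
  enters.\<close>

lemma L2_set_weighted:
  assumes a: "a \<in> L2 \<mu>" and [measurable]: "\<And>j. \<alpha> j \<in> borel_measurable \<mu>" and "finite I" "0 \<le> P"
    and bound: "\<And>s. a s \<noteq> 0 \<Longrightarrow> (\<Sum>j\<in>I. (cmod (\<alpha> j s))\<^sup>2) \<le> P\<^sup>2"
  shows "\<And>j. j \<in> I \<Longrightarrow> (\<lambda>s. a s * \<alpha> j s) \<in> L2 \<mu>"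
    and "L2_set (\<lambda>j. L2_norm \<mu> (\<lambda>s. a s * \<alpha> j s)) I \<le> P * L2_norm \<mu> a"
proof -
  have [measurable]: "a \<in> borel_measurable \<mu>" using a by (simp add: L2_def)
  have b: "(\<Sum>j\<in>I. (cmod (a s * \<alpha> j s))\<^sup>2) \<le> P\<^sup>2 * (cmod (a s))\<^sup>2" for s
  proof (cases "a s = 0")
    case False
    have "(\<Sum>j\<in>I. (cmod (a s * \<alpha> j s))\<^sup>2) = (cmod (a s))\<^sup>2 * (\<Sum>j\<in>I. (cmod (\<alpha> j s))\<^sup>2)"
      by (simp add: norm_mult power_mult_distrib sum_distrib_left)
    also have "\<dots> \<le> (cmod (a s))\<^sup>2 * P\<^sup>2" by (intro mult_left_mono bound False) simp
    finally show ?thesis by (simp add: mult.commute)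
  qed simp
  show L: "(\<lambda>s. a s * \<alpha> j s) \<in> L2 \<mu>" if "j \<in> I" for j
  proof (rule L2_boundedI)
    show "integrable \<mu> (\<lambda>s. P\<^sup>2 * (cmod (a s))\<^sup>2)" using L2_integrable[OF a] by simp
    fix s
    show "(cmod (a s * \<alpha> j s))\<^sup>2 \<le> P\<^sup>2 * (cmod (a s))\<^sup>2"
      using member_le_sum[OF that, of "\<lambda>j. (cmod (a s * \<alpha> j s))\<^sup>2"] b[of s] \<open>finite I\<close> by fastforce
  qed measurable
  have "(L2_set (\<lambda>j. L2_norm \<mu> (\<lambda>s. a s * \<alpha> j s)) I)\<^sup>2 = (\<Sum>j\<in>I. \<integral>s. (cmod (a s * \<alpha> j s))\<^sup>2 \<partial>\<mu>)"
    by (simp add: L2_set_def sum_nonneg L2_norm_power2)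
  also have "\<dots> = (\<integral>s. (\<Sum>j\<in>I. (cmod (a s * \<alpha> j s))\<^sup>2) \<partial>\<mu>)"
    by (intro Bochner_Integration.integral_sum[symmetric] L2_integrable L)
  also have "\<dots> \<le> (\<integral>s. P\<^sup>2 * (cmod (a s))\<^sup>2 \<partial>\<mu>)"
    using L2_integrable[OF L] L2_integrable[OF a] b
    by (intro integral_mono Bochner_Integration.integrable_sum) auto
  also have "\<dots> = (P * L2_norm \<mu> a)\<^sup>2" by (simp add: power_mult_distrib L2_norm_power2)
  finally show "L2_set (\<lambda>j. L2_norm \<mu> (\<lambda>s. a s * \<alpha> j s)) I \<le> P * L2_norm \<mu> a"
    by (rule power2_le_imp_le) (simp add: \<open>0 \<le> P\<close>)
qed

text \<open>Splitting the sum at \<open>N\<close> makes the bound small as soon as \<open>p\<close> and \<open>q\<close> are small.\<close>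

lemma fourier_bounded_kernel:
  assumes a: "a \<in> L2 \<mu>" and b: "b \<in> L2 \<mu>"
    and m: "\<And>j. \<alpha> j \<in> borel_measurable \<mu>" "\<And>j. \<beta> j \<in> borel_measurable \<mu>"
    and K: "\<And>s t. (\<lambda>j. \<alpha> j s * cnj (\<beta> j t)) sums f (t - s)"
    and nn: "0 \<le> A" "0 \<le> B" "0 \<le> p" "0 \<le> q"
    and A: "\<And>s I. a s \<noteq> 0 \<Longrightarrow> finite I \<Longrightarrow> (\<Sum>j\<in>I. (cmod (\<alpha> j s))\<^sup>2) \<le> A\<^sup>2"
    and p: "\<And>s I. a s \<noteq> 0 \<Longrightarrow> finite I \<Longrightarrow> I \<subseteq> {..<N} \<Longrightarrow> (\<Sum>j\<in>I. (cmod (\<alpha> j s))\<^sup>2) \<le> p\<^sup>2"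
    and B: "\<And>t I. b t \<noteq> 0 \<Longrightarrow> finite I \<Longrightarrow> (\<Sum>j\<in>I. (cmod (\<beta> j t))\<^sup>2) \<le> B\<^sup>2"
    and q: "\<And>t I. b t \<noteq> 0 \<Longrightarrow> finite I \<Longrightarrow> I \<subseteq> {N..} \<Longrightarrow> (\<Sum>j\<in>I. (cmod (\<beta> j t))\<^sup>2) \<le> q\<^sup>2"
  shows "fourier_bounded \<mu> (\<lambda>x. f x * regular_coeff \<mu> a b x)
    ((p * B + A * q) * (L2_norm \<mu> a * L2_norm \<mu> b))"
proof -
  let ?\<xi> = "\<lambda>j s. a s * \<alpha> j s"
  let ?\<eta> = "\<lambda>j t. b t * \<beta> j t"
  let ?C = "(p * B + A * q) * (L2_norm \<mu> a * L2_norm \<mu> b)"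
  have L: "?\<xi> j \<in> L2 \<mu>" "?\<eta> j \<in> L2 \<mu>" for j
    using L2_set_weighted(1)[where \<alpha>=\<alpha> and I="{j}" and j=j, OF a m(1) _ nn(1)] A[where I="{j}"]
      L2_set_weighted(1)[where \<alpha>=\<beta> and I="{j}" and j=j, OF b m(2) _ nn(2)] B[where I="{j}"]
    by auto
  have part: "(\<Sum>j\<in>I. L2_norm \<mu> (?\<xi> j) * L2_norm \<mu> (?\<eta> j)) \<le> P * Q * (L2_norm \<mu> a * L2_norm \<mu> b)"
    if I: "finite I" "0 \<le> P" "0 \<le> Q" 
      "\<And>s. a s \<noteq> 0 \<Longrightarrow> (\<Sum>j\<in>I. (cmod (\<alpha> j s))\<^sup>2) \<le> P\<^sup>2"
      "\<And>t. b t \<noteq> 0 \<Longrightarrow> (\<Sum>j\<in>I. (cmod (\<beta> j t))\<^sup>2) \<le> Q\<^sup>2" for I P Q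
  proof -
    have "(\<Sum>j\<in>I. L2_norm \<mu> (?\<xi> j) * L2_norm \<mu> (?\<eta> j))
      \<le> L2_set (\<lambda>j. L2_norm \<mu> (?\<xi> j)) I * L2_set (\<lambda>j. L2_norm \<mu> (?\<eta> j)) I"
      using L2_set_mult_ineq[of "\<lambda>j. L2_norm \<mu> (?\<xi> j)" "\<lambda>j. L2_norm \<mu> (?\<eta> j)" I] by simp
    also have "\<dots> \<le> (P * L2_norm \<mu> a) * (Q * L2_norm \<mu> b)"
      by (intro mult_mono L2_set_weighted(2)[OF a m(1) I(1,2,4)] L2_set_weighted(2)[OF b m(2) I(1,3,5)])
        (use I in auto)
    finally show ?thesis by (simp add: mult_ac)
  qed
  have bound: "(\<Sum>j<n. L2_norm \<mu> (?\<xi> j) * L2_norm \<mu> (?\<eta> j)) \<le> ?C" for n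
  proof -
    \<comment> \<open>Below \<open>N\<close> the functions \<open>\<alpha> j\<close> are small and
      \<open>\<beta> j\<close> bounded; from \<open>N\<close> on the roles are reversed.\<close>
    have "(\<Sum>j<n. L2_norm \<mu> (?\<xi> j) * L2_norm \<mu> (?\<eta> j))
      = (\<Sum>j\<in>{..<n} \<inter> {..<N}. L2_norm \<mu> (?\<xi> j) * L2_norm \<mu> (?\<eta> j))
        + (\<Sum>j\<in>{..<n} - {..<N}. L2_norm \<mu> (?\<xi> j) * L2_norm \<mu> (?\<eta> j))"
      by (rule sum.Int_Diff) simp
    also have "\<dots> \<le> p * B * (L2_norm \<mu> a * L2_norm \<mu> b) + A * q * (L2_norm \<mu> a * L2_norm \<mu> b)"
      by (intro add_mono part nn) (auto intro!: A B p q)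
    finally show ?thesis by (simp add: distrib_right)
  qed
  have sm: "summable (\<lambda>j. L2_norm \<mu> (?\<xi> j) * L2_norm \<mu> (?\<eta> j))"
    by (rule summableI_nonneg_bounded[OF _ bound]) simp
  have "fourier_rep \<mu> (\<lambda>x. f x * regular_coeff \<mu> a b x) ?\<xi> ?\<eta>"
    unfolding fourier_rep_def
  proof (intro conjI allI L sm)
    fix x
    let ?g = "\<lambda>j t. ?\<xi> j (- x + t) * cnj (?\<eta> j t)"
    have Lt: "(\<lambda>t. ?\<xi> j (- x + t)) \<in> L2 \<mu>" for j using L2_translate[OF L(1)] .
    have "(\<lambda>j. \<integral>t. ?g j t \<partial>\<mu>) sums (\<integral>t. (\<Sum>j. ?g j t) \<partial>\<mu>)"
    proof (rule sums_integral)
      show "integrable \<mu> (?g j)" for j by (rule L2_mult_integrable[OF Lt L(2)])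
      show "AE t in \<mu>. summable (\<lambda>j. norm (?g j t))"
      proof (rule AE_I2)
        fix t
        show "summable (\<lambda>j. norm (?g j t))"
        proof (cases "a (- x + t) = 0 \<or> b t = 0")
          case False
          have "summable (\<lambda>j. cmod (\<alpha> j (- x + t)) * cmod (\<beta> j t))"
          proof (rule summableI_nonneg_bounded[where x="A * B"])
            fix n
            have "(\<Sum>j<n. cmod (\<alpha> j (- x + t)) * cmod (\<beta> j t))
              \<le> L2_set (\<lambda>j. cmod (\<alpha> j (- x + t))) {..<n} * L2_set (\<lambda>j. cmod (\<beta> j t)) {..<n}"
              using L2_set_mult_ineq[of "\<lambda>j. cmod (\<alpha> j (- x + t))" "\<lambda>j. cmod (\<beta> j t)" "{..<n}"] by simp
            also have "\<dots> \<le> A * B"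
              unfolding L2_set_def using A[of "- x + t" "{..<n}"] B[of t "{..<n}"] False nn
              by (intro mult_mono real_le_lsqrt) (auto intro: sum_nonneg)
            finally show "(\<Sum>j<n. cmod (\<alpha> j (- x + t)) * cmod (\<beta> j t)) \<le> A * B" .
          qed simp
          then have "summable (\<lambda>j. (cmod (a (- x + t)) * cmod (b t)) * (cmod (\<alpha> j (- x + t)) * cmod (\<beta> j t)))"
            by (rule summable_mult)
          then show ?thesis by (simp add: norm_mult mult_ac)
        qed auto
      qed
      show "summable (\<lambda>j. \<integral>t. norm (?g j t) \<partial>\<mu>)"
      proof (rule summable_comparison_test'[OF sm, where N=0])
        fix j
        have "(\<integral>t. norm (?g j t) \<partial>\<mu>) = (\<integral>t. cmod (?\<xi> j (- x + t)) * cmod (?\<eta> j t) \<partial>\<mu>)"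
          by (simp add: norm_mult)
        also have "\<dots> \<le> L2_norm \<mu> (\<lambda>t. ?\<xi> j (- x + t)) * L2_norm \<mu> (?\<eta> j)"
          by (rule L2_Cauchy_Schwarz_abs[OF Lt L(2)])
        also have "L2_norm \<mu> (\<lambda>t. ?\<xi> j (- x + t)) = L2_norm \<mu> (?\<xi> j)"
          using L(1)[of j] by (intro L2_norm_translate[of "?\<xi> j"]) (simp add: L2_def)
        finally show "norm (\<integral>t. norm (?g j t) \<partial>\<mu>) \<le> L2_norm \<mu> (?\<xi> j) * L2_norm \<mu> (?\<eta> j)"
          by simp
      qed
    qed
    also have "(\<integral>t. (\<Sum>j. ?g j t) \<partial>\<mu>) = (\<integral>t. f x * (a (- x + t) * cnj (b t)) \<partial>\<mu>)"
    proof (rule Bochner_Integration.integral_cong[OF refl])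
      fix t
      \<comment> \<open>At \<open>s = - x + t\<close> the kernel takes the value \<open>f x\<close>
        for every \<open>t\<close>, so \<open>f x\<close> leaves the integral and the coefficient of
        \<open>a\<close> and \<open>b\<close> at \<open>x\<close> remains.\<close>
      have "t - (- x + t) = x" 
        by (simp only: diff_conv_add_uminus minus_add minus_minus add.assoc[symmetric] right_minus add_0)
      then have "(\<lambda>j. (a (- x + t) * cnj (b t)) * (\<alpha> j (- x + t) * cnj (\<beta> j t))) sums ((a (- x + t) * cnj (b t)) * f x)"
        using K[of "- x + t" t] by (intro sums_mult) simp
      then have "(\<lambda>j. ?g j t) sums (f x * (a (- x + t) * cnj (b t)))"
        by (simp add: mult_ac)
      then show "(\<Sum>j. ?g j t) = f x * (a (- x + t) * cnj (b t))" by (simp add: sums_iff)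
    qed
    also have "\<dots> = f x * regular_coeff \<mu> a b x" by (simp add: regular_coeff_def)
    finally show "(\<lambda>j. regular_coeff \<mu> (?\<xi> j) (?\<eta> j) x) sums (f x * regular_coeff \<mu> a b x)"
      by (simp add: regular_coeff_def)
  qed
  moreover have "(\<Sum>j. L2_norm \<mu> (?\<xi> j) * L2_norm \<mu> (?\<eta> j)) \<le> ?C"
    by (rule suminf_le_const[OF sm bound])
  ultimately show ?thesis unfolding fourier_bounded_def by blast
qed

section \<open>Coefficients as inner products\<close>

definition l2seq :: "(nat \<Rightarrow> 'a \<Rightarrow> complex) \<Rightarrow> bool" where
  "l2seq h \<longleftrightarrow> (\<forall>n. h n \<in> L2 \<mu>) \<and> summable (\<lambda>n. (L2_norm \<mu> (h n))\<^sup>2)"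

text \<open>The Hilbert sum of countably many copies of \<open>L2 \<mu>\<close> becomes a single
  \<open>L2\<close> space, to which the Gram-Schmidt results apply as they stand.\<close>

abbreviation seq_measure :: "(nat \<times> 'a) measure" where
  "seq_measure \<equiv> count_space UNIV \<Otimes>\<^sub>M \<mu>"

lemma seq_pair_sigma_finite: "pair_sigma_finite (count_space (UNIV :: nat set)) \<mu>"
  by (intro pair_sigma_finite.intro sigma_finite_measure_count_space sigma_finite_measure_axioms)

lemma l2seq_L2:
  assumes "l2seq h"
  shows "case_prod h \<in> L2 seq_measure"
    and "(L2_norm seq_measure (case_prod h))\<^sup>2 = (\<Sum>n. (L2_norm \<mu> (h n))\<^sup>2)"
proof -
  interpret pair_sigma_finite "count_space (UNIV :: nat set)" \<mu> by (rule seq_pair_sigma_finite)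
  let ?f = "\<lambda>x. (cmod (case_prod h x))\<^sup>2"
  have h: "h n \<in> L2 \<mu>" for n using assms by (simp add: l2seq_def)
  have m: "case_prod h \<in> borel_measurable seq_measure"
    by (rule measurable_pair_measure_countable1) (use h in \<open>auto simp: L2_def\<close>)
  have ic: "integrable (count_space UNIV) (\<lambda>n. (L2_norm \<mu> (h n))\<^sup>2)"
    using assms by (simp add: integrable_count_space_nat_iff l2seq_def)
  have i: "integrable seq_measure ?f"
  proof (rule Fubini_integrable)
    show "?f \<in> borel_measurable seq_measure" using m by measurable
    show "integrable (count_space UNIV) (\<lambda>n. \<integral>y. norm (?f (n, y)) \<partial>\<mu>)"
      using ic by (simp add: L2_norm_power2)
    show "AE n in count_space UNIV. integrable \<mu> (\<lambda>y. ?f (n, y))"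
      using L2_integrable[OF h] by simp
  qed
  then show "case_prod h \<in> L2 seq_measure" using m by (simp add: L2_def)
  have "(L2_norm seq_measure (case_prod h))\<^sup>2 = (\<integral>n. (\<integral>y. ?f (n, y) \<partial>\<mu>) \<partial>count_space UNIV)"
    unfolding L2_norm_power2 by (rule integral_fst'[OF i, symmetric])
  also have "\<dots> = (\<integral>n. (L2_norm \<mu> (h n))\<^sup>2 \<partial>count_space UNIV)"
    by (simp add: L2_norm_power2)
  also have "\<dots> = (\<Sum>n. (L2_norm \<mu> (h n))\<^sup>2)" by (rule integral_count_space_nat[OF ic])
  finally show "(L2_norm seq_measure (case_prod h))\<^sup>2 = (\<Sum>n. (L2_norm \<mu> (h n))\<^sup>2)" .
qed

lemma l2seq_inner:
  assumes "l2seq g" "l2seq h"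
  shows "(\<lambda>n. L2_inner \<mu> (g n) (h n)) sums L2_inner seq_measure (case_prod g) (case_prod h)"
proof -
  interpret pair_sigma_finite "count_space (UNIV :: nat set)" \<mu> by (rule seq_pair_sigma_finite)
  note i = L2_mult_integrable(1)[OF l2seq_L2(1)[OF assms(1)] l2seq_L2(1)[OF assms(2)]]
  have "(\<lambda>n. L2_inner \<mu> (g n) (h n)) sums (\<integral>n. L2_inner \<mu> (g n) (h n) \<partial>count_space UNIV)"
    using integrable_fst'[OF i] by (intro sums_integral_count_space_nat) (simp add: L2_inner_def)
  also have "(\<integral>n. L2_inner \<mu> (g n) (h n) \<partial>count_space UNIV) = L2_inner seq_measure (case_prod g) (case_prod h)"
    using integral_fst'[OF i] by (simp add: L2_inner_def)
  finally show ?thesis .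
qed

text \<open>The infinite amplification of the left regular representation: all coordinates of
  \<open>v\<close> are translated by the inverse of \<open>s\<close>.\<close>

definition amp :: "(nat \<Rightarrow> 'a \<Rightarrow> complex) \<Rightarrow> 'a \<Rightarrow> nat \<times> 'a \<Rightarrow> complex" where
  "amp v s = (\<lambda>(n, r). v n (s + r))"

lemma l2seq_translate:
  assumes "l2seq v"
  shows "l2seq (\<lambda>n r. v n (s + r))" "L2_norm \<mu> (\<lambda>r. v n (s + r)) = L2_norm \<mu> (v n)"
proof -
  have v: "v n \<in> L2 \<mu>" for n using assms by (simp add: l2seq_def)
  show n: "L2_norm \<mu> (\<lambda>r. v n (s + r)) = L2_norm \<mu> (v n)" for n
    using v[of n] by (intro L2_norm_translate) (simp add: L2_def)
  show "l2seq (\<lambda>n r. v n (s + r))"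
    using assms by (simp add: l2seq_def L2_translate n)
qed

lemma amp_L2:
  assumes "l2seq v"
  shows "amp v s \<in> L2 seq_measure" "(L2_norm seq_measure (amp v s))\<^sup>2 = (\<Sum>n. (L2_norm \<mu> (v n))\<^sup>2)"
  unfolding amp_def using l2seq_L2[OF l2seq_translate(1)[OF assms]]
  by (simp_all add: l2seq_translate(2)[OF assms])

text \<open>Each coordinate converges by continuity of translation. The squared norms are dominated
  by the summable \<open>4 * (L2_norm \<mu> (v n))\<^sup>2\<close>, so Tannery's theorem allows the
  limit inside the series.\<close>

lemma amp_tendsto:
  assumes v: "l2seq v"
  shows "((\<lambda>s. L2_norm seq_measure (\<lambda>x. amp v s x - amp v s0 x)) \<longlongrightarrow> 0) (nhds s0)"
proof -
  let ?g = "\<lambda>n s. L2_norm \<mu> (\<lambda>r. v n (s + r) - v n (s0 + r))"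
  have vL: "v n \<in> L2 \<mu>" for n using v by (simp add: l2seq_def)
  have g2: "(?g n s)\<^sup>2 \<le> 4 * (L2_norm \<mu> (v n))\<^sup>2" for n s
  proof -
    have "?g n s \<le> L2_norm \<mu> (\<lambda>r. v n (s + r)) + L2_norm \<mu> (\<lambda>r. v n (s0 + r))"
      by (intro L2_norm_diff L2_translate vL)
    then have "?g n s \<le> 2 * L2_norm \<mu> (v n)" by (simp add: l2seq_translate(2)[OF v])
    then have "(?g n s)\<^sup>2 \<le> (2 * L2_norm \<mu> (v n))\<^sup>2" by (intro power_mono) auto
    then show ?thesis by (simp add: power_mult_distrib)
  qed
  have s4: "summable (\<lambda>n. 4 * (L2_norm \<mu> (v n))\<^sup>2)"
    using v by (simp add: l2seq_def)
  have l: "l2seq (\<lambda>n r. v n (s + r) - v n (s0 + r))" for s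
    unfolding l2seq_def
  proof (intro conjI allI L2_diff L2_translate vL)
    show "summable (\<lambda>n. (?g n s)\<^sup>2)"
      by (rule summable_comparison_test'[OF s4, where N=0]) (use g2 in auto)
  qed
  have eq: "(\<lambda>x. amp v s x - amp v s0 x) = (\<lambda>(n, r). v n (s + r) - v n (s0 + r))" for s
    by (auto simp: amp_def)
  have nrm: "L2_norm seq_measure (\<lambda>x. amp v s x - amp v s0 x) = sqrt (\<Sum>n. (?g n s)\<^sup>2)" for s
    unfolding eq l2seq_L2(2)[OF l, symmetric] by simp
  have "((\<lambda>s. \<Sum>n. (?g n s)\<^sup>2) \<longlongrightarrow> (\<Sum>n. 0)) (nhds s0)"
  proof (rule tannerys_theorem[THEN conjunct2, THEN conjunct2, OF _ _ s4])
    show "((\<lambda>s. (?g n s)\<^sup>2) \<longlongrightarrow> 0) (nhds s0)" for n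
      using tendsto_power[OF L2_translate_tendsto[OF vL[of n], of s0], of 2] by simp
    show "eventually (\<lambda>(n, s). norm ((?g n s)\<^sup>2) \<le> 4 * (L2_norm \<mu> (v n))\<^sup>2) (at_top \<times>\<^sub>F nhds s0)"
      using g2 by (intro always_eventually) auto
  qed simp
  then have "((\<lambda>s. sqrt (\<Sum>n. (?g n s)\<^sup>2)) \<longlongrightarrow> sqrt 0) (nhds s0)"
    by (intro tendsto_real_sqrt) simp
  then show ?thesis unfolding nrm by simp
qed

text \<open>By left invariance the substitution \<open>y = t + r\<close> turns \<open>s + r\<close>
  into \<open>- (t - s) + y\<close>, the argument in the coefficient at
  \<open>t - s\<close>.\<close>

lemma amp_inner:
  assumes "fourier_rep \<mu> f \<xi> \<eta>" "l2seq \<xi>" "l2seq \<eta>"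
  shows "L2_inner seq_measure (amp \<xi> s) (amp \<eta> t) = f (t - s)"
proof -
  have c: "L2_inner \<mu> (\<lambda>r. \<xi> n (s + r)) (\<lambda>r. \<eta> n (t + r)) = regular_coeff \<mu> (\<xi> n) (\<eta> n) (t - s)" for n
  proof -
    have L: "\<xi> n \<in> L2 \<mu>" "\<eta> n \<in> L2 \<mu>" using assms by (auto simp: l2seq_def)
    let ?h = "\<lambda>y. \<xi> n (- (t - s) + y) * cnj (\<eta> n y)"
    have e: "- (t - s) + (t + r) = s + r" for r
      by (simp only: diff_conv_add_uminus minus_add minus_minus add.assoc[symmetric]) (simp add: add.assoc)
    have "(\<integral>r. ?h (t + r) \<partial>\<mu>) = (\<integral>y. ?h y \<partial>\<mu>)"
      using L2_mult_integrable(1)[OF L2_translate[OF L(1)] L(2)]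
      by (intro integral_translate) (rule borel_measurable_integrable)
    then show ?thesis unfolding e by (simp add: L2_inner_def regular_coeff_def)
  qed
  have "(\<lambda>n. regular_coeff \<mu> (\<xi> n) (\<eta> n) (t - s)) sums L2_inner seq_measure (amp \<xi> s) (amp \<eta> t)"
    using l2seq_inner[OF l2seq_translate(1)[OF assms(2), of s] l2seq_translate(1)[OF assms(3), of t]]
    by (simp add: c amp_def)
  moreover have "(\<lambda>n. regular_coeff \<mu> (\<xi> n) (\<eta> n) (t - s)) sums f (t - s)"
    using assms(1) by (simp add: fourier_rep_def)
  ultimately show ?thesis by (rule sums_unique2)
qed

lemma amp_inner_measurable:
  assumes v: "l2seq v" and w: "w \<in> L2 seq_measure"
  shows "(\<lambda>s. L2_inner seq_measure (amp v s) w) \<in> borel_measurable \<mu>"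
proof -
  have "continuous_on UNIV (\<lambda>s. L2_inner seq_measure (amp v s) w)"
    unfolding continuous_on_def
  proof
    fix s0
    have "((\<lambda>s. L2_inner seq_measure (amp v s) w - L2_inner seq_measure (amp v s0) w) \<longlongrightarrow> 0) (nhds s0)"
    proof (rule tendsto_0_le[where K="L2_norm seq_measure w", OF amp_tendsto[OF v, of s0]])
      show "\<forall>\<^sub>F s in nhds s0. norm (L2_inner seq_measure (amp v s) w - L2_inner seq_measure (amp v s0) w)
        \<le> norm (L2_norm seq_measure (\<lambda>x. amp v s x - amp v s0 x)) * L2_norm seq_measure w"
      proof (rule always_eventually, rule allI)
        fix s
        show "norm (L2_inner seq_measure (amp v s) w - L2_inner seq_measure (amp v s0) w)
          \<le> norm (L2_norm seq_measure (\<lambda>x. amp v s x - amp v s0 x)) * L2_norm seq_measure w"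
          using L2_Cauchy_Schwarz[OF L2_diff[OF amp_L2(1)[OF v, of s] amp_L2(1)[OF v, of s0]] w]
          by (simp add: L2_inner_diff_left amp_L2(1)[OF v] w)
      qed
    qed
    then have "((\<lambda>s. L2_inner seq_measure (amp v s) w) \<longlongrightarrow> L2_inner seq_measure (amp v s0) w) (nhds s0)"
      by (rule LIM_zero_cancel)
    then show "((\<lambda>s. L2_inner seq_measure (amp v s) w) \<longlongrightarrow> L2_inner seq_measure (amp v s0) w) (at s0 within UNIV)"
      by (rule filterlim_mono[OF _ order_refl]) (simp add: at_within_le_nhds)
  qed
  then show ?thesis
    by (subst measurable_cong_sets[OF sets_haar refl]) (rule borel_measurable_continuous_onI)
qed

text \<open>A countable dense subset of the group works for every \<open>v\<close> simultaneously,
  because each \<open>amp v\<close> is continuous.\<close>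

lemma amp_dense:
  obtains d :: "nat \<Rightarrow> 'a" where
    "\<And>v s \<epsilon>. l2seq v \<Longrightarrow> \<epsilon> > 0 \<Longrightarrow> \<exists>i. L2_norm seq_measure (\<lambda>x. amp v s x - amp v (d i) x) < \<epsilon>"
proof -
  obtain D :: "'a set" where D: "countable D" "\<And>X. open X \<Longrightarrow> X \<noteq> {} \<Longrightarrow> \<exists>d\<in>D. d \<in> X"
    by (erule countable_dense_setE)
  show ?thesis
  proof (rule that[of "from_nat_into D"])
    fix v :: "nat \<Rightarrow> 'a \<Rightarrow> complex" and s \<epsilon> assume v: "l2seq v" and \<epsilon>: "(\<epsilon>::real) > 0"
    from order_tendstoD(2)[OF amp_tendsto[OF v, of s] \<epsilon>]
    obtain U where U: "open U" "s \<in> U"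
      "\<And>y. y \<in> U \<Longrightarrow> L2_norm seq_measure (\<lambda>x. amp v y x - amp v s x) < \<epsilon>"
      unfolding eventually_nhds by blast
    obtain y where "y \<in> D" "y \<in> U" using D(2)[OF U(1)] U(2) by blast
    moreover obtain i where "from_nat_into D i = y"
      using from_nat_into_surj[OF D(1) \<open>y \<in> D\<close>] by (rule exE)
    ultimately show "\<exists>i. L2_norm seq_measure (\<lambda>x. amp v s x - amp v (from_nat_into D i) x) < \<epsilon>"
      using U(3)[of y] L2_norm_minus_commute[of seq_measure "amp v s"] by (intro exI[of _ i]) simp
  qed
qed

text \<open>Multiplying the two factors of each term by reciprocal constants equalises their norms,
  so summability of the products becomes square summability of each sequence. This places both
  sequences in the Hilbert sum.\<close>

lemma balanced_rep:
  assumes "fourier_bounded \<mu> f R"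
  obtains \<xi> \<eta> where "fourier_rep \<mu> f \<xi> \<eta>" "l2seq \<xi>" "l2seq \<eta>"
    "(\<Sum>n. (L2_norm \<mu> (\<xi> n))\<^sup>2) \<le> R" "(\<Sum>n. (L2_norm \<mu> (\<eta> n))\<^sup>2) \<le> R"
proof -
  obtain \<xi> \<eta> where r: "fourier_rep \<mu> f \<xi> \<eta>" "(\<Sum>n. L2_norm \<mu> (\<xi> n) * L2_norm \<mu> (\<eta> n)) \<le> R"
    using assms unfolding fourier_bounded_def by blast
  have L: "\<xi> n \<in> L2 \<mu>" "\<eta> n \<in> L2 \<mu>" for n using r(1) by (auto simp: fourier_rep_def)
  \<comment> \<open>A term with a factor of norm 0 cannot be balanced by scaling; its coefficient is
    0 by Cauchy-Schwarz, so both factors are replaced by 0.\<close>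
  define z where "z n \<longleftrightarrow> L2_norm \<mu> (\<xi> n) = 0 \<or> L2_norm \<mu> (\<eta> n) = 0" for n
  define c where "c n = (if z n then 0 else sqrt (L2_norm \<mu> (\<eta> n) / L2_norm \<mu> (\<xi> n)))" for n
  define d where "d n = (if z n then 0 else sqrt (L2_norm \<mu> (\<xi> n) / L2_norm \<mu> (\<eta> n)))" for n
  let ?\<xi> = "\<lambda>n x. complex_of_real (c n) * \<xi> n x"
  let ?\<eta> = "\<lambda>n x. complex_of_real (d n) * \<eta> n x"
  have sq: "(L2_norm \<mu> (?\<xi> n))\<^sup>2 = L2_norm \<mu> (\<xi> n) * L2_norm \<mu> (\<eta> n)"
      "(L2_norm \<mu> (?\<eta> n))\<^sup>2 = L2_norm \<mu> (\<xi> n) * L2_norm \<mu> (\<eta> n)" for n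
    by (auto simp: c_def d_def z_def power_mult_distrib) (auto simp: power2_eq_square)
  have pr: "L2_norm \<mu> (?\<xi> n) * L2_norm \<mu> (?\<eta> n) = L2_norm \<mu> (\<xi> n) * L2_norm \<mu> (\<eta> n)" for n
  proof -
    have "L2_norm \<mu> (?\<xi> n) = L2_norm \<mu> (?\<eta> n)"
      by (rule power2_eq_imp_eq) (unfold sq, auto)
    then show ?thesis using sq(1)[of n] by (simp add: power2_eq_square)
  qed
  have co: "regular_coeff \<mu> (?\<xi> n) (?\<eta> n) s = regular_coeff \<mu> (\<xi> n) (\<eta> n) s" for n s
  proof -
    have "regular_coeff \<mu> (?\<xi> n) (?\<eta> n) s = complex_of_real (c n * d n) * regular_coeff \<mu> (\<xi> n) (\<eta> n) s"
      by (simp add: regular_coeff_inner L2_inner_scale_left L2_inner_scale_right)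
    also have "\<dots> = regular_coeff \<mu> (\<xi> n) (\<eta> n) s"
    proof (cases "z n")
      case True
      then have "regular_coeff \<mu> (\<xi> n) (\<eta> n) s = 0"
        using regular_coeff_bound[OF L, of n n s] by (auto simp: z_def)
      then show ?thesis by simp
    next
      case False
      then have "c n * d n = 1" by (simp add: c_def d_def z_def flip: real_sqrt_mult)
      then show ?thesis by simp
    qed
    finally show ?thesis .
  qed
  have "fourier_rep \<mu> f ?\<xi> ?\<eta>"
    unfolding fourier_rep_def co pr using r(1) by (auto simp: fourier_rep_def)
  moreover have "l2seq ?\<xi>" "l2seq ?\<eta>"
    unfolding l2seq_def sq using r(1) by (auto simp: fourier_rep_def)
  moreover have "(\<Sum>n. (L2_norm \<mu> (?\<xi> n))\<^sup>2) \<le> R" "(\<Sum>n. (L2_norm \<mu> (?\<eta> n))\<^sup>2) \<le> R"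
    unfolding sq using r(2) by simp_all
  ultimately show ?thesis using that[of ?\<xi> ?\<eta>] by blast
qed

text \<open>The function \<open>(s, t) \<mapsto> f (t - s)\<close> is the inner product of the continuous vector functions
  \<open>amp \<xi>\<close> and \<open>amp \<eta>\<close>. If \<open>f\<close> vanishes on \<open>T j - s\<^sub>0\<close>, then \<open>amp \<xi> s\<^sub>0\<close> is orthogonal to all
  \<open>amp \<eta> (T j)\<close>; hence near \<open>s\<^sub>0\<close> and near the points \<open>T j\<close> the expansion of the kernel in an
  orthonormal system adapted to the span of the vectors \<open>amp \<eta> (T j)\<close> has small coefficients.\<close>

lemma fourier_bounded_product:
  fixes N :: nat
  assumes rep: "fourier_rep \<mu> f \<xi> \<eta>" and l\<xi>: "l2seq \<xi>" and l\<eta>: "l2seq \<eta>"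
    and R: "(\<Sum>n. (L2_norm \<mu> (\<xi> n))\<^sup>2) \<le> R" "(\<Sum>n. (L2_norm \<mu> (\<eta> n))\<^sup>2) \<le> R"
    and a: "a \<in> L2 \<mu>" and b: "b \<in> L2 \<mu>" and "0 \<le> p" "0 \<le> q"
    and hp: "\<And>s. a s \<noteq> 0 \<Longrightarrow> \<exists>s0. L2_norm seq_measure (\<lambda>x. amp \<xi> s x - amp \<xi> s0 x) \<le> p
      \<and> (\<forall>j<N. f (T j - s0) = 0)"
    and hq: "\<And>t. b t \<noteq> 0 \<Longrightarrow>
      (\<exists>j<N. L2_norm seq_measure (\<lambda>x. amp \<eta> t x - amp \<eta> (T j) x) \<le> q) \<or> R \<le> q\<^sup>2"
  shows "fourier_bounded \<mu> (\<lambda>x. f x * regular_coeff \<mu> a b x)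
    ((p + q) * sqrt R * (L2_norm \<mu> a * L2_norm \<mu> b))"
proof -
  obtain d :: "nat \<Rightarrow> 'a" where d:
    "\<And>v s \<epsilon>. l2seq v \<Longrightarrow> \<epsilon> > 0 \<Longrightarrow> \<exists>i. L2_norm seq_measure (\<lambda>x. amp v s x - amp v (d i) x) < \<epsilon>"
    by (rule amp_dense) blast
  \<comment> \<open>The vectors at the points \<open>T j\<close> come first, so that their span lies
    in that of the first \<open>N\<close> members of \<open>e\<close>. The remaining ones make every
    \<open>amp \<xi> s\<close> a limit of the system, which is all that Parseval requires.\<close>
  define v where "v j = (if j < N then amp \<eta> (T j) else amp \<xi> (d (j - N)))" for j
  define e where "e = gram_schmidt seq_measure v"
  have vL: "v j \<in> L2 seq_measure" for j
    using amp_L2(1)[OF l\<xi>] amp_L2(1)[OF l\<eta>] by (simp add: v_def)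
  have on: "orthonormal_or_zero seq_measure e"
    unfolding e_def using vL by (rule gram_schmidt_orthonormal)
  have eL: "e j \<in> L2 seq_measure" for j
    unfolding e_def using vL by (rule gram_schmidt_L2)
  have "0 \<le> (\<Sum>n. (L2_norm \<mu> (\<xi> n))\<^sup>2)"
    using l\<xi> by (intro suminf_nonneg) (auto simp: l2seq_def)
  then have R0: "0 \<le> R" using R(1) by simp
  have eq: "(p + q) * sqrt R = p * sqrt R + sqrt R * q" by (simp add: algebra_simps)
  note dL = L2_diff[OF amp_L2(1) amp_L2(1)]
  show ?thesis
    unfolding eq
  proof (rule fourier_bounded_kernel[OF a b, where N=N and
        \<alpha>="\<lambda>j s. L2_inner seq_measure (amp \<xi> s) (e j)" and \<beta>="\<lambda>j t. L2_inner seq_measure (amp \<eta> t) (e j)"])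
    show "(\<lambda>s. L2_inner seq_measure (amp \<xi> s) (e j)) \<in> borel_measurable \<mu>"
         "(\<lambda>s. L2_inner seq_measure (amp \<eta> s) (e j)) \<in> borel_measurable \<mu>" for j
      by (intro amp_inner_measurable l\<xi> l\<eta> eL)+
    show "(\<lambda>j. L2_inner seq_measure (amp \<xi> s) (e j) * cnj (L2_inner seq_measure (amp \<eta> t) (e j)))
      sums f (t - s)" for s t
      unfolding amp_inner[OF rep l\<xi> l\<eta>, symmetric] e_def
    proof (rule gram_schmidt_Parseval)
      fix \<epsilon> :: real assume "0 < \<epsilon>"
      from d[OF l\<xi> this, of s] obtain i where
        "L2_norm seq_measure (\<lambda>x. amp \<xi> s x - amp \<xi> (d i) x) < \<epsilon>" by blast
      then show "\<exists>j. L2_norm seq_measure (\<lambda>x. amp \<xi> s x - v j x) < \<epsilon>"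
        by (intro exI[of _ "N + i"]) (simp add: v_def)
    qed (intro vL amp_L2 l\<xi> l\<eta>)+
    show "(\<Sum>j\<in>I. (cmod (L2_inner seq_measure (amp \<xi> s) (e j)))\<^sup>2) \<le> (sqrt R)\<^sup>2" if "finite I" for s I
      using onz_Bessel[OF on amp_L2(1)[OF l\<xi>, of s] that] R(1) R0 by (simp add: amp_L2(2)[OF l\<xi>])
    show B: "(\<Sum>j\<in>I. (cmod (L2_inner seq_measure (amp \<eta> t) (e j)))\<^sup>2) \<le> (sqrt R)\<^sup>2" if "finite I" for t I
      using onz_Bessel[OF on amp_L2(1)[OF l\<eta>, of t] that] R(2) R0 by (simp add: amp_L2(2)[OF l\<eta>])
    show "(\<Sum>j\<in>I. (cmod (L2_inner seq_measure (amp \<xi> s) (e j)))\<^sup>2) \<le> p\<^sup>2"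
      if "a s \<noteq> 0" and I: "finite I" "I \<subseteq> {..<N}" for s I
    proof -
      obtain s0 where s0: "L2_norm seq_measure (\<lambda>x. amp \<xi> s x - amp \<xi> s0 x) \<le> p"
        "\<And>j. j < N \<Longrightarrow> f (T j - s0) = 0" using hp[OF \<open>a s \<noteq> 0\<close>] by blast
      have "L2_inner seq_measure (amp \<xi> s0) (e j) = 0" if "j < N" for j
        unfolding e_def
      proof (rule gram_schmidt_orthogonal[OF vL amp_L2(1)[OF l\<xi>] _ that])
        show "L2_inner seq_measure (amp \<xi> s0) (v j) = 0" if "j < N" for j
          using s0(2)[OF that] that by (simp add: v_def amp_inner[OF rep l\<xi> l\<eta>])
      qed
      then have "L2_inner seq_measure (amp \<xi> s) (e j)
          = L2_inner seq_measure (\<lambda>x. amp \<xi> s x - amp \<xi> s0 x) (e j)" if "j \<in> I" for j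
        using that I(2) by (subst L2_inner_diff_left) (auto intro: amp_L2 l\<xi> eL)
      then have "(\<Sum>j\<in>I. (cmod (L2_inner seq_measure (amp \<xi> s) (e j)))\<^sup>2)
          = (\<Sum>j\<in>I. (cmod (L2_inner seq_measure (\<lambda>x. amp \<xi> s x - amp \<xi> s0 x) (e j)))\<^sup>2)"
        by (intro sum.cong) auto
      also have "\<dots> \<le> (L2_norm seq_measure (\<lambda>x. amp \<xi> s x - amp \<xi> s0 x))\<^sup>2"
        by (rule onz_Bessel[OF on dL[OF l\<xi> l\<xi>] I(1)])
      also have "\<dots> \<le> p\<^sup>2" by (intro power_mono s0) simp
      finally show ?thesis .
    qed
    show "(\<Sum>j\<in>I. (cmod (L2_inner seq_measure (amp \<eta> t) (e j)))\<^sup>2) \<le> q\<^sup>2"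
      if "b t \<noteq> 0" and I: "finite I" "I \<subseteq> {N..}" for t I
    \<comment> \<open>With \<open>q\<close> this large the full Bessel bound suffices; this
      alternative covers a product without any points \<open>T j\<close>.\<close>
    proof (cases "R \<le> q\<^sup>2")
      case True
      then show ?thesis using B[OF I(1), of t] R0 by simp
    next
      case False
      then obtain i where i: "i < N" "L2_norm seq_measure (\<lambda>x. amp \<eta> t x - amp \<eta> (T i) x) \<le> q"
        using hq[OF \<open>b t \<noteq> 0\<close>] by blast
      have "L2_inner seq_measure (amp \<eta> (T i)) (e j) = 0" if "j \<in> I" for j
      proof -
        have "i < j" using that I(2) i(1) by auto
        from gram_schmidt_inner_beyond[of v seq_measure, OF vL this] i(1) show ?thesis
          by (simp add: v_def e_def)
      qed
      then have "L2_inner seq_measure (amp \<eta> t) (e j)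
          = L2_inner seq_measure (\<lambda>x. amp \<eta> t x - amp \<eta> (T i) x) (e j)" if "j \<in> I" for j
        using that by (subst L2_inner_diff_left) (auto intro: amp_L2 l\<eta> eL)
      then have "(\<Sum>j\<in>I. (cmod (L2_inner seq_measure (amp \<eta> t) (e j)))\<^sup>2)
          = (\<Sum>j\<in>I. (cmod (L2_inner seq_measure (\<lambda>x. amp \<eta> t x - amp \<eta> (T i) x) (e j)))\<^sup>2)"
        by (intro sum.cong) auto
      also have "\<dots> \<le> (L2_norm seq_measure (\<lambda>x. amp \<eta> t x - amp \<eta> (T i) x))\<^sup>2"
        by (rule onz_Bessel[OF on dL[OF l\<eta> l\<eta>] I(1)])
      also have "\<dots> \<le> q\<^sup>2" by (intro power_mono i) simp
      finally show ?thesis .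
    qed
  qed (use \<open>0 \<le> p\<close> \<open>0 \<le> q\<close> R0 in auto)
qed

text \<open>The case \<open>N = 0\<close> of the kernel estimate, with \<open>p = 0\<close> and
  \<open>q = sqrt R\<close>. It yields that the Fourier algebra is closed under multiplication with
  submultiplicative bounds.\<close>

lemma fourier_bounded_mult_coeff:
  assumes "fourier_bounded \<mu> f R" "a \<in> L2 \<mu>" "b \<in> L2 \<mu>"
  shows "fourier_bounded \<mu> (\<lambda>x. f x * regular_coeff \<mu> a b x) (R * (L2_norm \<mu> a * L2_norm \<mu> b))"
proof -
  have R0: "0 \<le> R" using assms(1) by (rule fourier_bounded_nonneg)
  obtain \<xi> \<eta> where r: "fourier_rep \<mu> f \<xi> \<eta>" "l2seq \<xi>" "l2seq \<eta>"
    "(\<Sum>n. (L2_norm \<mu> (\<xi> n))\<^sup>2) \<le> R" "(\<Sum>n. (L2_norm \<mu> (\<eta> n))\<^sup>2) \<le> R"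
    using assms(1) by (rule balanced_rep)
  have "fourier_bounded \<mu> (\<lambda>x. f x * regular_coeff \<mu> a b x)
    ((0 + sqrt R) * sqrt R * (L2_norm \<mu> a * L2_norm \<mu> b))"
  proof (rule fourier_bounded_product[OF r assms(2,3), where N=0 and T="\<lambda>_. 0"])
    show "\<exists>s0. L2_norm seq_measure (\<lambda>x. amp \<xi> s x - amp \<xi> s0 x) \<le> 0 \<and> (\<forall>j<0::nat. f (0 - s0) = 0)" for s
      by (rule exI[of _ s]) simp
  qed (use R0 in auto)
  with R0 show ?thesis by simp
qed

lemma fourier_bounded_mult:
  assumes f: "fourier_bounded \<mu> f R" and u: "fourier_bounded \<mu> u S"
  shows "fourier_bounded \<mu> (\<lambda>x. f x * u x) (R * S)"
proof -
  obtain \<xi> \<eta> where r: "fourier_rep \<mu> u \<xi> \<eta>" "(\<Sum>n. L2_norm \<mu> (\<xi> n) * L2_norm \<mu> (\<eta> n)) \<le> S"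
    using u unfolding fourier_bounded_def by blast
  have s: "summable (\<lambda>n. L2_norm \<mu> (\<xi> n) * L2_norm \<mu> (\<eta> n))"
    using r(1) by (simp add: fourier_rep_def)
  have "fourier_bounded \<mu> (\<lambda>x. f x * u x) (\<Sum>n. R * (L2_norm \<mu> (\<xi> n) * L2_norm \<mu> (\<eta> n)))"
  proof (rule fourier_bounded_sums')
    show "fourier_bounded \<mu> (\<lambda>x. f x * regular_coeff \<mu> (\<xi> n) (\<eta> n) x)
        (R * (L2_norm \<mu> (\<xi> n) * L2_norm \<mu> (\<eta> n)))" for n
      using r(1) by (intro fourier_bounded_mult_coeff f) (auto simp: fourier_rep_def)
    show "(\<lambda>n. f x * regular_coeff \<mu> (\<xi> n) (\<eta> n) x) sums (f x * u x)" for x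
      using r(1) by (intro sums_mult) (simp add: fourier_rep_def)
  qed (intro summable_mult s)
  then show ?thesis
    by (rule fourier_bounded_mono) 
      (simp add: suminf_mult[OF s] mult_left_mono r(2) fourier_bounded_nonneg[OF f])
qed

end

section \<open>The ideal of functions approximable away from a set\<close>

abbreviation off_functions :: "'a::topological_group_add measure \<Rightarrow> 'a set \<Rightarrow> ('a \<Rightarrow> complex) set" where
  "off_functions \<mu> E \<equiv> {h \<in> fourier_algebra \<mu>. compact (supp h) \<and> supp h \<inter> E = {}}"

abbreviation off_ideal :: "'a::topological_group_add measure \<Rightarrow> 'a set \<Rightarrow> ('a \<Rightarrow> complex) set" where
  "off_ideal \<mu> E \<equiv> fourier_closure \<mu> (off_functions \<mu> E)"

context haar
begin

lemma off_idealI: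
  assumes f: "f \<in> fourier_algebra \<mu>"
    and "\<And>\<epsilon>. \<epsilon> > 0 \<Longrightarrow> \<exists>h\<in>off_functions \<mu> E. fourier_bounded \<mu> (\<lambda>x. f x - h x) \<epsilon>"
  shows "f \<in> off_ideal \<mu> E"
  unfolding fourier_closure_def
proof (intro CollectI conjI f allI impI)
  fix \<epsilon> :: real assume "0 < \<epsilon>"
  then obtain h where "h \<in> off_functions \<mu> E" "fourier_bounded \<mu> (\<lambda>x. f x - h x) (\<epsilon>/2)"
    using assms(2)[of "\<epsilon>/2"] by auto
  then show "\<exists>h\<in>off_functions \<mu> E. fourier_norm \<mu> (\<lambda>x. f x - h x) < \<epsilon>"
    using fourier_boundedD(2)[of \<mu> "\<lambda>x. f x - h x" "\<epsilon>/2"] \<open>0 < \<epsilon>\<close> by (intro bexI[of _ h]) auto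
qed

lemma off_ideal_algebra: "f \<in> off_ideal \<mu> E \<Longrightarrow> f \<in> fourier_algebra \<mu>"
  by (simp add: fourier_closure_def)

lemma off_idealD:
  assumes "f \<in> off_ideal \<mu> E" "\<epsilon> > 0"
  obtains h where "h \<in> off_functions \<mu> E" "fourier_bounded \<mu> (\<lambda>x. f x - h x) \<epsilon>"
proof -
  obtain h where h: "h \<in> off_functions \<mu> E" "fourier_norm \<mu> (\<lambda>x. f x - h x) < \<epsilon>"
    using assms unfolding fourier_closure_def by blast
  moreover have "(\<lambda>x. f x - h x) \<in> fourier_algebra \<mu>"
    using h off_ideal_algebra[OF assms(1)] by (intro fourier_algebra_diff) auto
  ultimately show ?thesis using that fourier_boundedI by blast
qed

lemma off_ideal_closed:
  assumes f: "f \<in> fourier_algebra \<mu>"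
    and app: "\<And>\<epsilon>. \<epsilon> > 0 \<Longrightarrow> \<exists>g\<in>off_ideal \<mu> E. fourier_bounded \<mu> (\<lambda>x. f x - g x) \<epsilon>"
  shows "f \<in> off_ideal \<mu> E"
proof (rule off_idealI[OF f])
  fix \<epsilon> :: real assume "\<epsilon> > 0"
  then have e2: "\<epsilon>/2 > 0" by simp
  obtain g where g: "g \<in> off_ideal \<mu> E" "fourier_bounded \<mu> (\<lambda>x. f x - g x) (\<epsilon>/2)"
    using app[OF e2] by blast
  obtain h where h: "h \<in> off_functions \<mu> E" "fourier_bounded \<mu> (\<lambda>x. g x - h x) (\<epsilon>/2)"
    using off_idealD[OF g(1) e2] by blast
  have "fourier_bounded \<mu> (\<lambda>x. f x - h x) \<epsilon>"
    using fourier_bounded_add[OF g(2) h(2)] by simp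
  with h(1) show "\<exists>h\<in>off_functions \<mu> E. fourier_bounded \<mu> (\<lambda>x. f x - h x) \<epsilon>" by blast
qed

lemma fourier_algebra_add:
  "u \<in> fourier_algebra \<mu> \<Longrightarrow> v \<in> fourier_algebra \<mu> \<Longrightarrow> (\<lambda>x. u x + v x) \<in> fourier_algebra \<mu>"
  by (elim fourier_algebra_bounded) (rule fourier_boundedD(1)[OF fourier_bounded_add])

lemma supp_add: "supp (\<lambda>x. g x + h x) \<subseteq> supp g \<union> supp h"
proof -
  have "{x. g x + h x \<noteq> 0} \<subseteq> {x. g x \<noteq> 0} \<union> {x. h x \<noteq> 0}" by auto
  then show ?thesis unfolding supp_def by (metis closure_Un closure_mono)
qed

lemma supp_mult: "supp (\<lambda>x. g x * h x) \<subseteq> supp g"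
  unfolding supp_def by (rule closure_mono) auto

lemma compact_supp_mono: "compact (supp g) \<Longrightarrow> supp h \<subseteq> supp g \<Longrightarrow> compact (supp h)"
  for g h :: "'a \<Rightarrow> complex"
  by (metis closed_closure compact_Int_closed inf.absorb_iff2 supp_def)

lemma off_ideal_add:
  assumes "f \<in> off_ideal \<mu> E" "g \<in> off_ideal \<mu> E"
  shows "(\<lambda>x. f x + g x) \<in> off_ideal \<mu> E"
proof (rule off_idealI)
  show "(\<lambda>x. f x + g x) \<in> fourier_algebra \<mu>"
    by (intro fourier_algebra_add assms[THEN off_ideal_algebra])
  fix \<epsilon> :: real assume "\<epsilon> > 0"
  then have e2: "\<epsilon>/2 > 0" by simp
  obtain h where h: "h \<in> off_functions \<mu> E" "fourier_bounded \<mu> (\<lambda>x. f x - h x) (\<epsilon>/2)"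
    using off_idealD[OF assms(1) e2] by blast
  obtain k where k: "k \<in> off_functions \<mu> E" "fourier_bounded \<mu> (\<lambda>x. g x - k x) (\<epsilon>/2)"
    using off_idealD[OF assms(2) e2] by blast
  have "compact (supp (\<lambda>x. h x + k x))"
  proof -
    have "compact (supp h \<union> supp k)" using h k by auto
    then have "compact ((supp h \<union> supp k) \<inter> supp (\<lambda>x. h x + k x))"
      by (rule compact_Int_closed) (simp add: supp_def)
    then show ?thesis by (simp add: Int_absorb1 supp_add)
  qed
  moreover have "supp (\<lambda>x. h x + k x) \<inter> E = {}" using supp_add[of h k] h k by blast
  ultimately have "(\<lambda>x. h x + k x) \<in> off_functions \<mu> E"
    using h k by (simp add: fourier_algebra_add)
  moreover have "fourier_bounded \<mu> (\<lambda>x. (f x + g x) - (h x + k x)) \<epsilon>"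
    using fourier_bounded_add[OF h(2) k(2)] by (simp add: algebra_simps)
  ultimately show "\<exists>h\<in>off_functions \<mu> E. fourier_bounded \<mu> (\<lambda>x. f x + g x - h x) \<epsilon>"
    by (intro bexI[of _ "\<lambda>x. h x + k x"])
qed

lemma off_ideal_zero: "(\<lambda>x. 0) \<in> off_ideal \<mu> E"
proof (rule off_idealI)
  show z: "(\<lambda>x. 0) \<in> fourier_algebra \<mu>" using fourier_boundedD(1)[OF fourier_bounded_zero] .
  fix \<epsilon> :: real assume "\<epsilon> > 0"
  then show "\<exists>h\<in>off_functions \<mu> E. fourier_bounded \<mu> (\<lambda>x. 0 - h x) \<epsilon>"
    using z fourier_bounded_mono[OF fourier_bounded_zero, of \<epsilon>]
    by (intro bexI[of _ "\<lambda>x. 0"]) (auto simp: supp_def)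
qed

lemma off_ideal_sum:
  assumes "\<And>i. i \<in> I \<Longrightarrow> f i \<in> off_ideal \<mu> E"
  shows "(\<lambda>x. \<Sum>i\<in>I. f i x) \<in> off_ideal \<mu> E"
  using assms
proof (induction I rule: infinite_finite_induct)
  case (insert i I)
  then have "(\<lambda>x. f i x + (\<Sum>i\<in>I. f i x)) \<in> off_ideal \<mu> E" by (intro off_ideal_add) auto
  with insert show ?case by simp
qed (auto intro: off_ideal_zero)

lemma off_ideal_antimono:
  assumes "E \<subseteq> E'" "f \<in> off_ideal \<mu> E'" shows "f \<in> off_ideal \<mu> E"
proof (rule off_idealI[OF off_ideal_algebra[OF assms(2)]])
  fix \<epsilon> :: real assume "\<epsilon> > 0"
  then obtain h where "h \<in> off_functions \<mu> E'" "fourier_bounded \<mu> (\<lambda>x. f x - h x) \<epsilon>"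
    using off_idealD[OF assms(2)] by blast
  then show "\<exists>h\<in>off_functions \<mu> E. fourier_bounded \<mu> (\<lambda>x. f x - h x) \<epsilon>" using assms(1) by blast
qed

section \<open>Multiplication by coefficients and reduction to compact supports\<close>

lemma fourier_algebra_mult_coeff:
  "f \<in> fourier_algebra \<mu> \<Longrightarrow> a \<in> L2 \<mu> \<Longrightarrow> b \<in> L2 \<mu> \<Longrightarrow>
    (\<lambda>x. f x * regular_coeff \<mu> a b x) \<in> fourier_algebra \<mu>"
  by (elim fourier_algebra_bounded) (rule fourier_boundedD(1)[OF fourier_bounded_mult_coeff])

text \<open>Approximants \<open>h\<close> of \<open>f\<close> are multiplied by the coefficient. The
  product inherits compact support away from \<open>F\<close> from \<open>h\<close>, while the
  coefficient keeps its support in \<open>S\<close> and hence away from \<open>E\<close>.\<close>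

lemma off_ideal_mult_coeff:
  assumes f: "f \<in> off_ideal \<mu> F" and a: "a \<in> L2 \<mu>" and b: "b \<in> L2 \<mu>" and S: "closed S" "S \<inter> E = {}"
    and van: "\<And>x. regular_coeff \<mu> a b x \<noteq> 0 \<Longrightarrow> x \<in> S"
  shows "(\<lambda>x. f x * regular_coeff \<mu> a b x) \<in> off_ideal \<mu> (F \<union> E)"
proof (rule off_idealI)
  let ?C = "L2_norm \<mu> a * L2_norm \<mu> b"
  show "(\<lambda>x. f x * regular_coeff \<mu> a b x) \<in> fourier_algebra \<mu>"
    by (intro fourier_algebra_mult_coeff off_ideal_algebra[OF f] a b)
  fix \<epsilon> :: real assume "\<epsilon> > 0"
  have C: "?C + 1 > 0" by (simp add: add_nonneg_pos)
  then have "\<epsilon> / (?C + 1) > 0" using \<open>\<epsilon> > 0\<close> by simp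
  then obtain h where h: "h \<in> off_functions \<mu> F" "fourier_bounded \<mu> (\<lambda>x. f x - h x) (\<epsilon> / (?C + 1))"
    using off_idealD[OF f] by blast
  let ?h = "\<lambda>x. h x * regular_coeff \<mu> a b x"
  have "supp ?h \<subseteq> S"
    unfolding supp_def by (rule closure_minimal[OF _ S(1)]) (use van in auto)
  moreover have "supp ?h \<subseteq> supp h" by (rule supp_mult)
  ultimately have "?h \<in> off_functions \<mu> (F \<union> E)"
    using h(1) S(2) compact_supp_mono[of h ?h] fourier_algebra_mult_coeff[OF _ a b, of h] by auto
  moreover have "fourier_bounded \<mu> (\<lambda>x. f x * regular_coeff \<mu> a b x - ?h x) \<epsilon>"
  proof (rule fourier_bounded_mono)
    show "fourier_bounded \<mu> (\<lambda>x. f x * regular_coeff \<mu> a b x - ?h x) (\<epsilon> / (?C + 1) * ?C)"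
      using fourier_bounded_mult_coeff[OF h(2) a b] by (simp add: left_diff_distrib)
    have "\<epsilon> * ?C \<le> \<epsilon> * (?C + 1)" using \<open>\<epsilon> > 0\<close> by simp
    then show "\<epsilon> / (?C + 1) * ?C \<le> \<epsilon>" using C by (simp add: divide_simps)
  qed
  ultimately show "\<exists>h\<in>off_functions \<mu> (F \<union> E).
    fourier_bounded \<mu> (\<lambda>x. f x * regular_coeff \<mu> a b x - h x) \<epsilon>"
    by (intro bexI[of _ ?h])
qed

text \<open>Since \<open>f\<close> and \<open>\<epsilon>\<close> are fixed before \<open>u\<close>
  is taken from the net, a net without a norm bound suffices. For this single \<open>u\<close> a
  representation is truncated to finitely many coefficients.\<close>

lemma off_ideal_of_products:
  assumes f: "f \<in> fourier_algebra \<mu>" and "has_approximate_identity \<mu>"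
    and coeff: "\<And>a b. a \<in> L2 \<mu> \<Longrightarrow> b \<in> L2 \<mu> \<Longrightarrow> (\<lambda>x. f x * regular_coeff \<mu> a b x) \<in> off_ideal \<mu> E"
  shows "f \<in> off_ideal \<mu> E"
proof (rule off_ideal_closed[OF f])
  obtain R where R: "fourier_bounded \<mu> f R" using f by (rule fourier_algebra_bounded)
  note R0 = fourier_bounded_nonneg[OF R]
  have prod: "(\<lambda>x. f x * u x) \<in> off_ideal \<mu> E" if u: "u \<in> fourier_algebra \<mu>" for u
  proof (rule off_ideal_closed)
    obtain D where D: "fourier_bounded \<mu> u D" using u by (rule fourier_algebra_bounded)
    show "(\<lambda>x. f x * u x) \<in> fourier_algebra \<mu>"
      using fourier_boundedD(1)[OF fourier_bounded_mult[OF R D]] .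
    obtain \<xi> \<eta> where r: "fourier_rep \<mu> u \<xi> \<eta>" using u unfolding fourier_algebra_def by blast
    let ?n = "\<lambda>n. L2_norm \<mu> (\<xi> n) * L2_norm \<mu> (\<eta> n)"
    have s: "summable ?n" and L: "\<xi> n \<in> L2 \<mu>" "\<eta> n \<in> L2 \<mu>"
      and us: "(\<lambda>n. regular_coeff \<mu> (\<xi> n) (\<eta> n) x) sums u x" for n x
      using r by (auto simp: fourier_rep_def)
    fix \<epsilon> :: real assume "\<epsilon> > 0"
    \<comment> \<open>The tolerance is scaled for the later multiplication by \<open>f\<close>; the
      added 1 keeps the divisor positive when \<open>R = 0\<close>.\<close>
    then have "\<epsilon> / (R + 1) > 0" using R0 by simp
    from suminf_exist_split[OF this s] obtain N where N: "norm (\<Sum>i. ?n (i + N)) < \<epsilon> / (R + 1)" by blast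
    have sN: "summable (\<lambda>i. ?n (i + N))" using s by (rule summable_ignore_initial_segment)
    have tail: "fourier_bounded \<mu> (\<lambda>x. u x - (\<Sum>n<N. regular_coeff \<mu> (\<xi> n) (\<eta> n) x)) (\<Sum>i. ?n (i + N))"
    proof (rule fourier_bounded_sums')
      show "fourier_bounded \<mu> (regular_coeff \<mu> (\<xi> (n + N)) (\<eta> (n + N))) (?n (n + N))" for n
        by (rule fourier_bounded_coeff[OF L])
      show "(\<lambda>n. regular_coeff \<mu> (\<xi> (n + N)) (\<eta> (n + N)) x) sums
        (u x - (\<Sum>n<N. regular_coeff \<mu> (\<xi> n) (\<eta> n) x))" for x
        by (rule sums_split_initial_segment[OF us])
    qed (rule sN)
    let ?g = "\<lambda>x. \<Sum>n<N. f x * regular_coeff \<mu> (\<xi> n) (\<eta> n) x"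
    have "?g \<in> off_ideal \<mu> E" by (intro off_ideal_sum coeff L)
    moreover have "fourier_bounded \<mu> (\<lambda>x. f x * u x - ?g x) \<epsilon>"
    proof (rule fourier_bounded_mono)
      show "fourier_bounded \<mu> (\<lambda>x. f x * u x - ?g x) (R * (\<Sum>i. ?n (i + N)))"
        using fourier_bounded_mult[OF R tail] by (simp add: right_diff_distrib sum_distrib_left)
      have "R * (\<Sum>i. ?n (i + N)) \<le> R * (\<epsilon> / (R + 1))"
        using N R0 by (intro mult_left_mono) auto
      also have "\<dots> \<le> \<epsilon>" using R0 \<open>\<epsilon> > 0\<close> by (simp add: divide_simps)
      finally show "R * (\<Sum>i. ?n (i + N)) \<le> \<epsilon>" .
    qed
    ultimately show "\<exists>g\<in>off_ideal \<mu> E. fourier_bounded \<mu> (\<lambda>x. f x * u x - g x) \<epsilon>"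
      by (intro bexI[of _ ?g])
  qed
  obtain \<U> :: "('a \<Rightarrow> complex) filter" where \<U>: "\<U> \<noteq> bot" "\<forall>\<^sub>F u in \<U>. u \<in> fourier_algebra \<mu>"
    "\<And>f. f \<in> fourier_algebra \<mu> \<Longrightarrow> ((\<lambda>u. fourier_norm \<mu> (\<lambda>x. u x * f x - f x)) \<longlongrightarrow> 0) \<U>"
    using assms(2) unfolding has_approximate_identity_def by blast
  fix \<epsilon> :: real assume "\<epsilon> > 0"
  then have "\<forall>\<^sub>F u in \<U>. u \<in> fourier_algebra \<mu> \<and> fourier_norm \<mu> (\<lambda>x. u x * f x - f x) < \<epsilon>"
    by (intro eventually_conj \<U>(2) order_tendstoD(2)[OF \<U>(3)[OF f]])
  then obtain u where u: "u \<in> fourier_algebra \<mu>" "fourier_norm \<mu> (\<lambda>x. u x * f x - f x) < \<epsilon>"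
    using eventually_happens'[OF \<U>(1)] by blast
  have "(\<lambda>x. u x * f x - f x) \<in> fourier_algebra \<mu>"
    using off_ideal_algebra[OF prod[OF u(1)]] f by (intro fourier_algebra_diff) (simp_all add: mult.commute)
  from fourier_bounded_scale[OF fourier_boundedI[OF this u(2)], of "- 1"]
  have "fourier_bounded \<mu> (\<lambda>x. f x - f x * u x) \<epsilon>" by (simp add: mult.commute)
  with prod[OF u(1)] show "\<exists>g\<in>off_ideal \<mu> E. fourier_bounded \<mu> (\<lambda>x. f x - g x) \<epsilon>"
    by (intro bexI[of _ "\<lambda>x. f x * u x"])
qed

text \<open>Both vectors are cut off along a compact exhaustion. Replacing first \<open>a\<close>
  and then \<open>b\<close> splits the error into two coefficients, each with a factor of small
  norm.\<close>

lemma off_ideal_coeff_compact: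
  assumes f: "f \<in> fourier_algebra \<mu>"
    and cpt: "\<And>a b K. a \<in> L2 \<mu> \<Longrightarrow> b \<in> L2 \<mu> \<Longrightarrow> compact K \<Longrightarrow> (\<And>x. x \<notin> K \<Longrightarrow> a x = 0 \<and> b x = 0) \<Longrightarrow>
      (\<lambda>x. f x * regular_coeff \<mu> a b x) \<in> off_ideal \<mu> E"
    and a: "a \<in> L2 \<mu>" and b: "b \<in> L2 \<mu>"
  shows "(\<lambda>x. f x * regular_coeff \<mu> a b x) \<in> off_ideal \<mu> E"
proof (rule off_ideal_closed[OF fourier_algebra_mult_coeff[OF f a b]])
  obtain R where R: "fourier_bounded \<mu> f R" using f by (rule fourier_algebra_bounded)
  note R0 = fourier_bounded_nonneg[OF R]
  obtain K :: "nat \<Rightarrow> 'a set" where K: "\<And>n. compact (K n)" "incseq K" "(\<Union>n. K n) = UNIV"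
    by (rule compact_exhaustion) blast
  let ?a = "\<lambda>n x. indicator (K n) x * a x"
  let ?b = "\<lambda>n x. indicator (K n) x * b x"
  let ?da = "\<lambda>n. L2_norm \<mu> (\<lambda>x. a x - ?a n x)"
  let ?db = "\<lambda>n. L2_norm \<mu> (\<lambda>x. b x - ?b n x)"
  have aL: "?a n \<in> L2 \<mu>" and bL: "?b n \<in> L2 \<mu>" for n
    using a b K(1) by (auto intro!: L2_indicator_mult)
  have an: "L2_norm \<mu> (?a n) \<le> L2_norm \<mu> a" for n
    using aL[of n] a by (intro L2_norm_mono(2)) (auto simp: L2_def norm_mult indicator_def)
  have "(\<lambda>n. R * (?da n * L2_norm \<mu> b + L2_norm \<mu> a * ?db n)) \<longlonglongrightarrow> R * (0 * L2_norm \<mu> b + L2_norm \<mu> a * 0)"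
    by (intro tendsto_intros L2_compact_truncation a b K)
  then have lim: "(\<lambda>n. R * (?da n * L2_norm \<mu> b + L2_norm \<mu> a * ?db n)) \<longlonglongrightarrow> 0" by simp
  fix \<epsilon> :: real assume "\<epsilon> > 0"
  from order_tendstoD(2)[OF lim this] obtain n where
    n: "R * (?da n * L2_norm \<mu> b + L2_norm \<mu> a * ?db n) < \<epsilon>"
    by (auto simp: eventually_sequentially)
  have eq: "f x * regular_coeff \<mu> (\<lambda>x. a x - ?a n x) b x + f x * regular_coeff \<mu> (?a n) (\<lambda>x. b x - ?b n x) x
    = f x * regular_coeff \<mu> a b x - f x * regular_coeff \<mu> (?a n) (?b n) x" for x
    unfolding regular_coeff_diff_left[OF a aL b] regular_coeff_diff_right[OF aL b bL]
    by (simp add: algebra_simps)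
  have "fourier_bounded \<mu> (\<lambda>x. f x * regular_coeff \<mu> a b x - f x * regular_coeff \<mu> (?a n) (?b n) x) \<epsilon>"
  proof (rule fourier_bounded_mono)
    show "fourier_bounded \<mu> (\<lambda>x. f x * regular_coeff \<mu> a b x - f x * regular_coeff \<mu> (?a n) (?b n) x)
      (R * (?da n * L2_norm \<mu> b) + R * (L2_norm \<mu> (?a n) * ?db n))"
      unfolding eq[symmetric]
      by (intro fourier_bounded_add fourier_bounded_mult_coeff R L2_diff a b aL bL)
    have "L2_norm \<mu> (?a n) * ?db n \<le> L2_norm \<mu> a * ?db n"
      by (intro mult_right_mono an) simp
    then have "R * (L2_norm \<mu> (?a n) * ?db n) \<le> R * (L2_norm \<mu> a * ?db n)"
      using R0 by (rule mult_left_mono)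
    then show "R * (?da n * L2_norm \<mu> b) + R * (L2_norm \<mu> (?a n) * ?db n) \<le> \<epsilon>"
      using n by (simp add: distrib_left)
  qed
  moreover have "(\<lambda>x. f x * regular_coeff \<mu> (?a n) (?b n) x) \<in> off_ideal \<mu> E"
    by (rule cpt[OF aL bL K(1)[of n]]) simp
  ultimately show "\<exists>g\<in>off_ideal \<mu> E. fourier_bounded \<mu> (\<lambda>x. f x * regular_coeff \<mu> a b x - g x) \<epsilon>"
    by (intro bexI[of _ "\<lambda>x. f x * regular_coeff \<mu> (?a n) (?b n) x"])
qed

end

text \<open>On the compact set \<open>K - U\<close> the total deviation from the levels
  \<open>w i\<close> has a positive minimum, so a point of \<open>K\<close> with small deviations
  must lie in \<open>U\<close>.\<close>

lemma compact_level_nhd: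
  fixes \<phi> :: "'i \<Rightarrow> 'a::t2_space \<Rightarrow> real"
  assumes K: "compact K" and "finite S" and \<phi>: "\<And>i. i \<in> S \<Longrightarrow> continuous_on UNIV (\<phi> i)" and U: "open U"
    and sub: "\<And>x. x \<in> K \<Longrightarrow> (\<And>i. i \<in> S \<Longrightarrow> \<phi> i x = w i) \<Longrightarrow> x \<in> U"
  obtains \<delta> where "\<delta> > 0" "\<And>x. x \<in> K \<Longrightarrow> (\<And>i. i \<in> S \<Longrightarrow> \<bar>\<phi> i x - w i\<bar> < \<delta>) \<Longrightarrow> x \<in> U"
proof (cases "K - U = {}")
  case True
  then show ?thesis using that[of 1] by auto
next
  case False
  let ?m = "\<lambda>x. \<Sum>i\<in>S. \<bar>\<phi> i x - w i\<bar>"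
  have cont: "continuous_on (K - U) ?m"
    by (intro continuous_intros continuous_on_subset[OF \<phi>]) auto
  have "compact (K - U)" using K U by (rule compact_diff)
  then obtain x0 where x0: "x0 \<in> K - U" "\<And>x. x \<in> K - U \<Longrightarrow> ?m x0 \<le> ?m x"
    using continuous_attains_inf[OF _ False cont] by blast
  have pos: "?m x0 > 0"
  proof (rule ccontr)
    assume "\<not> ?m x0 > 0"
    then have "?m x0 = 0" by (simp add: sum_nonneg antisym not_less)
    then have "\<phi> i x0 = w i" if "i \<in> S" for i
      using that \<open>finite S\<close> by (simp add: sum_nonneg_eq_0_iff)
    with sub[of x0] x0(1) show False by auto
  qed
  \<comment> \<open>Dividing by \<open>card S + 1\<close> instead of \<open>card S\<close> makes the
    sum of deviations strictly smaller than the minimum.\<close>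
  show ?thesis
  proof (rule that[of "?m x0 / (card S + 1)"])
    show "?m x0 / (card S + 1) > 0" using pos by simp
    fix x assume x: "x \<in> K" "\<And>i. i \<in> S \<Longrightarrow> \<bar>\<phi> i x - w i\<bar> < ?m x0 / (card S + 1)"
    have "?m x \<le> of_nat (card S) * (?m x0 / (card S + 1))"
      by (rule sum_bounded_above) (use x(2) in \<open>auto intro: less_imp_le\<close>)
    also have "\<dots> < ?m x0" using pos by (simp add: divide_simps algebra_simps)
    finally show "x \<in> U" using x0(2)[of x] x(1) by fastforce
  qed
qed

context haar
begin

section \<open>The estimate near the boundary\<close>

lemma amp_nhd:
  assumes "l2seq v" "\<epsilon> > 0"
  obtains U where "open U" "s0 \<in> U"
    "\<And>s. s \<in> U \<Longrightarrow> L2_norm seq_measure (\<lambda>x. amp v s x - amp v s0 x) < \<epsilon>"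
  using order_tendstoD(2)[OF amp_tendsto[OF assms(1), of s0] assms(2)]
  unfolding eventually_nhds by blast

text \<open>If \<open>s0\<close> has levels \<open>w i\<close> and \<open>t\<close> has levels
  \<open>c i + w i\<close>, then \<open>\<phi> i (t - s0) = c i\<close> for all \<open>i\<close>, so
  \<open>f (t - s0) = 0\<close>. This supplies the orthogonality in
  \<open>fourier_bounded_product\<close>, and compactness thickens the exact levels to slabs of
  width governed by \<delta>.\<close>

lemma near_level_estimate:
  fixes \<phi> :: "'i \<Rightarrow> 'a \<Rightarrow> real"
  assumes rep: "fourier_rep \<mu> f \<xi> \<eta>" "l2seq \<xi>" "l2seq \<eta>"
    "(\<Sum>n. (L2_norm \<mu> (\<xi> n))\<^sup>2) \<le> R" "(\<Sum>n. (L2_norm \<mu> (\<eta> n))\<^sup>2) \<le> R"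
    and K: "compact K" and "\<epsilon> > 0" and S: "finite S"
    and \<phi>: "\<And>i. i \<in> S \<Longrightarrow> continuous_on UNIV (\<phi> i)"
      "\<And>i x y. i \<in> S \<Longrightarrow> \<phi> i (x - y) = \<phi> i x - \<phi> i y"
    and van: "\<And>x. (\<And>i. i \<in> S \<Longrightarrow> \<phi> i x \<le> c i) \<Longrightarrow> f x = 0"
  obtains \<delta> where "\<delta> > 0"
    "\<And>a b. a \<in> L2 \<mu> \<Longrightarrow> b \<in> L2 \<mu> \<Longrightarrow>
       (\<And>s. a s \<noteq> 0 \<Longrightarrow> s \<in> K \<and> (\<forall>i\<in>S. \<bar>\<phi> i s - w i\<bar> < \<delta>)) \<Longrightarrow>
       (\<And>t. b t \<noteq> 0 \<Longrightarrow> t \<in> K \<and> (\<forall>i\<in>S. \<bar>\<phi> i t - c i - w i\<bar> < \<delta>)) \<Longrightarrow>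
       fourier_bounded \<mu> (\<lambda>x. f x * regular_coeff \<mu> a b x) (2 * \<epsilon> * sqrt R * (L2_norm \<mu> a * L2_norm \<mu> b))"
proof -
  have "\<exists>W. open W \<and> s0 \<in> W \<and> (\<forall>s\<in>W. L2_norm seq_measure (\<lambda>x. amp \<xi> s x - amp \<xi> s0 x) < \<epsilon>)" for s0
    by (rule amp_nhd[OF rep(2) \<open>\<epsilon> > 0\<close>, of s0]) blast
  then obtain U where "\<And>s0. open (U s0) \<and> s0 \<in> U s0 \<and>
      (\<forall>s\<in>U s0. L2_norm seq_measure (\<lambda>x. amp \<xi> s x - amp \<xi> s0 x) < \<epsilon>)"
    by metis
  then have U: "\<And>s0. open (U s0)" "\<And>s0. s0 \<in> U s0"
    "\<And>s0 s. s \<in> U s0 \<Longrightarrow> L2_norm seq_measure (\<lambda>x. amp \<xi> s x - amp \<xi> s0 x) < \<epsilon>"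
    by blast+
  have "\<exists>W. open W \<and> s0 \<in> W \<and> (\<forall>s\<in>W. L2_norm seq_measure (\<lambda>x. amp \<eta> s x - amp \<eta> s0 x) < \<epsilon>)" for s0
    by (rule amp_nhd[OF rep(3) \<open>\<epsilon> > 0\<close>, of s0]) blast
  then obtain V where "\<And>s0. open (V s0) \<and> s0 \<in> V s0 \<and>
      (\<forall>s\<in>V s0. L2_norm seq_measure (\<lambda>x. amp \<eta> s x - amp \<eta> s0 x) < \<epsilon>)"
    by metis
  then have V: "\<And>s0. open (V s0)" "\<And>s0. s0 \<in> V s0"
    "\<And>s0 s. s \<in> V s0 \<Longrightarrow> L2_norm seq_measure (\<lambda>x. amp \<eta> s x - amp \<eta> s0 x) < \<epsilon>"
    by blast+
  define A where "A = {s\<in>K. \<forall>i\<in>S. \<phi> i s = w i}"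
  define B where "B = {t\<in>K. \<forall>i\<in>S. \<phi> i t = c i + w i}"
  have "{t. \<forall>i\<in>S. \<phi> i t = c i + w i} = (\<Inter>i\<in>S. {t. \<phi> i t = c i + w i})" by auto
  moreover have "closed (\<Inter>i\<in>S. {t. \<phi> i t = c i + w i})"
    using \<phi>(1) by (intro closed_INT ballI closed_Collect_eq continuous_intros) auto
  ultimately have "compact (K \<inter> {t. \<forall>i\<in>S. \<phi> i t = c i + w i})" by (simp add: compact_Int_closed[OF K])
  then have cB: "compact B" by (simp add: B_def Int_def)
  \<comment> \<open>The points on the side of \<open>t\<close> must be finite in number, since they
    start the orthonormal system. On the side of \<open>s\<close> each point may use its own
    \<open>s0\<close>, so the open cover of \<open>A\<close> is kept whole.\<close>
  obtain D where D: "D \<subseteq> B" "finite D" "B \<subseteq> (\<Union>t\<in>D. V t)"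
    by (rule compactE_image[OF cB, of B V]) (use V(1,2) in auto)
  obtain T :: "nat \<Rightarrow> 'a" and N where T: "D = T ` {i. i < N}"
    using finite_imp_nat_seg_image_inj_on[OF D(2)] by blast
  have TB: "T j \<in> B" if "j < N" for j using that D(1) T by auto
  obtain \<delta>1 where \<delta>1: "\<delta>1 > 0"
    "\<And>x. x \<in> K \<Longrightarrow> (\<And>i. i \<in> S \<Longrightarrow> \<bar>\<phi> i x - w i\<bar> < \<delta>1) \<Longrightarrow> x \<in> (\<Union>s\<in>A. U s)"
    by (rule compact_level_nhd[OF K S \<phi>(1), where U="\<Union>s\<in>A. U s" and w=w]) (use U(1,2) in \<open>auto simp: A_def\<close>)
  obtain \<delta>2 where \<delta>2: "\<delta>2 > 0"
    "\<And>x. x \<in> K \<Longrightarrow> (\<And>i. i \<in> S \<Longrightarrow> \<bar>\<phi> i x - (c i + w i)\<bar> < \<delta>2) \<Longrightarrow> x \<in> (\<Union>t\<in>D. V t)"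
    by (rule compact_level_nhd[OF K S \<phi>(1), where U="\<Union>t\<in>D. V t" and w="\<lambda>i. c i + w i"])
      (use V(1) D(3) in \<open>auto simp: B_def\<close>)
  show ?thesis
  proof (rule that[of "min \<delta>1 \<delta>2"])
    show "min \<delta>1 \<delta>2 > 0" using \<delta>1 \<delta>2 by simp
    fix a b assume L: "a \<in> L2 \<mu>" "b \<in> L2 \<mu>"
      and as: "\<And>s. a s \<noteq> 0 \<Longrightarrow> s \<in> K \<and> (\<forall>i\<in>S. \<bar>\<phi> i s - w i\<bar> < min \<delta>1 \<delta>2)"
      and bs: "\<And>t. b t \<noteq> 0 \<Longrightarrow> t \<in> K \<and> (\<forall>i\<in>S. \<bar>\<phi> i t - c i - w i\<bar> < min \<delta>1 \<delta>2)"
    have "fourier_bounded \<mu> (\<lambda>x. f x * regular_coeff \<mu> a b x)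
        ((\<epsilon> + \<epsilon>) * sqrt R * (L2_norm \<mu> a * L2_norm \<mu> b))"
    proof (rule fourier_bounded_product[OF rep L, where N=N and T=T])
      fix s assume "a s \<noteq> 0"
      then have "s \<in> (\<Union>s\<in>A. U s)" using as by (intro \<delta>1(2)) auto
      then obtain s0 where s0: "s0 \<in> A" "s \<in> U s0" by blast
      have "f (T j - s0) = 0" if "j < N" for j
        using TB[OF that] s0(1) by (intro van) (simp add: \<phi>(2) A_def B_def)
      then show "\<exists>s0. L2_norm seq_measure (\<lambda>x. amp \<xi> s x - amp \<xi> s0 x) \<le> \<epsilon> \<and> (\<forall>j<N. f (T j - s0) = 0)"
        using U(3)[OF s0(2)] by (intro exI[of _ s0]) auto
    next
      fix t assume "b t \<noteq> 0"
      then have "t \<in> (\<Union>t\<in>D. V t)" using bs by (intro \<delta>2(2)) (auto simp: diff_diff_eq)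
      then obtain j where "j < N" "t \<in> V (T j)" using T by auto
      then show "(\<exists>j<N. L2_norm seq_measure (\<lambda>x. amp \<eta> t x - amp \<eta> (T j) x) \<le> \<epsilon>) \<or> R \<le> \<epsilon>\<^sup>2"
        using V(3) less_imp_le by blast
    qed (use \<open>\<epsilon> > 0\<close> in auto)
    then show "fourier_bounded \<mu> (\<lambda>x. f x * regular_coeff \<mu> a b x)
        (2 * \<epsilon> * sqrt R * (L2_norm \<mu> a * L2_norm \<mu> b))" by simp
  qed
qed

text \<open>The previous \<delta> depends on the level \<open>w\<close>, whereas a grid of one mesh
  meets many levels. Only levels close to values of the \<open>\<phi> i\<close> on \<open>K\<close>
  matter, and a finite cover of \<open>K\<close> makes the choice uniform.\<close>

lemma uniform_level_estimate:
  fixes \<phi> :: "'i \<Rightarrow> 'a \<Rightarrow> real"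
  assumes rep: "fourier_rep \<mu> f \<xi> \<eta>" "l2seq \<xi>" "l2seq \<eta>"
    "(\<Sum>n. (L2_norm \<mu> (\<xi> n))\<^sup>2) \<le> R" "(\<Sum>n. (L2_norm \<mu> (\<eta> n))\<^sup>2) \<le> R"
    and K: "compact K" and "\<epsilon> > 0" and S: "finite S"
    and \<phi>: "\<And>i. i \<in> S \<Longrightarrow> continuous_on UNIV (\<phi> i)"
      "\<And>i x y. i \<in> S \<Longrightarrow> \<phi> i (x - y) = \<phi> i x - \<phi> i y"
    and van: "\<And>x. (\<And>i. i \<in> S \<Longrightarrow> \<phi> i x \<le> c i) \<Longrightarrow> f x = 0"
  shows "\<exists>\<delta>>0. \<forall>a\<in>L2 \<mu>. \<forall>b\<in>L2 \<mu>. \<forall>w.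
      (\<forall>s. a s \<noteq> 0 \<longrightarrow> s \<in> K \<and> (\<forall>i\<in>S. \<bar>\<phi> i s - w i\<bar> < \<delta>)) \<longrightarrow>
      (\<forall>t. b t \<noteq> 0 \<longrightarrow> t \<in> K \<and> (\<forall>i\<in>S. \<bar>\<phi> i t - c i - w i\<bar> < \<delta>)) \<longrightarrow>
      fourier_bounded \<mu> (\<lambda>x. f x * regular_coeff \<mu> a b x) (2 * \<epsilon> * sqrt R * (L2_norm \<mu> a * L2_norm \<mu> b))"
proof -
  let ?P = "\<lambda>w \<delta>. \<forall>a b. a \<in> L2 \<mu> \<longrightarrow> b \<in> L2 \<mu> \<longrightarrow>
       (\<forall>s. a s \<noteq> 0 \<longrightarrow> s \<in> K \<and> (\<forall>i\<in>S. \<bar>\<phi> i s - w i\<bar> < \<delta>)) \<longrightarrow>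
       (\<forall>t. b t \<noteq> 0 \<longrightarrow> t \<in> K \<and> (\<forall>i\<in>S. \<bar>\<phi> i t - c i - w i\<bar> < \<delta>)) \<longrightarrow>
       fourier_bounded \<mu> (\<lambda>x. f x * regular_coeff \<mu> a b x) (2 * \<epsilon> * sqrt R * (L2_norm \<mu> a * L2_norm \<mu> b))"
  have "\<exists>\<delta>>0. ?P w \<delta>" for w
  proof (rule near_level_estimate[OF rep K \<open>\<epsilon> > 0\<close> S \<phi> van, where w=w])
    fix \<delta> :: real assume 1: "\<delta> > 0" and 2: "\<And>a b. a \<in> L2 \<mu> \<Longrightarrow> b \<in> L2 \<mu> \<Longrightarrow>
       (\<And>s. a s \<noteq> 0 \<Longrightarrow> s \<in> K \<and> (\<forall>i\<in>S. \<bar>\<phi> i s - w i\<bar> < \<delta>)) \<Longrightarrow>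
       (\<And>t. b t \<noteq> 0 \<Longrightarrow> t \<in> K \<and> (\<forall>i\<in>S. \<bar>\<phi> i t - c i - w i\<bar> < \<delta>)) \<Longrightarrow>
       fourier_bounded \<mu> (\<lambda>x. f x * regular_coeff \<mu> a b x) (2 * \<epsilon> * sqrt R * (L2_norm \<mu> a * L2_norm \<mu> b))"
    show "\<exists>\<delta>>0. ?P w \<delta>"
      by (intro exI[of _ \<delta>] conjI 1 allI impI) (rule 2; blast)
  qed
  then obtain d where "\<And>w. d w > 0 \<and> ?P w (d w)" using choice[of "\<lambda>w \<delta>. \<delta> > 0 \<and> ?P w \<delta>"] by blast
  then have d: "\<And>w. d w > 0" "\<And>w. ?P w (d w)" by (rule conjunct1, rule conjunct2)
  define r where "r s = d (\<lambda>i. \<phi> i s)" for s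
  have r: "r s > 0" for s using d(1) by (simp add: r_def)
  define V where "V s = {x. \<forall>i\<in>S. \<bar>\<phi> i x - \<phi> i s\<bar> < r s / 2}" for s
  have oV: "open (V s)" for s
  proof -
    have "V s = (\<Inter>i\<in>S. {x. \<bar>\<phi> i x - \<phi> i s\<bar> < r s / 2})" by (auto simp: V_def)
    then show ?thesis
      using \<phi>(1) S by (auto intro!: open_INT open_Collect_less continuous_intros)
  qed
  have Vs: "s \<in> V s" for s using r by (simp add: V_def)
  obtain D where D: "D \<subseteq> K" "finite D" "K \<subseteq> (\<Union>s\<in>D. V s)"
    by (rule compactE_image[OF K, of K V]) (use oV Vs in auto)
  \<comment> \<open>A quarter leaves room for the distances from a value to \<open>w\<close> and
    from \<open>w\<close> to the levels of a point of the support, next to the half used in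
    \<open>V\<close>. The element 1 covers an empty \<open>D\<close>.\<close>
  define \<delta> where "\<delta> = Min (insert 1 ((\<lambda>s. r s / 4) ` D))"
  have \<delta>D: "\<delta> \<le> r s / 4" if "s \<in> D" for s
    unfolding \<delta>_def using that D(2) by (intro Min_le) auto
  show ?thesis
  proof (intro exI[of _ \<delta>] conjI ballI allI impI)
    show "\<delta> > 0" unfolding \<delta>_def using D(2) r by (subst Min_gr_iff) auto
    fix a b and w :: "'i \<Rightarrow> real" assume L: "a \<in> L2 \<mu>" "b \<in> L2 \<mu>"
      and "\<forall>s. a s \<noteq> 0 \<longrightarrow> s \<in> K \<and> (\<forall>i\<in>S. \<bar>\<phi> i s - w i\<bar> < \<delta>)"
      and "\<forall>t. b t \<noteq> 0 \<longrightarrow> t \<in> K \<and> (\<forall>i\<in>S. \<bar>\<phi> i t - c i - w i\<bar> < \<delta>)"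
    then have as: "\<And>s. a s \<noteq> 0 \<Longrightarrow> s \<in> K \<and> (\<forall>i\<in>S. \<bar>\<phi> i s - w i\<bar> < \<delta>)"
      and bs: "\<And>t. b t \<noteq> 0 \<Longrightarrow> t \<in> K \<and> (\<forall>i\<in>S. \<bar>\<phi> i t - c i - w i\<bar> < \<delta>)" by blast+
    show "fourier_bounded \<mu> (\<lambda>x. f x * regular_coeff \<mu> a b x)
      (2 * \<epsilon> * sqrt R * (L2_norm \<mu> a * L2_norm \<mu> b))"
    \<comment> \<open>A level \<open>w\<close> far from all values on \<open>K\<close> forces
      \<open>a = 0\<close>. Otherwise a point of the support of \<open>a\<close> ties
      \<open>w\<close> to the levels of some centre \<open>s2\<close>, and the estimate at that
      centre applies.\<close>
    proof (cases "\<exists>s. a s \<noteq> 0")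
      case False
      then have "a = (\<lambda>x. 0)" by auto
      then show ?thesis using fourier_bounded_zero by (simp add: regular_coeff_def)
    next
      case True
      then obtain s1 where s1: "a s1 \<noteq> 0" by blast
      then obtain s2 where s2: "s2 \<in> D" "s1 \<in> V s2" using as D(3) by blast
      have near: "\<bar>y - \<phi> i s2\<bar> < r s2" if "i \<in> S" "\<bar>y - w i\<bar> < \<delta>" for y i
      proof -
        have "\<bar>\<phi> i s1 - w i\<bar> < \<delta>" using as[OF s1] that by blast
        moreover have "\<bar>\<phi> i s1 - \<phi> i s2\<bar> < r s2 / 2" using s2(2) that by (simp add: V_def)
        ultimately show ?thesis using \<delta>D[OF s2(1)] that(2) by linarith
      qed
      show ?thesis
      proof (rule d(2)[of "\<lambda>i. \<phi> i s2", rule_format, OF L])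
        show "s \<in> K \<and> (\<forall>i\<in>S. \<bar>\<phi> i s - \<phi> i s2\<bar> < d (\<lambda>i. \<phi> i s2))" if "a s \<noteq> 0" for s
          using as[OF that] near by (simp add: r_def)
        show "t \<in> K \<and> (\<forall>i\<in>S. \<bar>\<phi> i t - c i - \<phi> i s2\<bar> < d (\<lambda>i. \<phi> i s2))" if "b t \<noteq> 0" for t
          using bs[OF that] near by (simp add: r_def)
      qed
    qed
  qed
qed

end

section \<open>Grid decomposition\<close>

text \<open>The restriction to \<open>S\<close> fixes the values elsewhere, so that a compact set
  meets only finitely many indices and each index stands for one cell.\<close>

definition grid_index :: "('i \<Rightarrow> 'a \<Rightarrow> real) \<Rightarrow> 'i set \<Rightarrow> real \<Rightarrow> 'a \<Rightarrow> 'i \<Rightarrow> int" where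
  "grid_index \<phi> S \<delta> x = (\<lambda>i\<in>S. \<lfloor>\<phi> i x / \<delta>\<rfloor>)"

lemma grid_index_bounds:
  assumes "grid_index \<phi> S \<delta> x = l" "i \<in> S" "\<delta> > 0"
  shows "real_of_int (l i) * \<delta> \<le> \<phi> i x" "\<phi> i x < (real_of_int (l i) + 1) * \<delta>"
proof -
  have "l i = \<lfloor>\<phi> i x / \<delta>\<rfloor>" using assms(1,2) by (auto simp: grid_index_def)
  then have "real_of_int (l i) \<le> \<phi> i x / \<delta>" "\<phi> i x / \<delta> < real_of_int (l i) + 1" by linarith+
  then show "real_of_int (l i) * \<delta> \<le> \<phi> i x" "\<phi> i x < (real_of_int (l i) + 1) * \<delta>"
    using \<open>\<delta> > 0\<close> by (simp_all add: pos_le_divide_eq pos_divide_less_eq)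
qed

lemma finite_grid_index:
  fixes \<phi> :: "'i \<Rightarrow> 'a::topological_space \<Rightarrow> real"
  assumes "compact K" "finite S" "\<And>i. i \<in> S \<Longrightarrow> continuous_on UNIV (\<phi> i)"
  shows "finite (grid_index \<phi> S \<delta> ` K)"
proof -
  have "\<exists>B. \<forall>x\<in>K. \<bar>\<phi> i x / \<delta>\<bar> \<le> B" if "i \<in> S" for i
  proof -
    have "continuous_on K (\<lambda>x. \<phi> i x / \<delta>)"
      using continuous_on_subset[OF assms(3)[OF that], of K]
      by (cases "\<delta> = 0") (auto intro!: continuous_intros)
    from compact_imp_bounded[OF compact_continuous_image[OF this assms(1)]]
    show ?thesis by (auto simp: bounded_iff)
  qed
  then obtain B where B: "\<And>i x. i \<in> S \<Longrightarrow> x \<in> K \<Longrightarrow> \<bar>\<phi> i x / \<delta>\<bar> \<le> B i" by metis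
  have "grid_index \<phi> S \<delta> ` K \<subseteq> PiE S (\<lambda>i. {\<lfloor>- B i\<rfloor>..\<lfloor>B i\<rfloor>})"
  proof
    fix l assume "l \<in> grid_index \<phi> S \<delta> ` K"
    then obtain x where x: "x \<in> K" "l = grid_index \<phi> S \<delta> x" by blast
    have "\<lfloor>- B i\<rfloor> \<le> \<lfloor>\<phi> i x / \<delta>\<rfloor> \<and> \<lfloor>\<phi> i x / \<delta>\<rfloor> \<le> \<lfloor>B i\<rfloor>" if "i \<in> S" for i
      using B[OF that x(1)] by (intro conjI floor_mono) linarith+
    then show "l \<in> PiE S (\<lambda>i. {\<lfloor>- B i\<rfloor>..\<lfloor>B i\<rfloor>})" by (auto simp: x(2) grid_index_def)
  qed
  moreover have "finite (PiE S (\<lambda>i. {\<lfloor>- B i\<rfloor>..\<lfloor>B i\<rfloor>}))"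
    using assms(2) by (intro finite_PiE) auto
  ultimately show ?thesis by (rule finite_subset)
qed

lemma grid_cell_measurable:
  fixes \<phi> :: "'i \<Rightarrow> 'a::topological_space \<Rightarrow> real"
  assumes S: "finite S" and \<phi>: "\<And>i. i \<in> S \<Longrightarrow> continuous_on UNIV (\<phi> i)"
  shows "{x. grid_index \<phi> S \<delta> x = l} \<in> sets borel"
proof (cases "l \<in> extensional S")
  case True
  have "{x. grid_index \<phi> S \<delta> x = l} = {x\<in>space borel. \<forall>i\<in>S. \<lfloor>\<phi> i x / \<delta>\<rfloor> = l i}"
    using True by (auto simp: grid_index_def extensional_def fun_eq_iff restrict_def)
  also have "\<dots> \<in> sets borel"
  proof (rule sets.sets_Collect_finite_All[OF _ S])
    fix i assume "i \<in> S"
    then have [measurable]: "\<phi> i \<in> borel_measurable borel"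
      using \<phi> by (intro borel_measurable_continuous_onI) auto
    show "{x \<in> space borel. \<lfloor>\<phi> i x / \<delta>\<rfloor> = l i} \<in> sets borel" by measurable
  qed
  finally show ?thesis .
next
  case False
  then have "{x. grid_index \<phi> S \<delta> x = l} = {}" by (auto simp: grid_index_def)
  then show ?thesis by simp
qed

lemma card_grid_neighbours:
  fixes M :: "('i \<Rightarrow> int) set"
  assumes "finite S" "M \<subseteq> extensional S"
  shows "real (card {m \<in> M. \<forall>i\<in>S. m i \<in> {g i, g i + 1}}) \<le> 2 ^ card S"
proof -
  have "{m \<in> M. \<forall>i\<in>S. m i \<in> {g i, g i + 1}} \<subseteq> PiE S (\<lambda>i. {g i, g i + 1})"
    using assms(2) by (auto simp: PiE_def)
  then have "card {m \<in> M. \<forall>i\<in>S. m i \<in> {g i, g i + 1}} \<le> card (PiE S (\<lambda>i. {g i, g i + 1}))"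
    using assms(1) by (intro card_mono finite_PiE) auto
  also have "\<dots> = (\<Prod>i\<in>S. card {g i, g i + 1})" using assms(1) by (rule card_PiE)
  also have "\<dots> = 2 ^ card S" by (simp add: numeral_2_eq_2)
  finally have "real (card {m \<in> M. \<forall>i\<in>S. m i \<in> {g i, g i + 1}}) \<le> real (2 ^ card S)"
    by (rule of_nat_mono)
  then show ?thesis by (simp only: of_nat_power of_nat_numeral)
qed

context haar
begin

text \<open>The cells are disjoint, so the pieces are orthogonal. The bound on squared norms is what
  keeps later sums over cells independent of the mesh.\<close>

lemma L2_grid_decomposition:
  fixes \<phi> :: "'i \<Rightarrow> 'a \<Rightarrow> real" and \<delta> :: real
  assumes a: "a \<in> L2 \<mu>" and K: "compact K" "\<And>x. x \<notin> K \<Longrightarrow> a x = 0" and S: "finite S"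
    and \<phi>: "\<And>i. i \<in> S \<Longrightarrow> continuous_on UNIV (\<phi> i)"
  defines "L \<equiv> grid_index \<phi> S \<delta> ` K"
  defines "al \<equiv> \<lambda>l x. indicator {x. grid_index \<phi> S \<delta> x = l} x * a x"
  shows "al l \<in> L2 \<mu>" "a = (\<lambda>x. \<Sum>l\<in>L. al l x)" "(\<Sum>l\<in>L. (L2_norm \<mu> (al l))\<^sup>2) \<le> (L2_norm \<mu> a)\<^sup>2"
proof -
  have fin: "finite L" unfolding L_def by (rule finite_grid_index[OF K(1) S \<phi>])
  show alL: "al l \<in> L2 \<mu>" for l
    unfolding al_def using grid_cell_measurable[OF S \<phi>] by (intro L2_indicator_mult a) simp
  have al: "al l x = (if l = grid_index \<phi> S \<delta> x then a x else 0)" for l x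
    by (auto simp: al_def indicator_def)
  have "(\<Sum>l\<in>L. al l x) = a x" for x
    unfolding al using fin K(2)[of x] by (auto simp: L_def)
  then show "a = (\<lambda>x. \<Sum>l\<in>L. al l x)" by simp
  have "(\<Sum>l\<in>L. (L2_norm \<mu> (al l))\<^sup>2) = (\<integral>x. (\<Sum>l\<in>L. (cmod (al l x))\<^sup>2) \<partial>\<mu>)"
    unfolding L2_norm_power2 by (intro Bochner_Integration.integral_sum[symmetric] L2_integrable alL)
  also have "\<dots> \<le> (\<integral>x. (cmod (a x))\<^sup>2 \<partial>\<mu>)"
  proof (rule integral_mono)
    fix x
    have "(\<Sum>l\<in>L. (cmod (al l x))\<^sup>2) = (\<Sum>l\<in>L. if l = grid_index \<phi> S \<delta> x then (cmod (a x))\<^sup>2 else 0)"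
      by (intro sum.cong) (auto simp: al)
    also have "\<dots> \<le> (cmod (a x))\<^sup>2" using fin by simp
    finally show "(\<Sum>l\<in>L. (cmod (al l x))\<^sup>2) \<le> (cmod (a x))\<^sup>2" .
  qed (use L2_integrable[OF a] L2_integrable[OF alL] in auto)
  finally show "(\<Sum>l\<in>L. (L2_norm \<mu> (al l))\<^sup>2) \<le> (L2_norm \<mu> a)\<^sup>2" by (simp add: L2_norm_power2)
qed

lemma regular_coeff_nonzeroD:
  assumes "regular_coeff \<mu> a b x \<noteq> 0"
  obtains t where "a (- x + t) \<noteq> 0" "b t \<noteq> 0"
proof -
  have "\<exists>t. a (- x + t) * cnj (b t) \<noteq> 0"
  proof (rule ccontr)
    assume "\<not> (\<exists>t. a (- x + t) * cnj (b t) \<noteq> 0)"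
    then have "(\<lambda>t. a (- x + t) * cnj (b t)) = (\<lambda>t. 0)" by blast
    then have "regular_coeff \<mu> a b x = 0" unfolding regular_coeff_def by simp
    with assms show False by blast
  qed
  with that show ?thesis by auto
qed

text \<open>Cells with \<open>m i \<ge> l i + 2\<close> for some \<open>i\<close> are treated by the synthesis of \<open>F\<close>, cells with
  \<open>m i < l i\<close> for some \<open>i\<close> by the hypothesis on \<open>S - {i}\<close>. The remaining cells contribute little,
  because each \<open>l\<close> has only \<open>2 ^ card S\<close> neighbours \<open>m\<close>, whatever the mesh.\<close>

lemma off_ideal_step:
  fixes \<phi> :: "'i \<Rightarrow> 'a \<Rightarrow> real" and c :: "'i \<Rightarrow> real"
  defines "E \<equiv> \<lambda>S. {x. \<forall>i\<in>S. \<phi> i x \<le> c i}"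
  assumes S: "finite S"
    and \<phi>: "\<And>i. i \<in> S \<Longrightarrow> continuous_on UNIV (\<phi> i)"
      "\<And>i x y. i \<in> S \<Longrightarrow> \<phi> i (x - y) = \<phi> i x - \<phi> i y"
    and synth: "\<And>g. g \<in> fourier_algebra \<mu> \<Longrightarrow> (\<And>x. x \<in> F \<Longrightarrow> g x = 0) \<Longrightarrow> g \<in> off_ideal \<mu> F"
    and IH: "\<And>i g. i \<in> S \<Longrightarrow> g \<in> fourier_algebra \<mu> \<Longrightarrow> (\<And>x. x \<in> F \<union> E (S - {i}) \<Longrightarrow> g x = 0) \<Longrightarrow>
      g \<in> off_ideal \<mu> (F \<union> E (S - {i}))"
    and f: "f \<in> fourier_algebra \<mu>" "\<And>x. x \<in> F \<union> E S \<Longrightarrow> f x = 0"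
    and a: "a \<in> L2 \<mu>" and b: "b \<in> L2 \<mu>" and K: "compact K" "\<And>x. x \<notin> K \<Longrightarrow> a x = 0 \<and> b x = 0"
  shows "(\<lambda>x. f x * regular_coeff \<mu> a b x) \<in> off_ideal \<mu> (F \<union> E S)"
proof (rule off_ideal_closed[OF fourier_algebra_mult_coeff[OF f(1) a b]])
  obtain R where "fourier_bounded \<mu> f R" using f(1) by (rule fourier_algebra_bounded)
  then obtain \<xi> \<eta> where rep: "fourier_rep \<mu> f \<xi> \<eta>" "l2seq \<xi>" "l2seq \<eta>"
    "(\<Sum>n. (L2_norm \<mu> (\<xi> n))\<^sup>2) \<le> R" "(\<Sum>n. (L2_norm \<mu> (\<eta> n))\<^sup>2) \<le> R"
    and R0: "0 \<le> R"
    using balanced_rep fourier_bounded_nonneg by metis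
  fix \<epsilon> :: real assume "\<epsilon> > 0"
  \<comment> \<open>The cells near the boundary will contribute at most
    \<open>\<epsilon>' * Q\<close> in total. The constant contains no mesh size, so
    \<open>\<epsilon>'\<close> can be fixed before the grid.\<close>
  define Q where "Q = sqrt R * (2 ^ card S * ((L2_norm \<mu> a)\<^sup>2 + (L2_norm \<mu> b)\<^sup>2))"
  have Q0: "Q \<ge> 0" using R0 by (simp add: Q_def)
  define \<epsilon>' where "\<epsilon>' = \<epsilon> / (Q + 1)"
  have \<epsilon>': "\<epsilon>' > 0" using \<open>\<epsilon> > 0\<close> Q0 by (simp add: \<epsilon>'_def)
  have van: "f x = 0" if "\<And>i. i \<in> S \<Longrightarrow> \<phi> i x \<le> c i" for x
    using that by (intro f(2)) (simp add: E_def)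
  have "\<exists>\<delta>>0. \<forall>a\<in>L2 \<mu>. \<forall>b\<in>L2 \<mu>. \<forall>w.
      (\<forall>s. a s \<noteq> 0 \<longrightarrow> s \<in> K \<and> (\<forall>i\<in>S. \<bar>\<phi> i s - w i\<bar> < \<delta>)) \<longrightarrow>
      (\<forall>t. b t \<noteq> 0 \<longrightarrow> t \<in> K \<and> (\<forall>i\<in>S. \<bar>\<phi> i t - c i - w i\<bar> < \<delta>)) \<longrightarrow>
      fourier_bounded \<mu> (\<lambda>x. f x * regular_coeff \<mu> a b x) (2 * \<epsilon>' * sqrt R * (L2_norm \<mu> a * L2_norm \<mu> b))"
    by (rule uniform_level_estimate[OF rep K(1) \<epsilon>' S \<phi> van])
  then obtain \<delta>0 where \<delta>0: "\<delta>0 > 0" and est: "\<forall>a\<in>L2 \<mu>. \<forall>b\<in>L2 \<mu>. \<forall>w.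
      (\<forall>s. a s \<noteq> 0 \<longrightarrow> s \<in> K \<and> (\<forall>i\<in>S. \<bar>\<phi> i s - w i\<bar> < \<delta>0)) \<longrightarrow>
      (\<forall>t. b t \<noteq> 0 \<longrightarrow> t \<in> K \<and> (\<forall>i\<in>S. \<bar>\<phi> i t - c i - w i\<bar> < \<delta>0)) \<longrightarrow>
      fourier_bounded \<mu> (\<lambda>x. f x * regular_coeff \<mu> a b x) (2 * \<epsilon>' * sqrt R * (L2_norm \<mu> a * L2_norm \<mu> b))"
    by blast
  \<comment> \<open>For \<open>m i\<close> equal to \<open>l i\<close> or \<open>l i + 1\<close>,
    the value \<open>\<phi> i t - c i\<close> lies within two mesh widths above
    \<open>l i * \<delta>\<close>.\<close>
  define \<delta> where "\<delta> = \<delta>0 / 2"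
  have \<delta>: "\<delta> > 0" "\<delta>0 = 2 * \<delta>" using \<delta>0 by (auto simp: \<delta>_def)
  let ?\<psi> = "\<lambda>i x. \<phi> i x - c i"
  have \<psi>: "continuous_on UNIV (?\<psi> i)" if "i \<in> S" for i
    using \<phi>(1)[OF that] by (intro continuous_intros)
  define L where "L = grid_index \<phi> S \<delta> ` K"
  define M where "M = grid_index ?\<psi> S \<delta> ` K"
  define al where "al = (\<lambda>l x. indicator {x. grid_index \<phi> S \<delta> x = l} x * a x)"
  define bm where "bm = (\<lambda>m x. indicator {x. grid_index ?\<psi> S \<delta> x = m} x * b x)"
  have finL: "finite L" unfolding L_def by (rule finite_grid_index[OF K(1) S \<phi>(1)])
  have finM: "finite M" unfolding M_def by (rule finite_grid_index[OF K(1) S \<psi>])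
  have extL: "L \<subseteq> extensional S" and extM: "M \<subseteq> extensional S"
    by (auto simp: L_def M_def grid_index_def)
  have Ka: "\<And>x. x \<notin> K \<Longrightarrow> a x = 0" and Kb: "\<And>x. x \<notin> K \<Longrightarrow> b x = 0" using K(2) by auto
  have A: "\<And>l. al l \<in> L2 \<mu>" "a = (\<lambda>x. \<Sum>l\<in>L. al l x)"
    "(\<Sum>l\<in>L. (L2_norm \<mu> (al l))\<^sup>2) \<le> (L2_norm \<mu> a)\<^sup>2"
    unfolding al_def L_def
    subgoal by (rule L2_grid_decomposition(1)[OF a K(1) Ka S \<phi>(1)])
    subgoal by (rule L2_grid_decomposition(2)[OF a K(1) Ka S \<phi>(1)])
    subgoal by (rule L2_grid_decomposition(3)[OF a K(1) Ka S \<phi>(1)])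
    done
  have B: "\<And>l. bm l \<in> L2 \<mu>" "b = (\<lambda>x. \<Sum>l\<in>M. bm l x)"
    "(\<Sum>l\<in>M. (L2_norm \<mu> (bm l))\<^sup>2) \<le> (L2_norm \<mu> b)\<^sup>2"
    unfolding bm_def M_def
    subgoal by (rule L2_grid_decomposition(1)[OF b K(1) Kb S \<psi>])
    subgoal by (rule L2_grid_decomposition(2)[OF b K(1) Kb S \<psi>])
    subgoal by (rule L2_grid_decomposition(3)[OF b K(1) Kb S \<psi>])
    done
  have as: "s \<in> K" "\<And>i. i \<in> S \<Longrightarrow> real_of_int (l i) * \<delta> \<le> \<phi> i s \<and> \<phi> i s < (real_of_int (l i) + 1) * \<delta>"
    if "al l s \<noteq> 0" for l s
  proof -
    from that have "grid_index \<phi> S \<delta> s = l" "a s \<noteq> 0" by (auto simp: al_def indicator_def split: if_splits)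
    then show "s \<in> K" "\<And>i. i \<in> S \<Longrightarrow> real_of_int (l i) * \<delta> \<le> \<phi> i s \<and> \<phi> i s < (real_of_int (l i) + 1) * \<delta>"
      using Ka grid_index_bounds[OF _ _ \<delta>(1), of \<phi> S s l] by auto
  qed
  have bs: "t \<in> K" "\<And>i. i \<in> S \<Longrightarrow> real_of_int (m i) * \<delta> \<le> \<phi> i t - c i \<and> \<phi> i t - c i < (real_of_int (m i) + 1) * \<delta>"
    if "bm m t \<noteq> 0" for m t
  proof -
    from that have "grid_index ?\<psi> S \<delta> t = m" "b t \<noteq> 0" by (auto simp: bm_def indicator_def split: if_splits)
    then show "t \<in> K" "\<And>i. i \<in> S \<Longrightarrow> real_of_int (m i) * \<delta> \<le> \<phi> i t - c i \<and> \<phi> i t - c i < (real_of_int (m i) + 1) * \<delta>"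
      using Kb grid_index_bounds[OF _ _ \<delta>(1), of ?\<psi> S t m] by auto
  qed
  \<comment> \<open>A nonzero coefficient at \<open>x\<close> gives \<open>x = t - s\<close> with
    \<open>s\<close> in the cell \<open>l\<close> and \<open>t\<close> in the cell \<open>m\<close>.
    Subtracting the two half-open intervals leaves an open one of length
    \<open>2 * \<delta>\<close>, which contains 0 only for \<open>m i = l i\<close>; its upper end
    is at most 0 for \<open>m i < l i\<close>, and its lower end is at least \<delta> for
    \<open>m i \<ge> l i + 2\<close>.\<close>
  have coeff_range: "real_of_int (m i - l i - 1) * \<delta> < \<phi> i x - c i \<and> \<phi> i x - c i < real_of_int (m i - l i + 1) * \<delta>"
    if nz: "regular_coeff \<mu> (al l) (bm m) x \<noteq> 0" and i: "i \<in> S" for l m x i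
  proof -
    obtain t where t: "al l (- x + t) \<noteq> 0" "bm m t \<noteq> 0"
      using nz by (rule regular_coeff_nonzeroD)
    have "t - (- x + t) = x"
      by (simp only: diff_conv_add_uminus minus_add minus_minus add.assoc[symmetric] right_minus add_0)
    then have "\<phi> i x = \<phi> i t - \<phi> i (- x + t)" using \<phi>(2)[OF i, of t "- x + t"] by simp
    with as(2)[OF t(1) i] bs(2)[OF t(2) i] show ?thesis
      by (simp add: algebra_simps)
  qed
  define g where "g p x = f x * regular_coeff \<mu> (al (fst p)) (bm (snd p)) x" for p x
  define P where "P = {p \<in> L \<times> M. \<forall>i\<in>S. snd p i \<in> {fst p i, fst p i + 1}}"
  have finP: "finite P" unfolding P_def using finL finM by simp
  have total: "f x * regular_coeff \<mu> a b x = (\<Sum>p\<in>L \<times> M. g p x)" for x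
  proof -
    have "regular_coeff \<mu> a b x = regular_coeff \<mu> (\<lambda>x. \<Sum>l\<in>L. al l x) (\<lambda>x. \<Sum>m\<in>M. bm m x) x"
      using A(2) B(2) by simp
    also have "\<dots> = (\<Sum>l\<in>L. \<Sum>m\<in>M. regular_coeff \<mu> (al l) (bm m) x)"
      by (intro regular_coeff_sum A(1) B(1))
    finally show ?thesis
      by (simp add: g_def sum_distrib_left sum.cartesian_product case_prod_beta)
  qed
  have far: "g p \<in> off_ideal \<mu> (F \<union> E S)" if pLM: "p \<in> L \<times> M - P" for p
  proof -
    obtain l m where p: "p = (l, m)" by (cases p)
    have gp: "g p = (\<lambda>x. f x * regular_coeff \<mu> (al l) (bm m) x)" by (simp add: g_def p fun_eq_iff)
    obtain i where i: "i \<in> S" "m i \<notin> {l i, l i + 1}" using pLM by (auto simp: P_def p)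
    show ?thesis
    proof (cases "m i < l i")
      case True
      \<comment> \<open>Where the coefficient is nonzero the condition for \<open>i\<close> holds
        automatically. A point of the larger set \<open>E (S - {i})\<close> with nonzero coefficient
        is therefore in \<open>E S\<close>, where \<open>f\<close> vanishes.\<close>
      have neg: "\<phi> i x \<le> c i" if "regular_coeff \<mu> (al l) (bm m) x \<noteq> 0" for x
      proof -
        have "real_of_int (m i - l i + 1) * \<delta> \<le> 0" using True \<delta>(1) by (intro mult_nonpos_nonneg) auto
        with coeff_range[OF that i(1)] show ?thesis by linarith
      qed
      have "g p \<in> off_ideal \<mu> (F \<union> E (S - {i}))"
      proof (rule IH[OF i(1)])
        show "g p \<in> fourier_algebra \<mu>" unfolding gp by (intro fourier_algebra_mult_coeff f A(1) B(1))
        fix x assume x: "x \<in> F \<union> E (S - {i})"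
        show "g p x = 0"
        proof (cases "regular_coeff \<mu> (al l) (bm m) x = 0")
          case False
          then have "x \<in> F \<union> E S" using x neg by (auto simp: E_def)
          then show ?thesis by (simp add: gp f(2))
        qed (simp add: gp)
      qed
      moreover have "F \<union> E S \<subseteq> F \<union> E (S - {i})" by (auto simp: E_def)
      ultimately show ?thesis by (rule off_ideal_antimono[rotated])
    next
      case False
      then have "m i \<ge> l i + 2" using i(2) by auto
      then have "1 * \<delta> \<le> real_of_int (m i - l i - 1) * \<delta>" using \<delta>(1) by (intro mult_right_mono) auto
      \<comment> \<open>The gap \<delta> provides a closed set that contains the support of the
        coefficient and is disjoint from \<open>E S\<close>.\<close>
      then have pos: "c i + \<delta> \<le> \<phi> i x" if "regular_coeff \<mu> (al l) (bm m) x \<noteq> 0" for x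
        using coeff_range[OF that i(1)] by linarith
      show ?thesis
        unfolding gp
      proof (rule off_ideal_mult_coeff[where S="{x. c i + \<delta> \<le> \<phi> i x}"])
        show "f \<in> off_ideal \<mu> F" using f by (intro synth) auto
        show "closed {x. c i + \<delta> \<le> \<phi> i x}"
          using \<phi>(1)[OF i(1)] by (intro closed_Collect_le continuous_intros)
        show "{x. c i + \<delta> \<le> \<phi> i x} \<inter> E S = {}" using i(1) \<delta>(1) by (fastforce simp: E_def)
      qed (use A(1) B(1) pos in auto)
    qed
  qed
  have near: "fourier_bounded \<mu> (g p) (\<epsilon>' * sqrt R * ((L2_norm \<mu> (al (fst p)))\<^sup>2 + (L2_norm \<mu> (bm (snd p)))\<^sup>2))"
    if "p \<in> P" for p
  proof -
    obtain l m where p: "p = (l, m)" by (cases p)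
    have gp: "g p = (\<lambda>x. f x * regular_coeff \<mu> (al l) (bm m) x)" by (simp add: g_def p fun_eq_iff)
    have m: "m i = l i \<or> m i = l i + 1" if "i \<in> S" for i using \<open>p \<in> P\<close> that by (auto simp: P_def p)
    have "fourier_bounded \<mu> (g p) (2 * \<epsilon>' * sqrt R * (L2_norm \<mu> (al l) * L2_norm \<mu> (bm m)))"
      unfolding gp
    proof (rule est[rule_format, where w="\<lambda>i. real_of_int (l i) * \<delta>", OF A(1) B(1)])
      show "s \<in> K \<and> (\<forall>i\<in>S. \<bar>\<phi> i s - real_of_int (l i) * \<delta>\<bar> < \<delta>0)" if s: "al l s \<noteq> 0" for s
      proof (intro conjI ballI as(1)[OF s])
        fix i assume "i \<in> S"
        from as(2)[OF s this] show "\<bar>\<phi> i s - real_of_int (l i) * \<delta>\<bar> < \<delta>0"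
          using \<delta> by (simp add: algebra_simps abs_less_iff)
      qed
      show "t \<in> K \<and> (\<forall>i\<in>S. \<bar>\<phi> i t - c i - real_of_int (l i) * \<delta>\<bar> < \<delta>0)" if t: "bm m t \<noteq> 0" for t
      proof (intro conjI ballI bs(1)[OF t])
        fix i assume "i \<in> S"
        from bs(2)[OF t this] m[OF this] show "\<bar>\<phi> i t - c i - real_of_int (l i) * \<delta>\<bar> < \<delta>0"
          using \<delta> by (auto simp: algebra_simps abs_less_iff)
      qed
    qed
    \<comment> \<open>The arithmetic-geometric mean inequality separates the pieces of
      \<open>a\<close> from those of \<open>b\<close>, so that each side can be summed over its own
      cells.\<close>
    moreover have "\<epsilon>' * sqrt R * (2 * (L2_norm \<mu> (al l) * L2_norm \<mu> (bm m)))
      \<le> \<epsilon>' * sqrt R * ((L2_norm \<mu> (al l))\<^sup>2 + (L2_norm \<mu> (bm m))\<^sup>2)"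
      using sum_squares_bound[of "L2_norm \<mu> (al l)" "L2_norm \<mu> (bm m)"] \<epsilon>' R0
      by (intro mult_left_mono) auto
    ultimately show ?thesis unfolding p by (auto intro: fourier_bounded_mono simp: mult_ac)
  qed
  have sumA: "(\<Sum>p\<in>P. (L2_norm \<mu> (al (fst p)))\<^sup>2) \<le> 2 ^ card S * (L2_norm \<mu> a)\<^sup>2"
  proof -
    have P: "P = (SIGMA l:L. {m \<in> M. \<forall>i\<in>S. m i \<in> {l i, l i + 1}})" by (auto simp: P_def)
    have "(\<Sum>p\<in>P. (L2_norm \<mu> (al (fst p)))\<^sup>2)
      = (\<Sum>l\<in>L. card {m \<in> M. \<forall>i\<in>S. m i \<in> {l i, l i + 1}} * (L2_norm \<mu> (al l))\<^sup>2)"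
      unfolding P using finL finM
      by (subst sum.Sigma[symmetric, where g="\<lambda>l m. (L2_norm \<mu> (al l))\<^sup>2", unfolded case_prod_beta]) auto
    also have "\<dots> \<le> (\<Sum>l\<in>L. 2 ^ card S * (L2_norm \<mu> (al l))\<^sup>2)"
      by (intro sum_mono mult_right_mono card_grid_neighbours[OF S extM]) simp
    also have "\<dots> \<le> 2 ^ card S * (L2_norm \<mu> a)\<^sup>2"
      unfolding sum_distrib_left[symmetric] by (intro mult_left_mono A(3)) simp
    finally show ?thesis .
  qed
  have sumB: "(\<Sum>p\<in>P. (L2_norm \<mu> (bm (snd p)))\<^sup>2) \<le> 2 ^ card S * (L2_norm \<mu> b)\<^sup>2"
  proof -
    \<comment> \<open>The partners of \<open>m\<close> are \<open>l i = m i - 1\<close> and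
      \<open>l i = m i\<close>. Writing the latter as \<open>m i - 1 + 1\<close> lets the same
      neighbour count apply.\<close>
    let ?P' = "SIGMA m:M. {l \<in> L. \<forall>i\<in>S. l i \<in> {m i - 1, m i - 1 + 1}}"
    have "l i \<in> {m i - 1, m i - 1 + 1} \<longleftrightarrow> m i \<in> {l i, l i + 1}" for l m :: "'i \<Rightarrow> int" and i
      by auto
    then have P: "P = prod.swap ` ?P'" by (auto simp: P_def image_iff)
    have "(\<Sum>p\<in>P. (L2_norm \<mu> (bm (snd p)))\<^sup>2) = (\<Sum>p\<in>?P'. (L2_norm \<mu> (bm (fst p)))\<^sup>2)"
      unfolding P by (subst sum.reindex) (auto simp: inj_on_def)
    also have "\<dots> = (\<Sum>m\<in>M. card {l \<in> L. \<forall>i\<in>S. l i \<in> {m i - 1, m i - 1 + 1}} * (L2_norm \<mu> (bm m))\<^sup>2)"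
      using finL finM
      by (subst sum.Sigma[symmetric, where g="\<lambda>m l. (L2_norm \<mu> (bm m))\<^sup>2", unfolded case_prod_beta]) auto
    also have "\<dots> \<le> (\<Sum>m\<in>M. 2 ^ card S * (L2_norm \<mu> (bm m))\<^sup>2)"
      by (intro sum_mono mult_right_mono card_grid_neighbours[OF S extL]) simp
    also have "\<dots> \<le> 2 ^ card S * (L2_norm \<mu> b)\<^sup>2"
      unfolding sum_distrib_left[symmetric] by (intro mult_left_mono B(3)) simp
    finally show ?thesis .
  qed
  have "fourier_bounded \<mu> (\<lambda>x. \<Sum>p\<in>P. g p x)
    (\<Sum>p\<in>P. \<epsilon>' * sqrt R * ((L2_norm \<mu> (al (fst p)))\<^sup>2 + (L2_norm \<mu> (bm (snd p)))\<^sup>2))"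
    by (intro fourier_bounded_sum near)
  moreover have "(\<Sum>p\<in>P. \<epsilon>' * sqrt R * ((L2_norm \<mu> (al (fst p)))\<^sup>2 + (L2_norm \<mu> (bm (snd p)))\<^sup>2)) \<le> \<epsilon>"
  proof -
    have "(\<Sum>p\<in>P. \<epsilon>' * sqrt R * ((L2_norm \<mu> (al (fst p)))\<^sup>2 + (L2_norm \<mu> (bm (snd p)))\<^sup>2))
      = \<epsilon>' * sqrt R * ((\<Sum>p\<in>P. (L2_norm \<mu> (al (fst p)))\<^sup>2) + (\<Sum>p\<in>P. (L2_norm \<mu> (bm (snd p)))\<^sup>2))"
      by (simp add: sum.distrib flip: sum_distrib_left)
    also have "\<dots> \<le> \<epsilon>' * sqrt R * (2 ^ card S * (L2_norm \<mu> a)\<^sup>2 + 2 ^ card S * (L2_norm \<mu> b)\<^sup>2)"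
      using \<epsilon>' R0 by (intro mult_left_mono add_mono sumA sumB) auto
    also have "\<dots> = \<epsilon>' * Q" by (simp add: Q_def algebra_simps)
    also have "\<dots> \<le> \<epsilon>" using \<open>\<epsilon> > 0\<close> Q0 by (simp add: \<epsilon>'_def divide_simps)
    finally show ?thesis .
  qed
  ultimately have small: "fourier_bounded \<mu> (\<lambda>x. \<Sum>p\<in>P. g p x) \<epsilon>" by (rule fourier_bounded_mono)
  \<comment> \<open>The sum over all other cells belongs to the ideal and serves as the approximant;
    the error is the sum over \<open>P\<close>.\<close>
  let ?h = "\<lambda>x. \<Sum>p\<in>L \<times> M - P. g p x"
  have "f x * regular_coeff \<mu> a b x - ?h x = (\<Sum>p\<in>P. g p x)" for x
    unfolding total using finL finM by (subst sum.subset_diff[of P "L \<times> M"]) (auto simp: P_def)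
  then have "fourier_bounded \<mu> (\<lambda>x. f x * regular_coeff \<mu> a b x - ?h x) \<epsilon>" using small by simp
  moreover have "?h \<in> off_ideal \<mu> (F \<union> E S)" by (intro off_ideal_sum far)
  ultimately show "\<exists>h\<in>off_ideal \<mu> (F \<union> E S). fourier_bounded \<mu> (\<lambda>x. f x * regular_coeff \<mu> a b x - h x) \<epsilon>"
    by (intro bexI[of _ ?h])
qed

text \<open>Induction over proper subsets with \<open>f\<close> arbitrary, because the functions to
  which the hypothesis is applied are products of \<open>f\<close> with pieces of a coefficient. The
  empty \<open>S\<close> goes through the same step: the intersection is then the whole group, and
  \<open>f\<close> is zero.\<close>

lemma off_ideal_sublevel:
  fixes \<phi> :: "'i \<Rightarrow> 'a \<Rightarrow> real" and c :: "'i \<Rightarrow> real"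
  assumes ai: "has_approximate_identity \<mu>"
    and synth: "\<And>g. g \<in> fourier_algebra \<mu> \<Longrightarrow> (\<And>x. x \<in> F \<Longrightarrow> g x = 0) \<Longrightarrow> g \<in> off_ideal \<mu> F"
    and S: "finite S"
    and "\<And>i. i \<in> S \<Longrightarrow> continuous_on UNIV (\<phi> i)"
    and "\<And>i x y. i \<in> S \<Longrightarrow> \<phi> i (x - y) = \<phi> i x - \<phi> i y"
    and "f \<in> fourier_algebra \<mu>" "\<And>x. x \<in> F \<union> {x. \<forall>i\<in>S. \<phi> i x \<le> c i} \<Longrightarrow> f x = 0"
  shows "f \<in> off_ideal \<mu> (F \<union> {x. \<forall>i\<in>S. \<phi> i x \<le> c i})"
  using S assms(4-)
proof (induction S arbitrary: f rule: finite_psubset_induct)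
  case (psubset S)
  show ?case
  proof (rule off_ideal_of_products[OF psubset.prems(3) ai])
    fix a b assume "a \<in> L2 \<mu>" "b \<in> L2 \<mu>"
    then show "(\<lambda>x. f x * regular_coeff \<mu> a b x) \<in> off_ideal \<mu> (F \<union> {x. \<forall>i\<in>S. \<phi> i x \<le> c i})"
    proof (rule off_ideal_coeff_compact[OF psubset.prems(3), rotated])
      fix a b :: "'a \<Rightarrow> complex" and K
      assume L: "a \<in> L2 \<mu>" "b \<in> L2 \<mu>" and K: "compact K" "\<And>x. x \<notin> K \<Longrightarrow> a x = 0 \<and> b x = 0"
      show "(\<lambda>x. f x * regular_coeff \<mu> a b x) \<in> off_ideal \<mu> (F \<union> {x. \<forall>i\<in>S. \<phi> i x \<le> c i})"
      proof (rule off_ideal_step[OF psubset.hyps psubset.prems(1,2) synth _ psubset.prems(3,4) L K])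
        fix i g assume i: "i \<in> S" and g: "g \<in> fourier_algebra \<mu>"
          "\<And>x. x \<in> F \<union> {x. \<forall>i\<in>S - {i}. \<phi> i x \<le> c i} \<Longrightarrow> g x = 0"
        show "g \<in> off_ideal \<mu> (F \<union> {x. \<forall>i\<in>S - {i}. \<phi> i x \<le> c i})"
          by (rule psubset.IH[OF _ _ _ g]) (use i psubset.prems(1,2) in auto)
      qed
    qed
  qed
qed

end

theorem corollary4p3:
  fixes \<mu> :: "'a::{topological_group_add, t2_space, second_countable_topology} measure"
    and \<omega> :: "nat \<Rightarrow> 'a \<Rightarrow> real" and t :: "nat \<Rightarrow> real" and k :: nat and F :: "'a set"
  assumes "locally compact (UNIV :: 'a set)"
    and "left_haar_measure \<mu>"
    and "has_approximate_identity \<mu>"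
    and "1 \<le> k"
    and "\<And>i. i \<in> {1..k} \<Longrightarrow> continuous_hom_pos (\<omega> i)"
    and "\<And>i. i \<in> {1..k} \<Longrightarrow> 0 < t i"
    and "closed F"
    and "spectral_synthesis \<mu> F"
  shows "spectral_synthesis \<mu> (F \<union> (\<Inter>i\<in>{1..k}. sublevel (\<omega> i) (t i)))"
proof -
  interpret haar \<mu> using assms(1,2) by unfold_locales
  \<comment> \<open>The logarithm makes the homomorphisms additive, so that equally spaced levels
    fit with differences \<open>t - s\<close>; positivity of \<open>t i\<close> turns its sublevel
    set into one at level \<open>ln (t i)\<close>.\<close>
  let ?\<phi> = "\<lambda>i x. ln (\<omega> i x)"
  have \<omega>: "continuous_on UNIV (\<omega> i)" "0 < \<omega> i x" "\<omega> i (x + y) = \<omega> i x * \<omega> i y"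
    if "i \<in> {1..k}" for i x y
    using assms(5)[OF that] by (auto simp: continuous_hom_pos_def)
  have cont: "continuous_on UNIV (?\<phi> i)" if "i \<in> {1..k}" for i
    using \<omega>(1,2)[OF that] by (intro continuous_on_ln) (auto simp: less_imp_neq[symmetric])
  have diff: "?\<phi> i (x - y) = ?\<phi> i x - ?\<phi> i y" if "i \<in> {1..k}" for i x y
  proof -
    have "\<omega> i (x - y) * \<omega> i y = \<omega> i x" using \<omega>(3)[OF that, of "x - y" y] by simp
    then show ?thesis
      using ln_mult_pos[OF \<omega>(2)[OF that, of "x - y"] \<omega>(2)[OF that, of y]] by simp
  qed
  have eq: "(\<Inter>i\<in>{1..k}. sublevel (\<omega> i) (t i)) = {x. \<forall>i\<in>{1..k}. ?\<phi> i x \<le> ln (t i)}"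
    using \<omega>(2) assms(6) by (auto simp: sublevel_def)
  have "closed (\<Inter>i\<in>{1..k}. sublevel (\<omega> i) (t i))"
    unfolding sublevel_def using \<omega>(1)
    by (intro closed_INT ballI closed_Collect_le continuous_intros) auto
  moreover have "f \<in> off_ideal \<mu> (F \<union> {x. \<forall>i\<in>{1..k}. ?\<phi> i x \<le> ln (t i)})"
    if "f \<in> fourier_algebra \<mu>" "\<forall>x\<in>F \<union> {x. \<forall>i\<in>{1..k}. ?\<phi> i x \<le> ln (t i)}. f x = 0" for f
  proof (rule off_ideal_sublevel[OF assms(3) _ _ cont diff that(1)])
    show "g \<in> off_ideal \<mu> F" if "g \<in> fourier_algebra \<mu>" "\<And>x. x \<in> F \<Longrightarrow> g x = 0" for g
      using assms(8) that unfolding spectral_synthesis_def by blast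
  qed (use that(2) in auto)
  ultimately show ?thesis
    using assms(7) unfolding spectral_synthesis_def eq by (auto simp: closed_Un)
qed

end
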